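(* Let $r_1,r_2\in\mathbb{R}$ be real squeezing parameters, let $\lambda_2\ge\lambda_1\ge 0$, let $\alpha\in\mathbb{R}$ satisfy $|\alpha|\le e^{-r_1-r_2}$, and let $\theta\in[0,2\pi)$. Put $$\pi_d(r_1,r_2)=\mathrm{diag}\left(e^{-2r_1},\,e^{2r_1},\,e^{2r_2},\,e^{-2r_2}\right),$$ $$v_1=\begin{pmatrix}\alpha\cos\theta\\ \sin\theta\\ \cos\theta\\ \alpha\sin\theta\end{pmatrix},\qquad v_2=\begin{pmatrix}\alpha\sin\theta\\ -\cos\theta\\ \sin\theta\\ -\alpha\cos\theta\end{pmatrix},\qquad \phi_1=v_1v_1^\top,\qquad \phi_2=v_2v_2^\top,$$ $$K_{\mathrm{bs}}=\frac{1}{\sqrt2}\begin{pmatrix} I_2 & I_2\\ -I_2 & I_2\end{pmatrix},$$ where $I_2$ is the $2\times2$ identity matrix, and consider the two-mode Gaussian state with covariance matrix $$\sigma_{\mathrm{sp}}=K_{\mathrm{bs}}\left(\pi_d(r_1,r_2)+\lambda_1\phi_1+\lambda_2\phi_2\right)K_{\mathrm{bs}}^\top .$$ For any state $\sigma_{\mathrm{sp}}$ of this form, the upper bound $\mathcal{P}(\sigma_{\mathrm{sp}})\le h_0[\mathcal{S}(\sigma_{\mathrm{sp}})]$ is saturated, i.e. $$\mathcal{E}(\sigma_{\mathrm{sp}})=\mathcal{P}(\sigma_{\mathrm{sp}})=h_0\left[\mathcal{S}(\sigma_{\mathrm{sp}})\right],$$ where $\mathcal{E}$ is the entanglement of formation,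 $\mathcal{P}$ the entanglement of formation potential, $\mathcal{S}$ the squeezing of formation, and $h_0$ the auxiliary function given in the context.
   Context: **Gaussian states.** An $N$-mode Gaussian state (with zero mean) is identified with its covariance matrix $\sigma$ in the quadrature ordering $(\hat x_1,\hat p_1,\dots,\hat x_N,\hat p_N)$. This is a real symmetric $2N\times 2N$ matrix with $\sigma+i\Omega\ge 0$, where $\Omega=\bigoplus_{j=1}^N\begin{pmatrix}0&1\\-1&0\end{pmatrix}$. The vacuum has covariance matrix the identity. The state is pure if and only if $\det\sigma=1$; pure states are denoted $\pi$. The symplectic eigenvalues of a real symmetric positive definite $2N\times2N$ matrix $\sigma$ are the positive eigenvalues of $i\Omega\sigma$. In increasing order they are written $\nu_1^\uparrow(\sigma)\le\dots\le\nu_N^\uparrow(\sigma)$. The ordinary eigenvalues in increasing order are written $\lambda_1^\uparrow(\sigma)\le\dots\le\lambda_{2N}^\uparrow(\sigma)$. For a two-mode state, the partial transpose is $\sigma^\Gamma=P\sigma P$ with $P=\mathrm{diag}(1,1,1,-1)$. A passive transformation on $N$ modes is a real $2N\times2N$ matrix $K$ that is both orthogonal and symplectic ($K\Omega K^\top=\Omega$). It acts by $\sigma\mapsto K\sigma K^\top$. **Auxiliary functions.** For $0<x\le1$, $$h[x]=\frac{(1+x)^2}{4x}\ln\frac{(1+x)^2}{4x}-\frac{(1-x)^2}{4x}\ln\frac{(1-x)^2}{4x},$$ with the convention $0\ln0=0$. For $x\ge 0$, $h_0[x]=h[e^{-x}]$. **Squeezing of formation (SOF).** For a pure $N$-mode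 Gaussian state $\pi$, $$\mathcal{S}(\pi)=-\frac12\sum_{j=1}^N\ln\lambda_j^\uparrow(\pi)=\frac12\sum_{j=N+1}^{2N}\ln\lambda_j^\uparrow(\pi).$$ For a general Gaussian state $\sigma$, $$\mathcal{S}(\sigma)=\min_\pi\{\mathcal{S}(\pi)\mid \sigma-\pi\ge0,\ \det\pi=1\},$$ where the minimum is over covariance matrices $\pi$ of pure Gaussian states on the same modes. **Entanglement of formation (EOF).** For a pure two-mode Gaussian state $\pi$ (for which $\nu_1^\uparrow(\pi^\Gamma)\le 1$), $$\mathcal{E}(\pi)=\max\{0,\,h[\nu_1^\uparrow(\pi^\Gamma)]\}.$$ For a general two-mode Gaussian state $\sigma$, $$\mathcal{E}(\sigma)=\min_\pi\{\mathcal{E}(\pi)\mid\sigma-\pi\ge0,\ \det\pi=1\},$$ where the minimum is over covariance matrices $\pi$ of pure two-mode Gaussian states. **EOF potential.** For a two-mode Gaussian state $\sigma$, $$\mathcal{P}(\sigma)=\sup_K\left\{\mathcal{E}(\sigma')\ \middle|\ \sigma'=\mathrm{tr}_2\left[K(\sigma\oplus I_4)K^\top\right]\right\}.$$ Here $K$ ranges over all four-mode passive transformations ($8\times8$ real orthogonal symplectic matrices), $I_4$ is the $4\times4$ identity matrix (the covariance matrix of two ancillary vacuum modes), and $\mathrm{tr}_2$ denotes tracing out the two ancillary modes, i.e. keeping only the upper-left $4\times4$ block corresponding to the first two modes. It is known that $\mathcal{P}(\sigma)\le h_0[\mathcal{S}(\sigma)]$ for every two-mode Gaussian state $\sigma$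.
   Formalization: The squeezing parameters are assumed nonnegative, r_1, r_2 ≥ 0, since for arbitrary real values the claim fails: with r_1=1, r_2=-1, λ_1=λ_2=α=0 the state is a product state with zero entanglement of formation but squeezing of formation 2. *)

theory Defs
  imports
    Complex_Main
    "HOL-Computational_Algebra.Fundamental_Theorem_Algebra"
    "Jordan_Normal_Form.Schur_Decomposition"
begin

text \<open>
  Covariance matrices of \<open>N\<close> modes are matrices of dimension \<open>2 * N\<close> in the ordering
  \<open>x_1, p_1, ..., x_N, p_N\<close>. All indices start from \<open>0\<close>.
\<close>

definition psd :: "nat \<Rightarrow> 'a :: conjugatable_ordered_field mat \<Rightarrow> bool" where
  "psd n A \<longleftrightarrow> A \<in> carrier_mat n n \<and> mat_adjoint A = A \<and>
     (\<forall>v \<in> carrier_vec n. 0 \<le> (A *\<^sub>v v) \<bullet>c v)"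

definition Omega :: "nat \<Rightarrow> real mat" where
  "Omega N = diag_block_mat (replicate N (mat_of_rows_list 2 [[0, 1], [-1, 0]]))"

abbreviation cmat :: "real mat \<Rightarrow> complex mat" where
  "cmat A \<equiv> map_mat complex_of_real A"

definition gaussian_state :: "nat \<Rightarrow> real mat \<Rightarrow> bool" where
  "gaussian_state N \<sigma> \<longleftrightarrow> \<sigma> \<in> carrier_mat (2 * N) (2 * N) \<and> \<sigma>\<^sup>T = \<sigma> \<and>
     psd (2 * N) (cmat \<sigma> + \<i> \<cdot>\<^sub>m cmat (Omega N))"

definition pure_state :: "nat \<Rightarrow> real mat \<Rightarrow> bool" where
  "pure_state N \<pi> \<longleftrightarrow> gaussian_state N \<pi> \<and> det \<pi> = 1"

text \<open>Eigenvalues are listed with their algebraic multiplicity, in increasing order.\<close>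

definition eigs_up :: "real mat \<Rightarrow> real list" where
  "eigs_up A = sorted_list_of_multiset (proots (char_poly A))"

definition symp_eigs_up :: "nat \<Rightarrow> real mat \<Rightarrow> real list" where
  "symp_eigs_up N \<sigma> = sorted_list_of_multiset (image_mset Re
     (filter_mset (\<lambda>z. z \<in> \<real> \<and> 0 < Re z) (proots (char_poly (\<i> \<cdot>\<^sub>m cmat (Omega N * \<sigma>))))))"

definition partial_transpose :: "real mat \<Rightarrow> real mat" where
  "partial_transpose \<sigma> = (let P = mat_diag 4 (\<lambda>i. if i = 3 then -1 else 1) in P * \<sigma> * P)"

definition passive_transf :: "nat \<Rightarrow> real mat \<Rightarrow> bool" where
  "passive_transf N K \<longleftrightarrow> K \<in> carrier_mat (2 * N) (2 * N) \<and>
     K * K\<^sup>T = 1\<^sub>m (2 * N) \<and> K * Omega N * K\<^sup>T = Omega N"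

text \<open>At \<open>x = 1\<close> the convention \<open>0 ln 0 = 0\<close> is automatic. Values for \<open>x \<le> 0\<close> are irrelevant.\<close>

definition h :: "real \<Rightarrow> real" where
  "h x = (1 + x)\<^sup>2 / (4 * x) * ln ((1 + x)\<^sup>2 / (4 * x)) -
         (1 - x)\<^sup>2 / (4 * x) * ln ((1 - x)\<^sup>2 / (4 * x))"

definition h0 :: "real \<Rightarrow> real" where
  "h0 x = h (exp (- x))"

text \<open>
  The minima over pure states below are taken as infima in \<open>real\<close>. For a Gaussian state the sets are
  nonempty, bounded below by \<open>0\<close>, and attain their infimum by compactness.
\<close>

definition sof_pure :: "nat \<Rightarrow> real mat \<Rightarrow> real" where
  "sof_pure N \<pi> = - (1 / 2) * (\<Sum>j < N. ln (eigs_up \<pi> ! j))"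

definition sof :: "nat \<Rightarrow> real mat \<Rightarrow> real" where
  "sof N \<sigma> = Inf {sof_pure N \<pi> | \<pi>. pure_state N \<pi> \<and> psd (2 * N) (\<sigma> - \<pi>)}"

definition eof_pure :: "real mat \<Rightarrow> real" where
  "eof_pure \<pi> = max 0 (h (symp_eigs_up 2 (partial_transpose \<pi>) ! 0))"

definition eof :: "real mat \<Rightarrow> real" where
  "eof \<sigma> = Inf {eof_pure \<pi> | \<pi>. pure_state 2 \<pi> \<and> psd 4 (\<sigma> - \<pi>)}"

definition trace_out_ancillas :: "real mat \<Rightarrow> real mat" where
  "trace_out_ancillas A = mat 4 4 (\<lambda>ij. A $$ ij)"

definition eof_potential :: "real mat \<Rightarrow> real" where
  "eof_potential \<sigma> =
     Sup {eof (trace_out_ancillas (K * diag_block_mat [\<sigma>, 1\<^sub>m 4] * K\<^sup>T)) | K. passive_transf 4 K}"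

text \<open>
  Pitfall: \<open>pi_d r1 r2\<close> has squeezing \<open>\<bar>r1\<bar> + \<bar>r2\<bar>\<close>, but behind the beam splitter its entanglement
  depends on \<open>\<bar>r1 + r2\<bar>\<close>. At \<open>r1 = 1\<close>, \<open>r2 = -1\<close> it is left a product state, although its
  squeezing of formation is \<open>2\<close>. The squeezing parameters have to be nonnegative for the
  saturation result.
\<close>

definition pi_d :: "real \<Rightarrow> real \<Rightarrow> real mat" where
  "pi_d r1 r2 = mat_diag 4 (\<lambda>i. [exp (-2 * r1), exp (2 * r1), exp (2 * r2), exp (-2 * r2)] ! i)"

definition v1 :: "real \<Rightarrow> real \<Rightarrow> real vec" where
  "v1 \<alpha> \<theta> = vec_of_list [\<alpha> * cos \<theta>, sin \<theta>, cos \<theta>, \<alpha> * sin \<theta>]"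

definition v2 :: "real \<Rightarrow> real \<Rightarrow> real vec" where
  "v2 \<alpha> \<theta> = vec_of_list [\<alpha> * sin \<theta>, - cos \<theta>, sin \<theta>, - \<alpha> * cos \<theta>]"

definition outer :: "real vec \<Rightarrow> real mat" where
  "outer v = mat (dim_vec v) (dim_vec v) (\<lambda>(i, j). v $ i * v $ j)"

definition K_bs :: "real mat" where
  "K_bs = (1 / sqrt 2) \<cdot>\<^sub>m four_block_mat (1\<^sub>m 2) (1\<^sub>m 2) (- 1\<^sub>m 2) (1\<^sub>m 2)"

definition sigma_sp :: "real \<Rightarrow> real \<Rightarrow> real \<Rightarrow> real \<Rightarrow> real \<Rightarrow> real \<Rightarrow> real mat" where
  "sigma_sp r1 r2 l1 l2 \<alpha> \<theta> =
     K_bs * (pi_d r1 r2 + l1 \<cdot>\<^sub>m outer (v1 \<alpha> \<theta>) + l2 \<cdot>\<^sub>m outer (v2 \<alpha> \<theta>)) * K_bs\<^sup>T"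

end

theory Submission
  imports Defs
begin

text \<open>
  Write \<open>r = r1 + r2\<close> and let \<open>\<pi>\<close> be the squeezed state \<open>pi_d\<close> behind the beam splitter, so that
  \<open>\<pi> \<le> \<sigma>_sp\<close> has squeezing \<open>r\<close>. All three quantities are governed by \<open>\<pi>\<close>.

  The noise vectors \<open>v1\<close>, \<open>v2\<close> span the same plane for every \<open>\<theta>\<close>, and a pure state below \<open>\<sigma>_sp\<close> has at most
  the variances of \<open>\<pi>\<close> on the orthogonal complement of this plane. The uncertainty relation turns these two
  numbers into a lower bound on its entanglement, and \<open>\<bar>\<alpha>\<bar> \<le> exp (- r)\<close> is exactly the condition under
  which the bound is the entanglement \<open>h0 r\<close> of \<open>\<pi>\<close>.

  Conversely, for a passive \<open>K\<close> the output of \<open>K\<close> dominates the reduction of the pure four-mode state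
  \<open>K (\<pi> \<oplus> 1) K\<^sup>T\<close>. Projecting its ancillas onto the vacuum leaves a pure two-mode state below that
  reduction. Its symplectic eigenvalue after partial transposition is at least \<open>exp (- r)\<close>, because in the
  four-mode state the product of any two eigenvalues is at least \<open>exp (- 2 * r)\<close>. Hence its
  entanglement is at most \<open>h0 r\<close>. The same eigenvalue estimate bounds the squeezing of a pure state from
  below by its entanglement.
\<close>

section \<open>Quadratic forms and positive semidefinite matrices\<close>

text \<open>The lower bound rests on the orientation of the noiseless plane: behind the beam
  splitter it is spanned by one pure position direction and one pure momentum direction. The
  uncertainty relation bounds the momentum form from below by the inverse of the position block, so
  both variance constraints become constraints on the position block alone, and after scaling that
  block to determinant 1 a planar inequality remains. The same block bounds the invariant of the
  partial transpose from below, which closes the argument without Williamson's normal form. The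
  upper bound meets the obstacle that the reduction of a pure four-mode state is mixed, so its
  entanglement is itself a minimum. Conditioning on a vacuum outcome produces a pure competitor at
  once; the delicate point is its determinant, since purity is defined by it. No compactness enters:
  each infimum and the supremum is attained at an explicit candidate, \<open>pi_bs\<close> or the
  identity.\<close>

lemma scalar_prod_mult_mat_vec:
  fixes A :: "'a :: comm_semiring_0 mat"
  assumes "A \<in> carrier_mat n m" "x \<in> carrier_vec n" "y \<in> carrier_vec m"
  shows "x \<bullet> (A *\<^sub>v y) = (\<Sum>i<n. \<Sum>j<m. A $$ (i, j) * (x $ i * y $ j))"
  using assms
  by (auto simp: scalar_prod_def row_def sum_distrib_left atLeast0LessThan ac_simps intro!: sum.cong)

lemma scalar_prod_transpose:
  fixes A :: "'a :: comm_semiring_0 mat"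
  assumes "A \<in> carrier_mat n m" "x \<in> carrier_vec n" "y \<in> carrier_vec m"
  shows "x \<bullet> (A *\<^sub>v y) = (A\<^sup>T *\<^sub>v x) \<bullet> y"
  using assms by (metis transpose_vec_mult_scalar)

lemma scalar_prod_sym_mat:
  fixes A :: "'a :: comm_semiring_0 mat"
  assumes "A \<in> carrier_mat n n" "A\<^sup>T = A" "x \<in> carrier_vec n" "y \<in> carrier_vec n"
  shows "x \<bullet> (A *\<^sub>v y) = y \<bullet> (A *\<^sub>v x)"
  using assms by (metis comm_scalar_prod mult_mat_vec_carrier scalar_prod_transpose)

lemma scalar_prod_antisym_mat:
  fixes A :: "'a :: comm_ring_1 mat"
  assumes "A \<in> carrier_mat n n" "A\<^sup>T = - A" "x \<in> carrier_vec n" "y \<in> carrier_vec n"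
  shows "x \<bullet> (A *\<^sub>v y) = - (y \<bullet> (A *\<^sub>v x))"
proof -
  have "x \<bullet> (A *\<^sub>v y) = (- A *\<^sub>v x) \<bullet> y"
    using assms by (simp add: scalar_prod_transpose)
  also have "\<dots> = - ((A *\<^sub>v x) \<bullet> y)"
    using assms by (simp add: uminus_mult_mat_vec)
  finally show ?thesis
    using assms by (metis comm_scalar_prod mult_mat_vec_carrier)
qed

lemma scalar_prod_self_nonneg: "0 \<le> (x :: real vec) \<bullet> x"
  by (auto simp: scalar_prod_def intro!: sum_nonneg)

lemma congruence_quadratic_form:
  fixes A K :: "'a :: comm_semiring_0 mat"
  assumes "K \<in> carrier_mat n m" "A \<in> carrier_mat m m" "x \<in> carrier_vec n" "y \<in> carrier_vec n"
  shows "x \<bullet> (K * A * K\<^sup>T *\<^sub>v y) = (K\<^sup>T *\<^sub>v x) \<bullet> (A *\<^sub>v (K\<^sup>T *\<^sub>v y))"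
proof -
  have "K * A * K\<^sup>T *\<^sub>v y = K *\<^sub>v (A *\<^sub>v (K\<^sup>T *\<^sub>v y))"
    using assms by (smt (verit) assoc_mult_mat_vec mult_carrier_mat mult_mat_vec_carrier transpose_carrier_mat)
  then show ?thesis
    using assms by (simp add: scalar_prod_transpose[of K n m])
qed

lemma mat_adjoint_real: "mat_adjoint (A :: real mat) = A\<^sup>T"
  by (rule eq_matI) (auto simp: mat_adjoint_def mat_of_rows_def)

lemma psd_real_iff:
  fixes A :: "real mat"
  assumes "A \<in> carrier_mat n n"
  shows "psd n A \<longleftrightarrow> A\<^sup>T = A \<and> (\<forall>x \<in> carrier_vec n. 0 \<le> x \<bullet> (A *\<^sub>v x))"
proof -
  have "(A *\<^sub>v x) \<bullet>c x = x \<bullet> (A *\<^sub>v x)" if "x \<in> carrier_vec n" for x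
    using that assms comm_scalar_prod[of x n "A *\<^sub>v x"]
    by (metis conjugate_real_def conjugate_vec_def dim_vec index_vec eq_vecI mult_mat_vec_carrier
        dim_vec_conjugate vec_index_conjugate)
  then show ?thesis
    using assms by (auto simp: psd_def mat_adjoint_real)
qed

lemma mat_adjoint_index:
  "i < dim_col A \<Longrightarrow> j < dim_row A \<Longrightarrow> mat_adjoint A $$ (i, j) = conjugate (A $$ (j, i))"
  by (simp add: mat_adjoint_def mat_of_rows_def)

lemma dim_mat_adjoint: "dim_row (mat_adjoint A) = dim_col A" "dim_col (mat_adjoint A) = dim_row A"
  by (auto simp: mat_adjoint_def mat_of_rows_def)

lemma antisym_index:
  fixes J :: "'a :: comm_ring_1 mat"
  assumes "J \<in> carrier_mat n n" "J\<^sup>T = - J" "i < n" "j < n"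
  shows "J $$ (i, j) = - J $$ (j, i)"
proof -
  have "J $$ (i, j) = J\<^sup>T $$ (j, i)" using assms(1,3,4) by simp
  also have "\<dots> = - J $$ (j, i)" unfolding assms(2) using assms(1,3,4) by simp
  finally show ?thesis .
qed

lemma sym_index:
  assumes "S \<in> carrier_mat n n" "S\<^sup>T = S" "i < n" "j < n"
  shows "S $$ (i, j) = S $$ (j, i)"
  using assms by (metis carrier_matD index_transpose_mat(1))

lemma antisym_quadratic_form:
  fixes J :: "'a :: field_char_0 mat"
  assumes "J \<in> carrier_mat n n" "J\<^sup>T = - J" "x \<in> carrier_vec n"
  shows "x \<bullet> (J *\<^sub>v x) = 0"
  using scalar_prod_antisym_mat[OF assms(1,2,3,3)] by (simp add: eq_neg_iff_add_eq_0 flip: mult_2)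

text \<open>For v = x + i y the imaginary part of the form cancels by the symmetry of S and the
  antisymmetry of J, and the two J terms add up. This trades the complex condition for an inequality
  between real forms, the shape in which the uncertainty relation is used throughout.\<close>

lemma psd_complex_iff:
  fixes S J :: "real mat"
  assumes S: "S \<in> carrier_mat n n" "S\<^sup>T = S" and J: "J \<in> carrier_mat n n" "J\<^sup>T = - J"
  shows "psd n (cmat S + \<i> \<cdot>\<^sub>m cmat J) \<longleftrightarrow>
    (\<forall>x \<in> carrier_vec n. \<forall>y \<in> carrier_vec n.
       2 * (x \<bullet> (J *\<^sub>v y)) \<le> x \<bullet> (S *\<^sub>v x) + y \<bullet> (S *\<^sub>v y))"
proof -
  let ?A = "cmat S + \<i> \<cdot>\<^sub>m cmat J"
  have A: "?A \<in> carrier_mat n n" using S J by auto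
  have adj: "mat_adjoint ?A = ?A"
    using S J
    by (intro eq_matI)
      (auto simp: dim_mat_adjoint mat_adjoint_index complex_eq_iff sym_index[OF S]
        intro: antisym_index[OF J, symmetric])
  have form: "(?A *\<^sub>v v) \<bullet>c v =
      of_real (x \<bullet> (S *\<^sub>v x) + y \<bullet> (S *\<^sub>v y) - 2 * (x \<bullet> (J *\<^sub>v y)))"
    if v: "v \<in> carrier_vec n" and x: "x = map_vec Re v" and y: "y = map_vec Im v" for v x y
  proof -
    have xy: "x \<in> carrier_vec n" "y \<in> carrier_vec n" using v x y by auto
    have "(?A *\<^sub>v v) \<bullet>c v = conjugate v \<bullet> (?A *\<^sub>v v)"
      using A v by (metis comm_scalar_prod carrier_vec_conjugate mult_mat_vec_carrier)
    also have "\<dots> = (\<Sum>i<n. \<Sum>j<n. ?A $$ (i, j) * (cnj (v $ i) * v $ j))"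
      using scalar_prod_mult_mat_vec[OF A, of "conjugate v" v] v by simp
    also have "\<dots> = (\<Sum>i<n. \<Sum>j<n.
        of_real (S $$ (i, j) * (x $ i * x $ j) + S $$ (i, j) * (y $ i * y $ j)
          - J $$ (i, j) * (x $ i * y $ j) + J $$ (i, j) * (y $ i * x $ j)) +
        \<i> * of_real (J $$ (i, j) * (x $ i * x $ j) + J $$ (i, j) * (y $ i * y $ j)
          + S $$ (i, j) * (x $ i * y $ j) - S $$ (i, j) * (y $ i * x $ j)))"
      using S J v unfolding x y
      by (intro sum.cong) (auto simp: complex_eq_iff algebra_simps)
    also have "\<dots> = of_real (x \<bullet> (S *\<^sub>v x) + y \<bullet> (S *\<^sub>v y) - x \<bullet> (J *\<^sub>v y) + y \<bullet> (J *\<^sub>v x)) +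
        \<i> * of_real (x \<bullet> (J *\<^sub>v x) + y \<bullet> (J *\<^sub>v y) + x \<bullet> (S *\<^sub>v y) - y \<bullet> (S *\<^sub>v x))"
      using S(1) J(1) xy
      by (simp add: scalar_prod_mult_mat_vec sum.distrib sum_subtractf flip: sum_distrib_left)
    also have "\<dots> = of_real (x \<bullet> (S *\<^sub>v x) + y \<bullet> (S *\<^sub>v y) - 2 * (x \<bullet> (J *\<^sub>v y)))"
      using scalar_prod_antisym_mat[OF J xy(2,1)] scalar_prod_sym_mat[OF S xy]
        antisym_quadratic_form[OF J xy(1)] antisym_quadratic_form[OF J xy(2)]
      by simp
    finally show ?thesis .
  qed
  show ?thesis
  proof
    assume psd: "psd n ?A"
    show "\<forall>x \<in> carrier_vec n. \<forall>y \<in> carrier_vec n.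
       2 * (x \<bullet> (J *\<^sub>v y)) \<le> x \<bullet> (S *\<^sub>v x) + y \<bullet> (S *\<^sub>v y)"
    proof (intro ballI)
      fix x y :: "real vec" assume xy: "x \<in> carrier_vec n" "y \<in> carrier_vec n"
      define v where "v = vec n (\<lambda>i. Complex (x $ i) (y $ i))"
      have v: "v \<in> carrier_vec n" "x = map_vec Re v" "y = map_vec Im v"
        using xy by (auto simp: v_def)
      have "0 \<le> (?A *\<^sub>v v) \<bullet>c v" using psd v(1) by (auto simp: psd_def)
      then show "2 * (x \<bullet> (J *\<^sub>v y)) \<le> x \<bullet> (S *\<^sub>v x) + y \<bullet> (S *\<^sub>v y)"
        unfolding form[OF v] by (simp add: less_eq_complex_def)
    qed
  next
    assume *: "\<forall>x \<in> carrier_vec n. \<forall>y \<in> carrier_vec n.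
       2 * (x \<bullet> (J *\<^sub>v y)) \<le> x \<bullet> (S *\<^sub>v x) + y \<bullet> (S *\<^sub>v y)"
    have "0 \<le> (?A *\<^sub>v v) \<bullet>c v" if v: "v \<in> carrier_vec n" for v
      using * v unfolding form[OF v refl refl] by (simp add: less_eq_complex_def)
    then show "psd n ?A" using A adj by (auto simp: psd_def)
  qed
qed

section \<open>Determinants of positive semidefinite complex matrices\<close>

lemma prod_list_complex_nonneg:
  "(\<And>a. a \<in> set as \<Longrightarrow> 0 \<le> a) \<Longrightarrow> (0 :: complex) \<le> prod_list as"
proof (induction as)
  case (Cons a as)
  then have "0 \<le> a" "0 \<le> prod_list as" by auto
  then show ?case by (auto simp: less_eq_complex_def)
qed (simp add: less_eq_complex_def)

lemma det_eq_prod_roots: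
  fixes A :: "'a :: field mat"
  assumes A: "A \<in> carrier_mat n n" and as: "char_poly A = (\<Prod>a\<leftarrow>as. [:- a, 1:])" "length as = n"
  shows "det A = prod_list as"
proof -
  have neg: "- char_matrix A 0 = (-1) \<cdot>\<^sub>m A"
    using A by (intro eq_matI) (auto simp: char_matrix_def)
  have "poly (char_poly A) 0 = (-1) ^ n * det A"
    unfolding char_poly_matrix[OF A] neg using A by simp
  moreover have "poly (\<Prod>a\<leftarrow>bs. [:- a, 1:]) 0 = (-1) ^ length bs * prod_list bs" for bs :: "'a list"
    by (induction bs) auto
  ultimately have "(-1) ^ n * det A = (-1) ^ n * prod_list as" using as by simp
  then show ?thesis by simp
qed

text \<open>The determinant is the product of the eigenvalues, each of which is a nonnegative
  Rayleigh quotient. Applied to S + i m J it turns positivity into a polynomial inequality between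
  symplectic invariants.\<close>

lemma det_psd_nonneg:
  fixes A :: "complex mat"
  assumes "psd n A"
  shows "0 \<le> det A"
proof -
  have A: "A \<in> carrier_mat n n" using assms by (simp add: psd_def)
  obtain as where as: "char_poly A = (\<Prod>a\<leftarrow>as. [:- a, 1:])" "length as = n"
    using char_poly_factorized[OF A] by blast
  have "0 \<le> a" if "a \<in> set as" for a
  proof -
    have "poly (char_poly A) a = 0"
      using that unfolding as(1) by (induction as) auto
    then have "eigenvalue A a" using eigenvalue_root_char_poly[OF A] by simp
    then obtain v where v: "v \<in> carrier_vec n" "v \<noteq> 0\<^sub>v n" "A *\<^sub>v v = a \<cdot>\<^sub>v v"
      using A by (auto simp: eigenvalue_def eigenvector_def)
    have "0 \<le> (A *\<^sub>v v) \<bullet>c v" using assms v(1) by (simp add: psd_def)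
    then have *: "0 \<le> a * (v \<bullet>c v)" using v by simp
    have "0 < v \<bullet>c v" using conjugate_square_greater_0_vec[OF v(1)] v(2) by simp
    with * show ?thesis
      by (auto simp: less_eq_complex_def less_complex_def zero_le_mult_iff)
  qed
  then show ?thesis
    unfolding det_eq_prod_roots[OF A as] by (rule prod_list_complex_nonneg)
qed

section \<open>Small determinants and the symplectic form\<close>

lemma sum_lessThan_4: "sum f {..<4::nat} = f 0 + f 1 + f 2 + (f 3 :: 'a :: comm_monoid_add)"
  by (simp add: eval_nat_numeral)

lemma det_2:
  fixes A :: "'a :: comm_ring_1 mat"
  assumes "A \<in> carrier_mat 2 2"
  shows "det A = A $$ (0,0) * A $$ (1,1) - A $$ (0,1) * A $$ (1,0)"
  using assms
  by (simp add: laplace_expansion_row[of _ 2 0] cofactor_def mat_delete_def det_single numeral_2_eq_2)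

lemma det_3:
  fixes A :: "'a :: comm_ring_1 mat"
  assumes "A \<in> carrier_mat 3 3"
  shows "det A =
    A $$ (0,0) * (A $$ (1,1) * A $$ (2,2) - A $$ (1,2) * A $$ (2,1))
    - A $$ (0,1) * (A $$ (1,0) * A $$ (2,2) - A $$ (1,2) * A $$ (2,0))
    + A $$ (0,2) * (A $$ (1,0) * A $$ (2,1) - A $$ (1,1) * A $$ (2,0))"
proof -
  have del: "mat_delete A i j \<in> carrier_mat 2 2" for i j
    using mat_delete_carrier[OF assms, of i j] by simp
  have idx: "mat_delete A 0 j $$ (k, l) = A $$ (Suc k, if l < j then l else Suc l)"
    if "k < 2" "l < 2" for j k l
    using that assms by (simp add: mat_delete_def)
  have "det A = (\<Sum>j<3. A $$ (0,j) * cofactor A 0 j)"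
    using assms by (intro laplace_expansion_row) auto
  also have "\<dots> = A $$ (0,0) * cofactor A 0 0 + A $$ (0,1) * cofactor A 0 1
      + A $$ (0,2) * cofactor A 0 2"
    by (simp add: eval_nat_numeral)
  finally show ?thesis
    by (simp add: cofactor_def det_2[OF del] idx eval_nat_numeral algebra_simps)
qed

lemma det_4:
  fixes A :: "'a :: comm_ring_1 mat"
  assumes "A \<in> carrier_mat 4 4"
  shows "det A =
    A $$ (0,0) * (A $$ (1,1) * (A $$ (2,2) * A $$ (3,3) - A $$ (2,3) * A $$ (3,2))
      - A $$ (1,2) * (A $$ (2,1) * A $$ (3,3) - A $$ (2,3) * A $$ (3,1))
      + A $$ (1,3) * (A $$ (2,1) * A $$ (3,2) - A $$ (2,2) * A $$ (3,1)))
    - A $$ (0,1) * (A $$ (1,0) * (A $$ (2,2) * A $$ (3,3) - A $$ (2,3) * A $$ (3,2))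
      - A $$ (1,2) * (A $$ (2,0) * A $$ (3,3) - A $$ (2,3) * A $$ (3,0))
      + A $$ (1,3) * (A $$ (2,0) * A $$ (3,2) - A $$ (2,2) * A $$ (3,0)))
    + A $$ (0,2) * (A $$ (1,0) * (A $$ (2,1) * A $$ (3,3) - A $$ (2,3) * A $$ (3,1))
      - A $$ (1,1) * (A $$ (2,0) * A $$ (3,3) - A $$ (2,3) * A $$ (3,0))
      + A $$ (1,3) * (A $$ (2,0) * A $$ (3,1) - A $$ (2,1) * A $$ (3,0)))
    - A $$ (0,3) * (A $$ (1,0) * (A $$ (2,1) * A $$ (3,2) - A $$ (2,2) * A $$ (3,1))
      - A $$ (1,1) * (A $$ (2,0) * A $$ (3,2) - A $$ (2,2) * A $$ (3,0))
      + A $$ (1,2) * (A $$ (2,0) * A $$ (3,1) - A $$ (2,1) * A $$ (3,0)))"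
proof -
  have del: "mat_delete A i j \<in> carrier_mat 3 3" for i j
    using mat_delete_carrier[OF assms, of i j] by simp
  have idx: "mat_delete A 0 j $$ (k, l) = A $$ (Suc k, if l < j then l else Suc l)"
    if "k < 3" "l < 3" for j k l
    using that assms by (simp add: mat_delete_def)
  have "det A = (\<Sum>j<4. A $$ (0,j) * cofactor A 0 j)"
    using assms by (intro laplace_expansion_row) auto
  also have "\<dots> = A $$ (0,0) * cofactor A 0 0 + A $$ (0,1) * cofactor A 0 1
      + A $$ (0,2) * cofactor A 0 2 + A $$ (0,3) * cofactor A 0 3"
    by (rule sum_lessThan_4)
  finally show ?thesis
    by (simp add: cofactor_def det_3[OF del] idx eval_nat_numeral algebra_simps)
qed

lemma Omega_carrier [simp]: "Omega N \<in> carrier_mat (2 * N) (2 * N)"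
proof -
  have "dim_row (Omega N) = 2 * N" "dim_col (Omega N) = 2 * N"
    by (induction N) (auto simp: Omega_def Let_def mat_of_rows_list_def)
  then show ?thesis by auto
qed

lemma dim_Omega [simp]: "dim_row (Omega N) = 2 * N" "dim_col (Omega N) = 2 * N"
  using Omega_carrier[of N] by (auto simp del: Omega_carrier)

lemma mult_block_diag:
  fixes A :: "'a :: semiring_0 mat"
  assumes "A \<in> carrier_mat n n" "A' \<in> carrier_mat n n" "B \<in> carrier_mat m m" "B' \<in> carrier_mat m m"
  shows "four_block_mat A (0\<^sub>m n m) (0\<^sub>m m n) B * four_block_mat A' (0\<^sub>m n m) (0\<^sub>m m n) B' =
    four_block_mat (A * A') (0\<^sub>m n m) (0\<^sub>m m n) (B * B')"
  using assms
  by (subst mult_four_block_mat[of _ n n _ m _ m _ _ n _ m])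
    (simp_all add: left_mult_zero_mat[of _ m] left_mult_zero_mat[of _ n]
      right_mult_zero_mat[of _ m] right_mult_zero_mat[of _ n])

lemma transpose_block_diag:
  assumes "A \<in> carrier_mat n n" "B \<in> carrier_mat m m"
  shows "(four_block_mat A (0\<^sub>m n m) (0\<^sub>m m n) B)\<^sup>T =
    four_block_mat (A\<^sup>T) (0\<^sub>m n m) (0\<^sub>m m n) (B\<^sup>T)"
proof -
  have "(0\<^sub>m n m)\<^sup>T = (0\<^sub>m m n :: 'a mat)" "(0\<^sub>m m n)\<^sup>T = (0\<^sub>m n m :: 'a mat)" by auto
  then show ?thesis
    using assms by (simp add: transpose_four_block_mat[of _ n n _ m _ m])
qed

lemma Omega_add:
  "Omega (M + N) = four_block_mat (Omega M) (0\<^sub>m (2 * M) (2 * N)) (0\<^sub>m (2 * N) (2 * M)) (Omega N)"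
  using Omega_carrier[of M] Omega_carrier[of N]
  unfolding Omega_def replicate_add diag_block_mat_append Let_def by auto

lemma Omega_1: "Omega 1 = mat_of_rows_list 2 [[0, 1], [-1, 0]]"
  by (simp add: Omega_def del: diag_block_mat.simps)

lemma Omega_2: "Omega 2 = mat 4 4 (\<lambda>(i, j).
  [[0, 1, 0, 0], [-1, 0, 0, 0], [0, 0, 0, 1], [0, 0, -1, 0]] ! i ! j)"
proof -
  have "Omega 2 = Omega (1 + 1)" by (simp add: numeral_2_eq_2)
  also have "\<dots> = mat 4 4 (\<lambda>(i, j).
      [[0, 1, 0, 0], [-1, 0, 0, 0], [0, 0, 0, 1], [0, 0, -1, 0]] ! i ! j)"
    unfolding Omega_add Omega_1
    by (rule eq_matI) (auto simp: mat_of_rows_list_def less_Suc_eq numeral_eq_Suc)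
  finally show ?thesis .
qed

lemma Omega_transpose: "(Omega N)\<^sup>T = - Omega N"
proof (induction N)
  case 0
  show ?case by (rule eq_matI) (auto simp: Omega_def)
next
  case (Suc N)
  have 1: "Omega 1 \<in> carrier_mat 2 2" "(Omega 1)\<^sup>T = - Omega 1"
    unfolding Omega_1 by (auto simp: mat_of_rows_list_def less_Suc_eq numeral_2_eq_2 intro!: eq_matI)
  have *: "Omega (Suc N) = four_block_mat (Omega 1) (0\<^sub>m 2 (2 * N)) (0\<^sub>m (2 * N) 2) (Omega N)"
    using Omega_add[of 1 N] by simp
  show ?case
    unfolding * transpose_block_diag[OF 1(1) Omega_carrier] Suc 1(2)
    using Omega_carrier[of 1] by (intro eq_matI) (auto simp del: Omega_carrier)
qed

lemma Omega_square: "Omega N * Omega N = - 1\<^sub>m (2 * N)"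
proof (induction N)
  case 0
  show ?case by (rule eq_matI) (auto simp: Omega_def)
next
  case (Suc N)
  have 1: "Omega 1 \<in> carrier_mat 2 2" "Omega 1 * Omega 1 = - 1\<^sub>m 2"
    unfolding Omega_1
    by (auto simp: mat_of_rows_list_def less_Suc_eq scalar_prod_def numeral_2_eq_2 intro!: eq_matI)
  have *: "Omega (Suc N) = four_block_mat (Omega 1) (0\<^sub>m 2 (2 * N)) (0\<^sub>m (2 * N) 2) (Omega N)"
    using Omega_add[of 1 N] by simp
  show ?case
    unfolding * mult_block_diag[OF 1(1,1) Omega_carrier Omega_carrier] Suc 1(2)
    by (intro eq_matI) auto
qed

section \<open>Symplectic invariants of two modes\<close>

text \<open>This is P Omega P with P = diag(1, 1, 1, -1). It lets the partial transposition act on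
  the symplectic form instead of the state.\<close>

definition Omega_pt :: "real mat" where
  "Omega_pt = mat 4 4 (\<lambda>(i, j).
     [[0, 1, 0, 0], [-1, 0, 0, 0], [0, 0, 0, -1], [0, 0, 1, 0]] ! i ! j)"

text \<open>For a symmetric matrix with diagonal 2x2 blocks A, B and correlation block C this is det
  A + det B + 2 det C. Together with the determinant it fixes both symplectic eigenvalues of a
  two-mode state.\<close>

definition seralian :: "real mat \<Rightarrow> real" where
  "seralian S = S $$ (0,0) * S $$ (1,1) - S $$ (0,1) * S $$ (1,0) +
     (S $$ (2,2) * S $$ (3,3) - S $$ (2,3) * S $$ (3,2)) +
     2 * (S $$ (0,2) * S $$ (1,3) - S $$ (0,3) * S $$ (1,2))"

text \<open>The partial transposition reverses the sign of det C and keeps det A and det B.\<close>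

definition seralian_pt :: "real mat \<Rightarrow> real" where
  "seralian_pt S = S $$ (0,0) * S $$ (1,1) - S $$ (0,1) * S $$ (1,0) +
     (S $$ (2,2) * S $$ (3,3) - S $$ (2,3) * S $$ (3,2)) -
     2 * (S $$ (0,2) * S $$ (1,3) - S $$ (0,3) * S $$ (1,2))"

lemma Omega_pt_carrier [simp]: "Omega_pt \<in> carrier_mat 4 4"
  by (simp add: Omega_pt_def)

lemma dim_Omega_pt [simp]: "dim_row Omega_pt = 4" "dim_col Omega_pt = 4"
  by (simp_all add: Omega_pt_def)

lemma Omega_pt_transpose: "Omega_pt\<^sup>T = - Omega_pt"
  by (rule eq_matI) (auto simp: Omega_pt_def less_Suc_eq numeral_eq_Suc)

lemma Omega_2_carrier [simp]: "Omega 2 \<in> carrier_mat 4 4"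
  using Omega_carrier[of 2] by simp

lemma sym4:
  fixes S :: "'a mat"
  assumes "S \<in> carrier_mat 4 4" "S\<^sup>T = S"
  shows "S $$ (1,0) = S $$ (0,1)" "S $$ (2,0) = S $$ (0,2)" "S $$ (3,0) = S $$ (0,3)"
    "S $$ (2,1) = S $$ (1,2)" "S $$ (3,1) = S $$ (1,3)" "S $$ (3,2) = S $$ (2,3)"
  by (rule sym_index[OF assms]; simp)+

text \<open>Transposing exchanges z and -z, so odd powers of z drop out. At z = i the value is det S
  - seralian + 1.\<close>

lemma det_add_Omega:
  assumes S: "S \<in> carrier_mat 4 4" "S\<^sup>T = S"
  shows "det (cmat S + z \<cdot>\<^sub>m cmat (Omega 2)) =
    of_real (det S) + z\<^sup>2 * of_real (seralian S) + z ^ 4"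
proof -
  have A: "cmat S + z \<cdot>\<^sub>m cmat (Omega 2) \<in> carrier_mat 4 4" using S by auto
  have idx: "(cmat S + z \<cdot>\<^sub>m cmat (Omega 2)) $$ (i, j) =
      of_real (S $$ (i, j)) + z * of_real (Omega 2 $$ (i, j))" if "i < 4" "j < 4" for i j
    using that S by simp
  show ?thesis
    unfolding det_4[OF A] det_4[OF S(1)] seralian_def sym4[OF S]
    using S(1) by (simp add: idx Omega_2 sym4[OF S, simplified] power2_eq_square power4_eq_xxxx algebra_simps)
qed

lemma det_add_Omega_pt:
  assumes S: "S \<in> carrier_mat 4 4" "S\<^sup>T = S"
  shows "det (cmat S + z \<cdot>\<^sub>m cmat Omega_pt) =
    of_real (det S) + z\<^sup>2 * of_real (seralian_pt S) + z ^ 4"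
proof -
  have A: "cmat S + z \<cdot>\<^sub>m cmat Omega_pt \<in> carrier_mat 4 4" using S by auto
  have idx: "(cmat S + z \<cdot>\<^sub>m cmat Omega_pt) $$ (i, j) =
      of_real (S $$ (i, j)) + z * of_real (Omega_pt $$ (i, j))" if "i < 4" "j < 4" for i j
    using that S by simp
  show ?thesis
    unfolding det_4[OF A] det_4[OF S(1)] seralian_pt_def sym4[OF S]
    using S(1) by (simp add: idx Omega_pt_def sym4[OF S, simplified] power2_eq_square power4_eq_xxxx algebra_simps)
qed

lemma partial_transpose_eq:
  assumes S: "S \<in> carrier_mat 4 4"
  shows "partial_transpose S =
    mat 4 4 (\<lambda>(i, j). (if (i = 3) = (j = 3) then 1 else -1) * S $$ (i, j))"
proof -
  let ?f = "\<lambda>i. if i = 3 then -1 else 1 :: real"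
  have "mat_diag 4 ?f * S = mat 4 4 (\<lambda>(i, j). ?f i * S $$ (i, j))"
    using mat_diag_mult_left[OF S, of ?f] by simp
  moreover have "mat 4 4 (\<lambda>(i, j). ?f i * S $$ (i, j)) * mat_diag 4 ?f =
      mat 4 4 (\<lambda>(i, j). mat 4 4 (\<lambda>(i, j). ?f i * S $$ (i, j)) $$ (i, j) * ?f j)"
    by (rule mat_diag_mult_right) simp
  ultimately show ?thesis
    by (auto simp: partial_transpose_def Let_def intro!: eq_matI)
qed

text \<open>The spectrum is symmetric about 0, hence a quadratic polynomial in the square of the
  variable: two invariants determine the symplectic eigenvalues and no normal form has to be
  constructed.\<close>

lemma char_poly_Omega:
  assumes S: "S \<in> carrier_mat 4 4" "S\<^sup>T = S"
  shows "char_poly (\<i> \<cdot>\<^sub>m cmat (Omega 2 * S)) =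
    [:of_real (det S), 0, - of_real (seralian S), 0, 1:]"
proof -
  have A: "\<i> \<cdot>\<^sub>m cmat (Omega 2 * S) \<in> carrier_mat 4 4" using S by auto
  have OS: "Omega 2 * S = mat 4 4 (\<lambda>(i, j).
      if i = 0 then S $$ (1,j) else if i = 1 then - S $$ (0,j)
      else if i = 2 then S $$ (3,j) else - S $$ (2,j))"
    using S unfolding Omega_2
    by (intro eq_matI)
      (auto simp: scalar_prod_def less_Suc_eq numeral_eq_Suc)
  have "poly (char_poly (\<i> \<cdot>\<^sub>m cmat (Omega 2 * S))) z =
      poly [:of_real (det S), 0, - of_real (seralian S), 0, 1:] z" for z
  proof -
    let ?M = "- char_matrix (\<i> \<cdot>\<^sub>m cmat (Omega 2 * S)) z"
    have M: "?M \<in> carrier_mat 4 4" using A by simp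
    show ?thesis
      unfolding char_poly_matrix[OF A] det_4[OF M] det_4[OF S(1)] seralian_def sym4[OF S]
      using S(1) by (simp add: char_matrix_def OS sym4[OF S, simplified] power2_eq_square power4_eq_xxxx algebra_simps)
  qed
  then show ?thesis by (simp add: poly_eq_poly_eq_iff[symmetric] fun_eq_iff)
qed

lemma partial_transpose_invariants:
  assumes S: "S \<in> carrier_mat 4 4" "S\<^sup>T = S"
  shows "partial_transpose S \<in> carrier_mat 4 4" "(partial_transpose S)\<^sup>T = partial_transpose S"
    "det (partial_transpose S) = det S" "seralian (partial_transpose S) = seralian_pt S"
proof -
  show P: "partial_transpose S \<in> carrier_mat 4 4"
    by (simp add: partial_transpose_eq[OF S(1)])
  show "(partial_transpose S)\<^sup>T = partial_transpose S"
    using S(1) by (auto simp: partial_transpose_eq sym_index[OF S] intro!: eq_matI)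
  show "det (partial_transpose S) = det S"
    unfolding det_4[OF P] det_4[OF S(1)]
    by (simp add: partial_transpose_eq[OF S(1)] algebra_simps)
  show "seralian (partial_transpose S) = seralian_pt S"
    by (simp add: seralian_def seralian_pt_def partial_transpose_eq[OF S(1)])
qed

text \<open>Determinant 1 makes the two symplectic eigenvalues of the partial transpose reciprocal,
  and the sum of their squares is the invariant 2 cosh(2 s). The parameter s is the two-mode
  squeezing in terms of which entanglement is measured from here on.\<close>

lemma symp_eigs_up_partial_transpose:
  assumes S: "S \<in> carrier_mat 4 4" "S\<^sup>T = S" and "det S = 1"
    and s: "seralian_pt S = 2 * cosh (2 * s)" "0 \<le> s"
  shows "symp_eigs_up 2 (partial_transpose S) = [exp (- s), exp s]"
proof -
  let ?a = "complex_of_real (exp s)" and ?b = "complex_of_real (exp (- s))"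
  note pt = partial_transpose_invariants[OF S]
  have "char_poly (\<i> \<cdot>\<^sub>m cmat (Omega 2 * partial_transpose S)) =
      [:1, 0, - of_real (2 * cosh (2 * s)), 0, 1:]"
    using char_poly_Omega[OF pt(1,2)] assms pt by simp
  also have "\<dots> = [:- ?a, 1:] * [:- ?b, 1:] * ([:?a, 1:] * [:?b, 1:])"
  proof -
    have "?a * ?b = 1" by (simp flip: of_real_mult exp_add)
    moreover have "?a\<^sup>2 + ?b\<^sup>2 = of_real (2 * cosh (2 * s))"
      by (simp add: cosh_def flip: of_real_power of_real_add exp_double)
        (simp add: scaleR_conv_of_real)
    ultimately show ?thesis
      by (simp add: power2_eq_square algebra_simps)
  qed
  finally have "proots (char_poly (\<i> \<cdot>\<^sub>m cmat (Omega 2 * partial_transpose S))) =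
      {#?a, ?b, - ?a, - ?b#}"
    using proots_linear_factor[of "- ?a"] proots_linear_factor[of "- ?b"]
      proots_linear_factor[of ?a] proots_linear_factor[of ?b]
    by (simp add: proots_mult del: mult_pCons_left mult_pCons_right)
  then show ?thesis
    using s(2) by (simp add: symp_eigs_up_def add_mset_commute insort_is_Cons)
qed

section \<open>The entanglement function and the uncertainty relation\<close>

text \<open>In terms of y = (cosh s - 1) / 2 the function is (y + 1) ln(y + 1) - y ln y, the entropy
  of a thermal mode with mean photon number y.\<close>

lemma h0_eq:
  "h0 s = ((cosh s - 1) / 2 + 1) * ln ((cosh s - 1) / 2 + 1) - (cosh s - 1) / 2 * ln ((cosh s - 1) / 2)"
proof -
  have "(1 + exp (- s))\<^sup>2 / (4 * exp (- s)) = (cosh s - 1) / 2 + 1"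
       "(1 - exp (- s))\<^sup>2 / (4 * exp (- s)) = (cosh s - 1) / 2"
    by (simp_all add: cosh_def exp_minus field_simps power2_eq_square)
  then show ?thesis unfolding h0_def h_def by (simp only:)
qed

lemma h0_strict_mono:
  assumes "0 \<le> s" "s < t"
  shows "h0 s < h0 t"
proof -
  define f where "f y = (y + 1) * ln (y + 1) - y * ln y" for y :: real
  \<comment> \<open>The derivative ln(y + 1) - ln y blows up at y = 0, so this endpoint is compared
    directly instead of by the derivative.\<close>
  have f0: "0 < f y" if "0 < y" for y
  proof -
    have "ln y < ln (y + 1)" "0 < ln (y + 1)" using that by auto
    then have "y * ln y < y * ln (y + 1)" using that by simp
    then show ?thesis using \<open>0 < ln (y + 1)\<close> by (simp add: f_def distrib_right)
  qed
  have f: "f y < f z" if "0 < y" "y < z" for y z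
  proof (rule DERIV_pos_imp_increasing[OF that(2)])
    fix x assume "y \<le> x" "x \<le> z"
    then have "0 < x" using that by simp
    then have "(f has_real_derivative ln (x + 1) - ln x) (at x)"
      unfolding f_def by (auto intro!: derivative_eq_intros)
    moreover have "ln (x + 1) - ln x > 0" using \<open>0 < x\<close> by simp
    ultimately show "\<exists>d. (f has_real_derivative d) (at x) \<and> 0 < d" by blast
  qed
  have h: "h0 x = f ((cosh x - 1) / 2)" for x by (simp add: h0_eq f_def)
  have "cosh s < cosh t" using assms by (intro cosh_real_strict_mono) auto
  moreover have "1 \<le> cosh s" by (rule cosh_real_ge_1)
  ultimately show ?thesis
    unfolding h using f[of "(cosh s - 1) / 2" "(cosh t - 1) / 2"] f0[of "(cosh t - 1) / 2"]
    by (cases "cosh s = 1") (auto simp: f_def)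
qed

lemma h0_mono: "0 \<le> s \<Longrightarrow> s \<le> t \<Longrightarrow> h0 s \<le> h0 t"
  using h0_strict_mono[of s t] by (cases "s = t") auto

lemma h0_nonneg: "0 \<le> s \<Longrightarrow> 0 \<le> h0 s"
  using h0_mono[of 0 s] by (simp add: h0_def h_def)

lemma eof_pure_eq_h0:
  assumes "S \<in> carrier_mat 4 4" "S\<^sup>T = S" "det S = 1"
    and "seralian_pt S = 2 * cosh (2 * s)" "0 \<le> s"
  shows "eof_pure S = h0 s"
  using symp_eigs_up_partial_transpose[OF assms] h0_nonneg[OF assms(5)]
  by (simp add: eof_pure_def h0_def)

section \<open>The uncertainty relation for real test vectors\<close>

lemma gaussian_state_iff:
  "gaussian_state N S \<longleftrightarrow> S \<in> carrier_mat (2 * N) (2 * N) \<and> S\<^sup>T = S \<and>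
    (\<forall>x \<in> carrier_vec (2 * N). \<forall>y \<in> carrier_vec (2 * N).
       2 * (x \<bullet> (Omega N *\<^sub>v y)) \<le> x \<bullet> (S *\<^sub>v x) + y \<bullet> (S *\<^sub>v y))"
  using psd_complex_iff[of S "2 * N" "Omega N"] Omega_transpose[of N]
  by (auto simp: gaussian_state_def)

lemma gaussian_nonneg:
  assumes "gaussian_state N S" "x \<in> carrier_vec (2 * N)"
  shows "0 \<le> x \<bullet> (S *\<^sub>v x)"
  using assms antisym_quadratic_form[OF Omega_carrier Omega_transpose assms(2)]
  unfolding gaussian_state_iff by force

lemma gaussian_uncertainty:
  assumes "gaussian_state N S" "x \<in> carrier_vec (2 * N)" "y \<in> carrier_vec (2 * N)"
  shows "(x \<bullet> (Omega N *\<^sub>v y))\<^sup>2 \<le> (x \<bullet> (S *\<^sub>v x)) * (y \<bullet> (S *\<^sub>v y))"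
proof -
  define a b c where "a = x \<bullet> (S *\<^sub>v x)" "b = x \<bullet> (Omega N *\<^sub>v y)" "c = y \<bullet> (S *\<^sub>v y)"
  have S: "S \<in> carrier_mat (2 * N) (2 * N)" using assms(1) by (simp add: gaussian_state_def)
  \<comment> \<open>Scaling x alone gives a quadratic inequality in t; its discriminant is the
    product form of the relation, read off at the minimizer t = b / a.\<close>
  have ineq: "2 * (t * b) \<le> t\<^sup>2 * a + c" for t
  proof -
    have "2 * ((t \<cdot>\<^sub>v x) \<bullet> (Omega N *\<^sub>v y)) \<le> (t \<cdot>\<^sub>v x) \<bullet> (S *\<^sub>v (t \<cdot>\<^sub>v x)) + y \<bullet> (S *\<^sub>v y)"
      using assms(1)[unfolded gaussian_state_iff] assms(2,3) smult_carrier_vec[of t x "2 * N"] by blast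
    moreover have "S *\<^sub>v (t \<cdot>\<^sub>v x) = t \<cdot>\<^sub>v (S *\<^sub>v x)"
      using S assms by (simp add: mult_mat_vec)
    ultimately show ?thesis
      using S assms by (simp add: a_b_c_def power2_eq_square mult.assoc)
  qed
  have "0 \<le> a" using gaussian_nonneg[OF assms(1,2)] by (simp add: a_b_c_def)
  show ?thesis
  proof (cases "a = 0")
    case True
    have "b = 0"
    proof (rule ccontr)
      assume "b \<noteq> 0"
      \<comment> \<open>With a = 0 the left side is linear in t, and at this t it equals 2 (|c| +
        1), which exceeds c.\<close>
      then show False using ineq[of "(\<bar>c\<bar> + 1) / b"] True by simp
    qed
    then show ?thesis using True by (simp add: a_b_c_def)
  next
    case False
    then have "0 < a" using \<open>0 \<le> a\<close> by simp
    have "2 * (b / a * b) \<le> (b / a)\<^sup>2 * a + c" by (rule ineq)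
    then have "b\<^sup>2 / a \<le> c" using \<open>0 < a\<close> by (simp add: power2_eq_square)
    then show ?thesis using \<open>0 < a\<close> by (simp add: a_b_c_def field_simps)
  qed
qed

section \<open>Lower bound on the squeezing of a pure state\<close>

lemma quadratic_form_4:
  fixes S :: "'a :: comm_ring_1 mat"
  assumes "S \<in> carrier_mat 4 4"
  shows "vec_of_list [a0, a1, a2, a3] \<bullet> (S *\<^sub>v vec_of_list [b0, b1, b2, b3]) =
    S $$ (0,0) * (a0 * b0) + S $$ (0,1) * (a0 * b1) + S $$ (0,2) * (a0 * b2) + S $$ (0,3) * (a0 * b3) +
    (S $$ (1,0) * (a1 * b0) + S $$ (1,1) * (a1 * b1) + S $$ (1,2) * (a1 * b2) + S $$ (1,3) * (a1 * b3)) +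
    (S $$ (2,0) * (a2 * b0) + S $$ (2,1) * (a2 * b1) + S $$ (2,2) * (a2 * b2) + S $$ (2,3) * (a2 * b3)) +
    (S $$ (3,0) * (a3 * b0) + S $$ (3,1) * (a3 * b1) + S $$ (3,2) * (a3 * b2) + S $$ (3,3) * (a3 * b3))"
proof -
  have "vec_of_list [c0, c1, c2, c3] \<in> carrier_vec 4" for c0 c1 c2 c3 :: 'a
    by (rule carrier_vecI) simp
  from scalar_prod_mult_mat_vec[OF assms this this] show ?thesis
    by (simp add: sum_lessThan_4 eval_nat_numeral)
qed

text \<open>With \<open>c = cosh s\<close> and \<open>g12 = \<plusminus> sinh s\<close> the left-hand factors are those of the optimal state with
  squeezing \<open>s\<close>, up to local squeezing, which is the ratio of \<open>g1\<close> and \<open>g2\<close> and can only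
  increase the product as long as \<open>\<alpha>\<^sup>2 \<le> exp (- 2 * s)\<close>.\<close>

lemma two_mode_squeezing_bound:
  fixes g1 g2 g12 \<alpha> r :: real
  assumes g: "0 < g1" "0 < g2" "g1 * g2 - g12\<^sup>2 = 1"
    and r: "0 \<le> r" and \<alpha>: "\<bar>\<alpha>\<bar> \<le> exp (- r)"
    and le: "((1 - \<alpha>)\<^sup>2 / 2 * g1 - (1 - \<alpha>\<^sup>2) * g12 + (1 + \<alpha>)\<^sup>2 / 2 * g2) *
      ((1 - \<alpha>)\<^sup>2 / 2 * g2 - (1 - \<alpha>\<^sup>2) * g12 + (1 + \<alpha>)\<^sup>2 / 2 * g1) \<le> (exp (- r) + \<alpha>\<^sup>2 * exp r)\<^sup>2"
  shows "(cosh r)\<^sup>2 \<le> g1 * g2"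
proof (rule ccontr)
  assume "\<not> ?thesis"
  then have lt: "g1 * g2 < (cosh r)\<^sup>2" by simp
  \<comment> \<open>If the claim fails, the block has squeezing s < r, where cosh s is the geometric
    mean of its diagonal and sinh s is the modulus of its off-diagonal entry.\<close>
  define c where "c = sqrt (g1 * g2)"
  have c2: "c\<^sup>2 = g1 * g2" using g by (simp add: c_def)
  have c1: "1 \<le> c" using g(3) unfolding c_def by (simp add: algebra_simps)
  define s where "s = arcosh c"
  have s: "0 \<le> s" "cosh s = c" using c1 by (auto simp: s_def)
  have "cosh s < cosh r"
    using lt c2 c1 s(2) by (metis power_mono cosh_real_nonneg not_le)
  then have sr: "s < r" using s(1) r by (metis cosh_real_nonneg_less_iff)
  define sh where "sh = sinh s"
  have sh0: "0 \<le> sh" using s by (simp add: sh_def)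
  have sh2: "sh\<^sup>2 = g12\<^sup>2"
    using hyperbolic_pythagoras[of s] g(3) c2 s(2) by (simp add: sh_def)
  then have g12: "g12 \<le> sh" using sh0 by (metis abs_le_square_iff abs_of_nonneg abs_ge_self order_trans order_refl)
  define m where "m = g1 + g2"
  have m: "2 * c \<le> m"
    unfolding m_def c_def using arith_geo_mean_sqrt[of g1 g2] g by simp
  define k n where "k = (1 - \<alpha>\<^sup>2) / 2" and "n = 1 + \<alpha>\<^sup>2"
  have expr: "0 < exp (- r)" "exp (- r) \<le> 1" using r by auto
  have \<alpha>2: "\<alpha>\<^sup>2 \<le> exp (- r) * exp (- r)"
    using \<alpha> by (metis abs_ge_zero power2_abs power2_eq_square power_mono)
  also have "\<dots> \<le> 1" using expr by (simp add: mult_le_one)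
  finally have k0: "0 \<le> k" by (simp add: k_def)
  have n0: "0 \<le> n" by (simp add: n_def)
  have csh: "n * c - 2 * k * sh = exp (- s) + \<alpha>\<^sup>2 * exp s"
    unfolding s(2)[symmetric] sh_def n_def k_def
    by (simp add: cosh_def sinh_def field_simps)
  have "exp (- r) * exp (- r) \<le> exp (- s) * exp (- s)" using sr by (intro mult_mono) auto
  with \<alpha>2 have "\<alpha>\<^sup>2 \<le> exp (- s) * exp (- s)" by simp
  then have "\<alpha>\<^sup>2 * exp s \<le> exp (- s) * exp (- s) * exp s" by (intro mult_right_mono) auto
  then have "\<alpha>\<^sup>2 * exp s \<le> exp (- s)"
    by (simp add: mult.assoc flip: exp_add)
  moreover have "2 * k * c - n * sh = exp (- s) - \<alpha>\<^sup>2 * exp s"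
    unfolding s(2)[symmetric] sh_def n_def k_def
    by (simp add: cosh_def sinh_def field_simps)
  \<comment> \<open>This is \<alpha>^2 <= exp(-2 s) in disguise. It ensures that unequal diagonal
    entries, that is m > 2 c, cannot lower the product.\<close>
  ultimately have crit: "n * sh \<le> 2 * k * c" by simp
  let ?X = "(1 - \<alpha>)\<^sup>2 / 2 * g1 - (1 - \<alpha>\<^sup>2) * g12 + (1 + \<alpha>)\<^sup>2 / 2 * g2"
  let ?Y = "(1 - \<alpha>)\<^sup>2 / 2 * g2 - (1 - \<alpha>\<^sup>2) * g12 + (1 + \<alpha>)\<^sup>2 / 2 * g1"
  have "?X * ?Y = n\<^sup>2 * (g1 * g2) + k\<^sup>2 * m\<^sup>2 - 4 * k\<^sup>2 * (g1 * g2) - 2 * k * n * m * g12 + 4 * k\<^sup>2 * g12\<^sup>2"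
    unfolding m_def n_def k_def by (simp add: field_simps power2_eq_square)
  \<comment> \<open>Expansion around the symmetric point m = 2 c, g12 = sh: the square is the value
    there, and both remainders turn out nonnegative.\<close>
  also have "\<dots> = (n * c - 2 * k * sh)\<^sup>2 + k * (m - 2 * c) * (k * (m + 2 * c) - 2 * n * sh) +
      2 * k * n * m * (sh - g12)"
    unfolding c2[symmetric] sh2[symmetric] by (simp add: algebra_simps power2_eq_square)
  finally have XY: "?X * ?Y = \<dots>" .
  have "0 \<le> 2 * k * n * m * (sh - g12)"
    using k0 n0 g g12 by (simp add: m_def)
  moreover have "0 \<le> k * (m - 2 * c) * (k * (m + 2 * c) - 2 * n * sh)"
  proof -
    have "k * (2 * c + 2 * c) \<le> k * (m + 2 * c)" using k0 m by (intro mult_left_mono) auto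
    then show ?thesis using k0 m crit by simp
  qed
  ultimately have "(exp (- s) + \<alpha>\<^sup>2 * exp s)\<^sup>2 \<le> (exp (- r) + \<alpha>\<^sup>2 * exp r)\<^sup>2"
    using le unfolding XY csh by linarith
  then have le': "exp (- s) + \<alpha>\<^sup>2 * exp s \<le> exp (- r) + \<alpha>\<^sup>2 * exp r"
    by (rule power2_le_imp_le) (simp add: add_nonneg_nonneg)
  \<comment> \<open>The function exp(-t) + \<alpha>^2 exp t is strictly decreasing up to t = r
    because \<alpha>^2 <= exp(-2 r). Comparing its values at s < r contradicts
    \<open>le'\<close>.\<close>
  have "\<alpha>\<^sup>2 * (exp r - exp s) \<le> exp (- r) * exp (- r) * (exp r - exp s)"
    using sr \<alpha>2 by (intro mult_right_mono) auto
  also have "\<dots> < exp (- r) * exp (- s) * (exp r - exp s)"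
    using sr by (intro mult_strict_right_mono) auto
  also have "\<dots> = exp (- s) - exp (- r)"
    by (simp add: algebra_simps exp_minus)
  finally show False using le' by (simp add: algebra_simps)
qed

lemma gaussian_uncertainty_4:
  assumes "gaussian_state 2 S"
  shows "(a0 * b1 - a1 * b0 + a2 * b3 - a3 * b2)\<^sup>2 \<le>
    (vec_of_list [a0, a1, a2, a3] \<bullet> (S *\<^sub>v vec_of_list [a0, a1, a2, a3])) *
    (vec_of_list [b0, b1, b2, b3] \<bullet> (S *\<^sub>v vec_of_list [b0, b1, b2, b3]))"
proof -
  have c: "vec_of_list [c0, c1, c2, c3] \<in> carrier_vec (2 * 2)" for c0 c1 c2 c3 :: real
    by (rule carrier_vecI) simp
  have "vec_of_list [a0, a1, a2, a3] \<bullet> (Omega 2 *\<^sub>v vec_of_list [b0, b1, b2, b3]) =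
      a0 * b1 - a1 * b0 + a2 * b3 - a3 * b2"
    unfolding quadratic_form_4[OF Omega_2_carrier] by (simp add: Omega_2)
  then show ?thesis using gaussian_uncertainty[OF assms c c] by metis
qed

text \<open>Each bound is the uncertainty relation for a position combination against a suitable
  partner, with regression coefficients as entries. The last one says that the momentum block
  dominates the inverse of the position block; the two before it sharpen this for a single momentum
  whose correlation with its own position has been removed.\<close>

lemma gaussian_position_block:
  assumes "gaussian_state 2 S"
  defines "D \<equiv> S $$ (0,0) * S $$ (2,2) - (S $$ (0,2))\<^sup>2"
  shows "0 < S $$ (0,0)" "0 < S $$ (2,2)" "0 < D"
    "S $$ (0,0) * S $$ (2,2) \<le> D * (S $$ (0,0) * S $$ (1,1) - (S $$ (0,1))\<^sup>2)"
    "S $$ (0,0) * S $$ (2,2) \<le> D * (S $$ (2,2) * S $$ (3,3) - (S $$ (2,3))\<^sup>2)"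
    "S $$ (2,2) * u\<^sup>2 - 2 * S $$ (0,2) * (u * v) + S $$ (0,0) * v\<^sup>2 \<le>
      D * (vec_of_list [0, u, 0, v] \<bullet> (S *\<^sub>v vec_of_list [0, u, 0, v]))"
proof -
  have S: "S \<in> carrier_mat 4 4" "S\<^sup>T = S" using assms(1) by (auto simp: gaussian_state_def)
  note unc = gaussian_uncertainty_4[OF assms(1), unfolded quadratic_form_4[OF S(1)] sym4[OF S]]
  have nonneg: "0 \<le> vec_of_list [a0, a1, a2, a3] \<bullet> (S *\<^sub>v vec_of_list [a0, a1, a2, a3])" for a0 a1 a2 a3
    by (rule gaussian_nonneg[OF assms(1)], rule carrier_vecI) simp
  note nn = nonneg[unfolded quadratic_form_4[OF S(1)] sym4[OF S]]
  have "1 \<le> S $$ (0,0) * S $$ (1,1)" using unc[of 1 1 0 0 0 0 0 0] by simp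
  moreover have "0 \<le> S $$ (0,0)" using nn[of 1 0 0 0] by simp
  ultimately show p0: "0 < S $$ (0,0)" by (cases "S $$ (0,0) = 0") auto
  have "1 \<le> S $$ (2,2) * S $$ (3,3)" using unc[of 0 0 0 0 1 1 0 0] by simp
  moreover have "0 \<le> S $$ (2,2)" using nn[of 0 0 1 0] by simp
  ultimately show p2: "0 < S $$ (2,2)" by (cases "S $$ (2,2) = 0") auto
  \<comment> \<open>The part of x_2 uncorrelated with x_1, whose variance is
    \<open>S $$ (0,0) * D\<close>, is tested against p_2.\<close>
  have "(S $$ (0,0))\<^sup>2 \<le> (S $$ (0,0) * D) * S $$ (3,3)"
    using unc[of "- S $$ (0,2)" 0 0 0 "S $$ (0,0)" 1 0 0]
    by (simp add: D_def algebra_simps power2_eq_square)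
  then have "S $$ (0,0) \<le> D * S $$ (3,3)" using p0 by (simp add: power2_eq_square mult.assoc)
  moreover have "0 \<le> S $$ (3,3)" using nn[of 0 0 0 1] by simp
  ultimately show D: "0 < D" using p0
    by (metis mult_nonpos_nonneg not_le order_less_le_trans)
  \<comment> \<open>Here x_1 is cleared of its correlation with x_2, and p_1 of its correlation with
    x_1; the symplectic product of the two vectors is
    \<open>S $$ (0,0) * S $$ (2,2)\<close>.\<close>
  have "(S $$ (0,0) * S $$ (2,2))\<^sup>2 \<le> (S $$ (0,0) * S $$ (2,2)) * (D * (S $$ (0,0) * S $$ (1,1) - (S $$ (0,1))\<^sup>2))"
    using unc[of "S $$ (2,2)" "S $$ (0,0)" 0 "- S $$ (0,1)" "- S $$ (0,2)" 0 0 0]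
    by (simp add: D_def algebra_simps power2_eq_square)
  then show "S $$ (0,0) * S $$ (2,2) \<le> D * (S $$ (0,0) * S $$ (1,1) - (S $$ (0,1))\<^sup>2)"
    using p0 p2 unfolding power2_eq_square[of "_ * _"] by (simp del: mult_le_cancel_left add: mult_le_cancel_left_pos)
  have "(S $$ (0,0) * S $$ (2,2))\<^sup>2 \<le> (S $$ (0,0) * S $$ (2,2)) * (D * (S $$ (2,2) * S $$ (3,3) - (S $$ (2,3))\<^sup>2))"
    using unc[of "- S $$ (0,2)" 0 0 0 "S $$ (0,0)" "S $$ (2,2)" 0 "- S $$ (2,3)"]
    by (simp add: D_def algebra_simps power2_eq_square)
  then show "S $$ (0,0) * S $$ (2,2) \<le> D * (S $$ (2,2) * S $$ (3,3) - (S $$ (2,3))\<^sup>2)"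
    using p0 p2 unfolding power2_eq_square[of "_ * _"] by (simp del: mult_le_cancel_left add: mult_le_cancel_left_pos)
  let ?b = "S $$ (2,2) * u\<^sup>2 - 2 * S $$ (0,2) * (u * v) + S $$ (0,0) * v\<^sup>2"
  let ?q = "vec_of_list [0, u, 0, v] \<bullet> (S *\<^sub>v vec_of_list [0, u, 0, v])"
  \<comment> \<open>The position vector is the adjugate of the position block applied to (u, v),
    which is the optimal partner of the given momentum direction.\<close>
  have "?b\<^sup>2 \<le> (D * ?b) * ?q"
    using unc[of "S $$ (2,2) * u - S $$ (0,2) * v" u 0 0 "S $$ (0,0) * v - S $$ (0,2) * u" v 0 0]
    unfolding quadratic_form_4[OF S(1)] sym4[OF S]
    by (simp add: D_def algebra_simps power2_eq_square)
  then have "?b * ?b \<le> ?b * (D * ?q)" by (simp add: power2_eq_square ac_simps)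
  moreover have "0 \<le> D * ?q" using D nonneg by simp
  ultimately show "?b \<le> D * ?q"
    by (cases "0 < ?b") (auto simp: mult_le_cancel_left_pos)
qed

section \<open>Diagonalization of real symmetric matrices\<close>

text \<open>A complex eigenvector exists by algebraic closedness. Its eigenvalue turns out real, so
  whichever of the real and imaginary parts is nonzero is a real eigenvector.\<close>

lemma real_symmetric_eigenvector:
  fixes A :: "real mat"
  assumes A: "A \<in> carrier_mat n n" "A\<^sup>T = A" and n: "0 < n"
  obtains l v where "v \<in> carrier_vec n" "v \<bullet> v = 1" "A *\<^sub>v v = l \<cdot>\<^sub>v v"
proof -
  have cA: "cmat A \<in> carrier_mat n n" using A by simp
  obtain as where as: "char_poly (cmat A) = (\<Prod>a\<leftarrow>as. [:- a, 1:])" "length as = n"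
    using char_poly_factorized[OF cA] by blast
  then obtain z bs where "as = z # bs" using n by (cases as) auto
  then have "eigenvalue (cmat A) z"
    unfolding eigenvalue_root_char_poly[OF cA] as(1) by simp
  then obtain w where w: "w \<in> carrier_vec n" "w \<noteq> 0\<^sub>v n" "cmat A *\<^sub>v w = z \<cdot>\<^sub>v w"
    using A by (auto simp: eigenvalue_def eigenvector_def)
  define x y where "x = map_vec Re w" and "y = map_vec Im w"
  have xy: "x \<in> carrier_vec n" "y \<in> carrier_vec n" using w by (auto simp: x_def y_def)
  have entry: "(\<Sum>j<n. of_real (A $$ (i, j)) * w $ j) = z * w $ i" if "i < n" for i
  proof -
    have "(cmat A *\<^sub>v w) $ i = (z \<cdot>\<^sub>v w) $ i" by (simp only: w(3))
    then show ?thesis using that A(1) w(1) by (simp add: scalar_prod_def atLeast0LessThan)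
  qed
  have Ax: "A *\<^sub>v x = Re z \<cdot>\<^sub>v x - Im z \<cdot>\<^sub>v y"
  proof (rule eq_vecI)
    fix i assume "i < dim_vec (Re z \<cdot>\<^sub>v x - Im z \<cdot>\<^sub>v y)"
    then have i: "i < n" using xy by simp
    show "(A *\<^sub>v x) $ i = (Re z \<cdot>\<^sub>v x - Im z \<cdot>\<^sub>v y) $ i"
      using arg_cong[OF entry[OF i], of Re] i A(1) w(1)
      by (simp add: x_def y_def scalar_prod_def atLeast0LessThan)
  qed (use A xy in auto)
  have Ay: "A *\<^sub>v y = Im z \<cdot>\<^sub>v x + Re z \<cdot>\<^sub>v y"
  proof (rule eq_vecI)
    fix i assume "i < dim_vec (Im z \<cdot>\<^sub>v x + Re z \<cdot>\<^sub>v y)"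
    then have i: "i < n" using xy by simp
    show "(A *\<^sub>v y) $ i = (Im z \<cdot>\<^sub>v x + Re z \<cdot>\<^sub>v y) $ i"
      using arg_cong[OF entry[OF i], of Im] i A(1) w(1)
      by (simp add: x_def y_def scalar_prod_def atLeast0LessThan)
  qed (use A xy in auto)
  have nz: "x \<noteq> 0\<^sub>v n \<or> y \<noteq> 0\<^sub>v n"
  proof (rule ccontr)
    assume "\<not> ?thesis"
    then have xy0: "x = 0\<^sub>v n" "y = 0\<^sub>v n" by auto
    have "w = 0\<^sub>v n"
    proof (rule eq_vecI)
      fix i assume "i < dim_vec (0\<^sub>v n :: complex vec)"
      then have i: "i < n" by simp
      have "x $ i = 0" "y $ i = 0" unfolding xy0 using i by auto
      then show "w $ i = 0\<^sub>v n $ i" using i w(1) by (simp add: x_def y_def complex_eq_iff)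
    qed (use w in auto)
    then show False using w(2) by simp
  qed
  have pos: "0 < u \<bullet> u" if "u \<in> carrier_vec n" "u \<noteq> 0\<^sub>v n" for u :: "real vec"
    using conjugate_square_greater_0_vec[OF that(1)] that by (simp add: conjugate_vec_def)
  \<comment> \<open>Inserting \<open>Ax\<close> and \<open>Ay\<close> into the symmetry relation
    leaves Im z times the squared norm of w.\<close>
  have "x \<bullet> (A *\<^sub>v y) = y \<bullet> (A *\<^sub>v x)" by (rule scalar_prod_sym_mat[OF A xy])
  then have "Im z * (x \<bullet> x + y \<bullet> y) = 0"
    unfolding Ax Ay using xy comm_scalar_prod[OF xy]
    by (simp add: scalar_prod_add_distrib[of _ n] scalar_prod_minus_distrib[of _ n] algebra_simps)
  moreover have "0 < x \<bullet> x + y \<bullet> y"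
    using nz pos[OF xy(1)] pos[OF xy(2)] scalar_prod_self_nonneg[of x] scalar_prod_self_nonneg[of y] by linarith
  ultimately have "Im z = 0" by simp
  then have "A *\<^sub>v x = Re z \<cdot>\<^sub>v x" "A *\<^sub>v y = Re z \<cdot>\<^sub>v y"
    unfolding Ax Ay using xy by auto
  then obtain u where u: "u \<in> carrier_vec n" "u \<noteq> 0\<^sub>v n" "A *\<^sub>v u = Re z \<cdot>\<^sub>v u"
    using nz xy by blast
  define v where "v = (1 / sqrt (u \<bullet> u)) \<cdot>\<^sub>v u"
  show ?thesis
  proof
    show "v \<in> carrier_vec n" using u by (simp add: v_def)
    show "v \<bullet> v = 1" using u pos[OF u(1,2)] by (simp add: v_def)
    show "A *\<^sub>v v = Re z \<cdot>\<^sub>v v"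
      using u A by (simp add: v_def mult_mat_vec smult_smult_assoc mult.commute)
  qed
qed

text \<open>Householder reflection along the difference of the first unit vector and v. Being
  symmetric and involutive, it is orthogonal.\<close>

lemma reflection_to_first_unit_vec:
  fixes v :: "real vec"
  assumes v: "v \<in> carrier_vec n" "v \<bullet> v = 1" and n: "0 < n"
  obtains H where "H \<in> carrier_mat n n" "H\<^sup>T = H" "H * H = 1\<^sub>m n" "H *\<^sub>v unit_vec n 0 = v"
proof (cases "v = unit_vec n 0")
  case True
  show ?thesis
    by (rule that[of "1\<^sub>m n"]) (use True in auto)
next
  case False
  define u where "u = unit_vec n 0 - v"
  have u: "u \<in> carrier_vec n" using v by (simp add: u_def)
  have u_ne: "u \<noteq> 0\<^sub>v n"
  proof
    assume *: "u = 0\<^sub>v n"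
    have "v = unit_vec n 0"
    proof (rule eq_vecI)
      fix i assume "i < dim_vec (unit_vec n 0 :: real vec)"
      then have i: "i < n" by simp
      have "u $ i = 0" unfolding * using i by simp
      then show "v $ i = unit_vec n 0 $ i" using i v by (simp add: u_def)
    qed (use v in auto)
    with False show False by simp
  qed
  then have uu: "0 < u \<bullet> u"
    using conjugate_square_greater_0_vec[OF u] u by (simp add: conjugate_vec_def)
  \<comment> \<open>Both vectors have norm 1, so the squared norm of their difference is 2 (1 -
    v_0). This is what makes the first column of H equal to v.\<close>
  have uu_eq: "u \<bullet> u = 2 * u $ 0"
    unfolding u_def using v n comm_scalar_prod[OF v(1), of "unit_vec n 0"]
    by (simp add: scalar_prod_minus_distrib[of _ n] minus_scalar_prod_distrib[of _ n])
  define c where "c = 2 / (u \<bullet> u)"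
  define H where "H = mat n n (\<lambda>(i, j). (if i = j then 1 else 0) - c * u $ i * u $ j)"
  show ?thesis
  proof (rule that)
    show "H \<in> carrier_mat n n" by (simp add: H_def)
    show "H\<^sup>T = H" by (rule eq_matI) (auto simp: H_def)
    show "H * H = 1\<^sub>m n"
    proof (rule eq_matI)
      fix i j assume "i < dim_row (1\<^sub>m n :: real mat)" "j < dim_col (1\<^sub>m n :: real mat)"
      then have ij: "i < n" "j < n" by auto
      have "(H * H) $$ (i, j) = (\<Sum>k<n. ((if i = k then 1 else 0) - c * u $ i * u $ k) *
          ((if k = j then 1 else 0) - c * u $ k * u $ j))"
        using ij by (simp add: H_def scalar_prod_def atLeast0LessThan)
      also have "\<dots> = (\<Sum>k<n. (if k = i then if i = j then 1 else 0 else 0)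
          - (if k = i then c * u $ i * u $ j else 0) - (if k = j then c * u $ i * u $ j else 0)
          + c * u $ i * c * u $ j * (u $ k * u $ k))"
        by (intro sum.cong refl) (auto simp: algebra_simps)
      also have "\<dots> = (if i = j then 1 else 0) - 2 * c * u $ i * u $ j + c * u $ i * c * u $ j * (u \<bullet> u)"
        using ij u by (simp add: sum.distrib sum_subtractf scalar_prod_def atLeast0LessThan
            flip: sum_distrib_left)
      also have "\<dots> = (if i = j then 1 else 0)"
        using uu by (simp add: c_def)
      finally show "(H * H) $$ (i, j) = 1\<^sub>m n $$ (i, j)" using ij by simp
    qed (auto simp: H_def)
    show "H *\<^sub>v unit_vec n 0 = v"
    proof (rule eq_vecI)
      fix i assume "i < dim_vec v"
      then have i: "i < n" using v by simp
      have "(H *\<^sub>v unit_vec n 0) $ i = H $$ (i, 0)"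
        using i n by (simp add: H_def)
      also have "\<dots> = unit_vec n 0 $ i - u $ i"
        using i n uu uu_eq by (simp add: H_def c_def)
      also have "\<dots> = v $ i" using i v by (simp add: u_def)
      finally show "(H *\<^sub>v unit_vec n 0) $ i = v $ i" .
    qed (use v in \<open>auto simp: H_def\<close>)
  qed
qed

lemma mat_diag_carrier [simp]: "mat_diag n d \<in> carrier_mat n n"
  by (simp add: mat_diag_def)

lemma mat_diag_Suc:
  "mat_diag (Suc m) (case_nat l d) =
    four_block_mat (mat 1 1 (\<lambda>_. l)) (0\<^sub>m 1 m) (0\<^sub>m m 1) (mat_diag m d)"
  by (rule eq_matI) (auto simp: mat_diag_def split: nat.splits)

text \<open>Deflation: after conjugation with the reflection that takes the first unit vector to an
  eigenvector, the first column is a multiple of that unit vector. Symmetry clears the first row as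
  well, and the remaining block goes to the induction hypothesis.\<close>

theorem real_symmetric_diagonalization:
  fixes A :: "real mat"
  assumes "A \<in> carrier_mat n n" "A\<^sup>T = A"
  shows "\<exists>U d. U \<in> carrier_mat n n \<and> U\<^sup>T * U = 1\<^sub>m n \<and> U * U\<^sup>T = 1\<^sub>m n \<and> A = U * mat_diag n d * U\<^sup>T"
  using assms
proof (induction n arbitrary: A)
  case 0
  then show ?case by (intro exI[of _ "1\<^sub>m 0"] exI[of _ "\<lambda>_. 0"]) auto
next
  case (Suc m)
  let ?n = "Suc m"
  note A = Suc.prems
  obtain l v where v: "v \<in> carrier_vec ?n" "v \<bullet> v = 1" "A *\<^sub>v v = l \<cdot>\<^sub>v v"
    using real_symmetric_eigenvector[OF A] by blast
  obtain H where H: "H \<in> carrier_mat ?n ?n" "H\<^sup>T = H" "H * H = 1\<^sub>m ?n" "H *\<^sub>v unit_vec ?n 0 = v"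
    using reflection_to_first_unit_vec[OF v(1,2)] by blast
  define B where "B = H * A * H"
  have B: "B \<in> carrier_mat ?n ?n" using H A by (simp add: B_def)
  have Bsym: "B\<^sup>T = B"
    using H A unfolding B_def
    by (simp add: transpose_mult[of _ ?n ?n _ ?n] assoc_mult_mat[of _ ?n ?n _ ?n _ ?n])
  have Hv: "H *\<^sub>v v = unit_vec ?n 0"
  proof -
    have "H *\<^sub>v v = H * H *\<^sub>v unit_vec ?n 0"
      using H(1) unfolding H(4)[symmetric] by simp
    then show ?thesis by (simp add: H(3))
  qed
  have "B *\<^sub>v unit_vec ?n 0 = H *\<^sub>v (A *\<^sub>v (H *\<^sub>v unit_vec ?n 0))"
    unfolding B_def using H(1) A(1)
    by (simp add: assoc_mult_mat_vec[of _ ?n ?n _ ?n])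
  also have "\<dots> = l \<cdot>\<^sub>v unit_vec ?n 0"
    unfolding H(4) v(3) using H(1) v(1) Hv by (simp add: mult_mat_vec)
  finally have Be: "B *\<^sub>v unit_vec ?n 0 = l \<cdot>\<^sub>v unit_vec ?n 0" .
  have col0: "B $$ (i, 0) = (if i = 0 then l else 0)" if "i < ?n" for i
    using arg_cong[OF Be, of "\<lambda>v. v $ i"] that B by simp
  define A' where "A' = mat m m (\<lambda>(i, j). B $$ (Suc i, Suc j))"
  have A': "A' \<in> carrier_mat m m" by (simp add: A'_def)
  have "A'\<^sup>T = A'"
    by (rule eq_matI) (auto simp: A'_def sym_index[OF B Bsym])
  then obtain U d where U: "U \<in> carrier_mat m m" "U\<^sup>T * U = 1\<^sub>m m" "U * U\<^sup>T = 1\<^sub>m m"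
      "A' = U * mat_diag m d * U\<^sup>T"
    using Suc.IH[OF A'] by blast
  have B_eq: "B = four_block_mat (mat 1 1 (\<lambda>_. l)) (0\<^sub>m 1 m) (0\<^sub>m m 1) A'"
  proof (rule eq_matI)
    fix i j assume "i < dim_row (four_block_mat (mat 1 1 (\<lambda>_. l)) (0\<^sub>m 1 m) (0\<^sub>m m 1) A')"
      "j < dim_col (four_block_mat (mat 1 1 (\<lambda>_. l)) (0\<^sub>m 1 m) (0\<^sub>m m 1) A')"
    then have ij: "i < ?n" "j < ?n" using A' by auto
    show "B $$ (i, j) = four_block_mat (mat 1 1 (\<lambda>_. l)) (0\<^sub>m 1 m) (0\<^sub>m m 1) A' $$ (i, j)"
      using ij A' col0[of i] col0[of j] sym_index[OF B Bsym, of i j]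
      by (cases i; cases j) (auto simp: A'_def)
  qed (use A' B in auto)
  define W where "W = four_block_mat (1\<^sub>m 1) (0\<^sub>m 1 m) (0\<^sub>m m 1) U"
  have W: "W \<in> carrier_mat ?n ?n" using U(1) by (auto simp: W_def)
  have WT: "W\<^sup>T = four_block_mat (1\<^sub>m 1) (0\<^sub>m 1 m) (0\<^sub>m m 1) (U\<^sup>T)"
    unfolding W_def using transpose_block_diag[OF one_carrier_mat U(1)] by simp
  have one: "four_block_mat (1\<^sub>m 1) (0\<^sub>m 1 m) (0\<^sub>m m 1) (1\<^sub>m m) = (1\<^sub>m ?n :: real mat)"
    by (rule eq_matI) auto
  have UT: "U\<^sup>T \<in> carrier_mat m m" using U by simp
  have WW: "W\<^sup>T * W = 1\<^sub>m ?n" "W * W\<^sup>T = 1\<^sub>m ?n"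
    unfolding WT unfolding W_def mult_block_diag[OF one_carrier_mat one_carrier_mat U(1) UT]
      mult_block_diag[OF one_carrier_mat one_carrier_mat UT U(1)] U(2,3)
    using one by simp_all
  have l: "mat 1 1 (\<lambda>_. l) \<in> carrier_mat 1 1" by simp
  have UD: "U * mat_diag m d \<in> carrier_mat m m" using U(1) by simp
  have "W * mat_diag ?n (case_nat l d) =
      four_block_mat (mat 1 1 (\<lambda>_. l)) (0\<^sub>m 1 m) (0\<^sub>m m 1) (U * mat_diag m d)"
    unfolding mat_diag_Suc W_def mult_block_diag[OF one_carrier_mat l U(1) mat_diag_carrier] by simp
  then have B_diag: "B = W * mat_diag ?n (case_nat l d) * W\<^sup>T"
    unfolding B_eq WT using mult_block_diag[OF l one_carrier_mat UD UT] U(4) by simp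
  show ?case
  proof (intro exI conjI)
    show "H * W \<in> carrier_mat ?n ?n" using H W by simp
    have HWT: "(H * W)\<^sup>T = W\<^sup>T * H" using H W by (simp add: transpose_mult[of _ ?n ?n _ ?n])
    have "W\<^sup>T * H * (H * W) = W\<^sup>T * (H * H) * W"
      using H(1) W by (simp add: assoc_mult_mat[of _ ?n ?n _ ?n _ ?n])
    then show "(H * W)\<^sup>T * (H * W) = 1\<^sub>m ?n"
      unfolding HWT H(3) using W WW by simp
    have "H * W * (W\<^sup>T * H) = H * (W * W\<^sup>T) * H"
      using H(1) W by (simp add: assoc_mult_mat[of _ ?n ?n _ ?n _ ?n])
    then show "H * W * (H * W)\<^sup>T = 1\<^sub>m ?n"
      unfolding HWT WW(2) using H by simp
    have "A = (H * H) * A * (H * H)" using A H(3) by simp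
    also have "\<dots> = H * B * H"
      unfolding B_def using H(1) A(1) by (simp add: assoc_mult_mat[of _ ?n ?n _ ?n _ ?n])
    also have "\<dots> = H * W * mat_diag ?n (case_nat l d) * (W\<^sup>T * H)"
      unfolding B_diag using H(1) W
      by (simp add: assoc_mult_mat[of _ ?n ?n _ ?n _ ?n] mult_carrier_mat[of _ ?n ?n _ ?n])
    finally show "A = H * W * mat_diag ?n (case_nat l d) * (H * W)\<^sup>T"
      unfolding HWT .
  qed
qed

text \<open>The terms with i = j vanish on the right, so only products of two distinct weights
  occur. Hence a lower bound on products of distinct eigenvalues controls the Gram determinant on a
  plane.\<close>

lemma weighted_lagrange_identity:
  fixes d x y :: "nat \<Rightarrow> real"
  shows "2 * ((\<Sum>i<n. d i * (x i)\<^sup>2) * (\<Sum>i<n. d i * (y i)\<^sup>2) - (\<Sum>i<n. d i * (x i * y i))\<^sup>2) =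
    (\<Sum>i<n. \<Sum>j<n. d i * d j * (x i * y j - x j * y i)\<^sup>2)"
proof -
  let ?P = "\<Sum>i<n. d i * (x i)\<^sup>2" and ?Q = "\<Sum>i<n. d i * (y i)\<^sup>2" and ?R = "\<Sum>i<n. d i * (x i * y i)"
  have "(\<Sum>i<n. \<Sum>j<n. d i * d j * (x i * y j - x j * y i)\<^sup>2) =
      (\<Sum>i<n. \<Sum>j<n. (d i * (x i)\<^sup>2) * (d j * (y j)\<^sup>2) + (d i * (y i)\<^sup>2) * (d j * (x j)\<^sup>2)
        - 2 * ((d i * (x i * y i)) * (d j * (x j * y j))))"
    by (intro sum.cong refl) (simp add: power2_eq_square algebra_simps)
  also have "\<dots> = ?P * ?Q + ?Q * ?P - 2 * (?R * ?R)"
    by (simp only: sum.distrib sum_subtractf sum_product flip: sum_distrib_left)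
  finally show ?thesis by (simp only: power2_eq_square) simp
qed

lemma diag_quadratic_form:
  fixes d :: "nat \<Rightarrow> real"
  assumes "x \<in> carrier_vec n" "y \<in> carrier_vec n"
  shows "x \<bullet> (mat_diag n d *\<^sub>v y) = (\<Sum>i<n. d i * (x $ i * y $ i))"
proof -
  have "(\<Sum>j<n. mat_diag n d $$ (i, j) * (x $ i * y $ j)) = d i * (x $ i * y $ i)" if "i < n" for i
  proof -
    have "(\<Sum>j<n. mat_diag n d $$ (i, j) * (x $ i * y $ j)) =
        (\<Sum>j<n. if j = i then d i * (x $ i * y $ i) else 0)"
      using that by (intro sum.cong) (auto simp: mat_diag_def)
    then show ?thesis using that by simp
  qed
  then show ?thesis
    by (simp add: scalar_prod_mult_mat_vec[OF mat_diag_carrier assms])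
qed

text \<open>Antisymmetry makes J y orthogonal to y, so only the component of x orthogonal to y
  contributes, and Cauchy-Schwarz yields the Gram determinant instead of the product of norms. The
  vector \<open>w\<close> is this component multiplied by \<open>y \<bullet> y\<close>, which avoids
  a division.\<close>

lemma antisym_contraction_bound:
  fixes J :: "real mat"
  assumes J: "J \<in> carrier_mat n n" "J\<^sup>T = - J"
    and contr: "\<And>y. y \<in> carrier_vec n \<Longrightarrow> (J *\<^sub>v y) \<bullet> (J *\<^sub>v y) \<le> y \<bullet> y"
    and xy: "x \<in> carrier_vec n" "y \<in> carrier_vec n"
  shows "(x \<bullet> (J *\<^sub>v y))\<^sup>2 \<le> (x \<bullet> x) * (y \<bullet> y) - (x \<bullet> y)\<^sup>2"
proof -
  have CS: "(a \<bullet> b)\<^sup>2 \<le> (a \<bullet> a) * (b \<bullet> b)" if "a \<in> carrier_vec n" "b \<in> carrier_vec n" for a b :: "real vec"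
  proof -
    have "0 \<le> 2 * ((\<Sum>i<n. 1 * (a $ i)\<^sup>2) * (\<Sum>i<n. 1 * (b $ i)\<^sup>2) - (\<Sum>i<n. 1 * (a $ i * b $ i))\<^sup>2)"
      unfolding weighted_lagrange_identity by (intro sum_nonneg) simp
    then show ?thesis
      using that by (simp add: scalar_prod_def atLeast0LessThan power2_eq_square)
  qed
  define N p where "N = y \<bullet> y" and "p = x \<bullet> y"
  define w where "w = N \<cdot>\<^sub>v x - p \<cdot>\<^sub>v y"
  have w: "w \<in> carrier_vec n" and Jy: "J *\<^sub>v y \<in> carrier_vec n" using xy J by (auto simp: w_def)
  have wJ: "w \<bullet> (J *\<^sub>v y) = N * (x \<bullet> (J *\<^sub>v y))"
    unfolding w_def using xy Jy antisym_quadratic_form[OF J xy(2)]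
    by (simp add: minus_scalar_prod_distrib[of _ n])
  have ww: "w \<bullet> w = N * (N * (x \<bullet> x) - p\<^sup>2)"
    unfolding w_def using xy comm_scalar_prod[OF xy]
    by (simp add: minus_scalar_prod_distrib[of _ n] scalar_prod_minus_distrib[of _ n]
        N_def p_def algebra_simps power2_eq_square)
  have "(N * (x \<bullet> (J *\<^sub>v y)))\<^sup>2 \<le> (w \<bullet> w) * ((J *\<^sub>v y) \<bullet> (J *\<^sub>v y))"
    using CS[OF w Jy] by (simp add: wJ)
  also have "\<dots> \<le> (w \<bullet> w) * N"
    unfolding N_def by (intro mult_left_mono contr xy scalar_prod_self_nonneg)
  finally have *: "N\<^sup>2 * (x \<bullet> (J *\<^sub>v y))\<^sup>2 \<le> N\<^sup>2 * (N * (x \<bullet> x) - p\<^sup>2)"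
    unfolding ww by (simp add: power2_eq_square algebra_simps)
  show ?thesis
  proof (cases "N = 0")
    case True
    have "(J *\<^sub>v y) \<bullet> (J *\<^sub>v y) = 0"
      using contr[OF xy(2)] True scalar_prod_self_nonneg[of "J *\<^sub>v y"] by (simp add: N_def)
    then show ?thesis using CS[OF xy(1) Jy] CS[OF xy] True by (simp add: N_def)
  next
    case False
    then have "0 < N\<^sup>2" by simp
    then show ?thesis using * by (simp add: N_def p_def mult.commute)
  qed
qed

text \<open>The argument of Wolf, Eisert and Plenio: on the plane spanned by \<open>x\<close> and \<open>y\<close> the determinant of the
  form is at least \<open>\<mu>\<^sup>2\<close> times the squared area, which in turn dominates \<open>(x \<bullet> J y)\<^sup>2\<close>.\<close>

lemma orthogonal_diag_bound:
  fixes J U :: "real mat"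
  assumes J: "J \<in> carrier_mat n n" "J\<^sup>T = - J"
    and contr: "\<And>y. y \<in> carrier_vec n \<Longrightarrow> (J *\<^sub>v y) \<bullet> (J *\<^sub>v y) \<le> y \<bullet> y"
    and U: "U \<in> carrier_mat n n" "U * U\<^sup>T = 1\<^sub>m n"
    and d: "\<And>i. i < n \<Longrightarrow> 0 \<le> d i" "\<And>i j. i < n \<Longrightarrow> j < n \<Longrightarrow> i \<noteq> j \<Longrightarrow> \<mu>\<^sup>2 \<le> d i * d j"
    and xy: "x \<in> carrier_vec n" "y \<in> carrier_vec n"
  shows "2 * (\<mu> * (x \<bullet> (J *\<^sub>v y))) \<le>
    x \<bullet> (U * mat_diag n d * U\<^sup>T *\<^sub>v x) + y \<bullet> (U * mat_diag n d * U\<^sup>T *\<^sub>v y)"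
proof -
  define a b where "a = U\<^sup>T *\<^sub>v x" and "b = U\<^sup>T *\<^sub>v y"
  have ab: "a \<in> carrier_vec n" "b \<in> carrier_vec n" using U xy by (auto simp: a_def b_def)
  have iso: "(U\<^sup>T *\<^sub>v v) \<bullet> (U\<^sup>T *\<^sub>v w) = v \<bullet> w" if "v \<in> carrier_vec n" "w \<in> carrier_vec n" for v w
  proof -
    have "(U\<^sup>T *\<^sub>v v) \<bullet> (U\<^sup>T *\<^sub>v w) = v \<bullet> (U *\<^sub>v (U\<^sup>T *\<^sub>v w))"
      using scalar_prod_transpose[OF U(1) that(1), of "U\<^sup>T *\<^sub>v w"] U that by simp
    also have "U *\<^sub>v (U\<^sup>T *\<^sub>v w) = w"
      using U that by (metis assoc_mult_mat_vec one_mult_mat_vec transpose_carrier_mat)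
    finally show ?thesis .
  qed
  have P: "z \<bullet> (U * mat_diag n d * U\<^sup>T *\<^sub>v z) = (\<Sum>i<n. d i * ((U\<^sup>T *\<^sub>v z) $ i)\<^sup>2)"
    if "z \<in> carrier_vec n" for z
    unfolding congruence_quadratic_form[OF U(1) mat_diag_carrier that that]
    using U that by (subst diag_quadratic_form) (auto simp: power2_eq_square)
  define Sa Sb where "Sa = (\<Sum>i<n. d i * (a $ i)\<^sup>2)" and "Sb = (\<Sum>i<n. d i * (b $ i)\<^sup>2)"
  have S0: "0 \<le> Sa" "0 \<le> Sb" using d(1) by (auto simp: Sa_def Sb_def intro!: sum_nonneg)
  have "2 * (\<mu>\<^sup>2 * ((a \<bullet> a) * (b \<bullet> b) - (a \<bullet> b)\<^sup>2)) =
      \<mu>\<^sup>2 * (2 * ((\<Sum>i<n. 1 * (a $ i)\<^sup>2) * (\<Sum>i<n. 1 * (b $ i)\<^sup>2) - (\<Sum>i<n. 1 * (a $ i * b $ i))\<^sup>2))"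
    using ab by (simp add: scalar_prod_def atLeast0LessThan power2_eq_square)
  also have "\<dots> = (\<Sum>i<n. \<Sum>j<n. \<mu>\<^sup>2 * (a $ i * b $ j - a $ j * b $ i)\<^sup>2)"
    unfolding weighted_lagrange_identity by (simp add: sum_distrib_left)
  also have "\<dots> \<le> (\<Sum>i<n. \<Sum>j<n. d i * d j * (a $ i * b $ j - a $ j * b $ i)\<^sup>2)"
  proof (intro sum_mono)
    fix i j assume "i \<in> {..<n}" "j \<in> {..<n}"
    then show "\<mu>\<^sup>2 * (a $ i * b $ j - a $ j * b $ i)\<^sup>2 \<le> d i * d j * (a $ i * b $ j - a $ j * b $ i)\<^sup>2"
      using d(2)[of i j] by (cases "i = j") (auto intro!: mult_right_mono)
  qed
  also have "\<dots> = 2 * (Sa * Sb - (\<Sum>i<n. d i * (a $ i * b $ i))\<^sup>2)"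
    unfolding Sa_def Sb_def weighted_lagrange_identity ..
  finally have "2 * (\<mu>\<^sup>2 * ((x \<bullet> x) * (y \<bullet> y) - (x \<bullet> y)\<^sup>2)) \<le>
      2 * (Sa * Sb - (\<Sum>i<n. d i * (a $ i * b $ i))\<^sup>2)"
    unfolding a_def b_def iso[OF xy(1,1)] iso[OF xy(2,2)] iso[OF xy] .
  then have "\<mu>\<^sup>2 * ((x \<bullet> x) * (y \<bullet> y) - (x \<bullet> y)\<^sup>2) \<le> Sa * Sb - (\<Sum>i<n. d i * (a $ i * b $ i))\<^sup>2"
    by simp
  also have "\<dots> \<le> Sa * Sb" by simp
  finally have "\<mu>\<^sup>2 * ((x \<bullet> x) * (y \<bullet> y) - (x \<bullet> y)\<^sup>2) \<le> Sa * Sb" .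
  moreover have "\<mu>\<^sup>2 * (x \<bullet> (J *\<^sub>v y))\<^sup>2 \<le> \<mu>\<^sup>2 * ((x \<bullet> x) * (y \<bullet> y) - (x \<bullet> y)\<^sup>2)"
    by (intro mult_left_mono antisym_contraction_bound[OF J contr xy]) auto
  ultimately have le: "(\<mu> * (x \<bullet> (J *\<^sub>v y)))\<^sup>2 \<le> Sa * Sb" by (simp add: power_mult_distrib)
  have "(2 * (\<mu> * (x \<bullet> (J *\<^sub>v y))))\<^sup>2 \<le> (Sa + Sb)\<^sup>2"
  proof -
    have "(2 * (\<mu> * (x \<bullet> (J *\<^sub>v y))))\<^sup>2 = 4 * (\<mu> * (x \<bullet> (J *\<^sub>v y)))\<^sup>2" by (simp only: power_mult_distrib) simp
    also have "\<dots> \<le> 4 * (Sa * Sb)" using le by simp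
    also have "\<dots> = (Sa + Sb)\<^sup>2 - (Sa - Sb)\<^sup>2" by (simp add: power2_eq_square algebra_simps)
    also have "\<dots> \<le> (Sa + Sb)\<^sup>2" by simp
    finally show ?thesis .
  qed
  then have "2 * (\<mu> * (x \<bullet> (J *\<^sub>v y))) \<le> Sa + Sb"
    by (rule power2_le_imp_le) (use S0 in simp)
  then show ?thesis unfolding P[OF xy(1)] P[OF xy(2)] Sa_def Sb_def a_def b_def .
qed

section \<open>Pure two-mode states\<close>

lemma pure_stateD:
  assumes "pure_state N S"
  shows "gaussian_state N S" "S \<in> carrier_mat (2 * N) (2 * N)" "S\<^sup>T = S" "det S = 1"
  using assms by (auto simp: pure_state_def gaussian_state_def)

lemma pure_state_2D:
  assumes "pure_state 2 S"
  shows "gaussian_state 2 S" "S \<in> carrier_mat 4 4" "S\<^sup>T = S" "det S = 1"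
  using pure_stateD[OF assms] by auto

text \<open>For determinant 1 the determinant of S + i Omega is 2 - seralian.\<close>

lemma pure_seralian_le:
  assumes "pure_state 2 S"
  shows "seralian S \<le> 2"
proof -
  note S = pure_state_2D[OF assms]
  have "psd 4 (cmat S + \<i> \<cdot>\<^sub>m cmat (Omega 2))" using S(1) by (simp add: gaussian_state_def)
  then have "0 \<le> complex_of_real (1 - seralian S + 1)"
    using det_psd_nonneg det_add_Omega[OF S(2,3), of \<i>] S(4) by fastforce
  then show ?thesis by (simp add: less_eq_complex_def)
qed

text \<open>The two invariants add up to twice the sum of the local determinants, and the previous
  bound caps one of them. The local determinants are bounded from below by the position block, so
  position correlations alone certify entanglement.\<close>

lemma pure_seralian_pt_ge:
  assumes "pure_state 2 S"
  shows "4 * (S $$ (0,0) * S $$ (2,2)) \<le>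
    (S $$ (0,0) * S $$ (2,2) - (S $$ (0,2))\<^sup>2) * (seralian_pt S + 2)"
proof -
  note S = pure_state_2D[OF assms]
  note b = gaussian_position_block[OF S(1)]
  let ?D = "S $$ (0,0) * S $$ (2,2) - (S $$ (0,2))\<^sup>2"
  let ?A = "S $$ (0,0) * S $$ (1,1) - (S $$ (0,1))\<^sup>2" and ?B = "S $$ (2,2) * S $$ (3,3) - (S $$ (2,3))\<^sup>2"
  have "2 * (?A + ?B) \<le> seralian_pt S + 2"
    using pure_seralian_le[OF assms] sym4[OF S(2,3)]
    by (simp add: seralian_def seralian_pt_def power2_eq_square)
  then have "?D * (2 * (?A + ?B)) \<le> ?D * (seralian_pt S + 2)"
    using b(3) by (intro mult_left_mono) auto
  moreover have "?D * (2 * (?A + ?B)) = 2 * (?D * ?A) + 2 * (?D * ?B)" by (simp add: algebra_simps)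
  ultimately show ?thesis using b(4,5) by linarith
qed

text \<open>The determinant of the position block is at most the product of its diagonal, so the
  preceding bound forces \<open>seralian_pt S\<close> to be at least 2, the range of 2 cosh.\<close>

lemma pure_state_two_mode_squeezing:
  assumes "pure_state 2 S"
  obtains s where "0 \<le> s" "seralian_pt S = 2 * cosh (2 * s)" "eof_pure S = h0 s"
proof -
  note S = pure_state_2D[OF assms]
  note b = gaussian_position_block[OF S(1)]
  let ?D = "S $$ (0,0) * S $$ (2,2) - (S $$ (0,2))\<^sup>2"
  have "?D * 4 \<le> 4 * (S $$ (0,0) * S $$ (2,2))" by simp
  also have "\<dots> \<le> ?D * (seralian_pt S + 2)" by (rule pure_seralian_pt_ge[OF assms])
  finally have "4 \<le> seralian_pt S + 2" using b(3) by (simp only: mult_le_cancel_left_pos)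
  then have "1 \<le> seralian_pt S / 2" by simp
  then have "cosh (2 * (arcosh (seralian_pt S / 2) / 2)) = seralian_pt S / 2"
    "0 \<le> arcosh (seralian_pt S / 2) / 2" by simp_all
  then show ?thesis
    using eof_pure_eq_h0[OF S(2-4), of "arcosh (seralian_pt S / 2) / 2"]
    by (intro that[of "arcosh (seralian_pt S / 2) / 2"]) simp_all
qed

text \<open>The hypothesis says that S + i exp(-r) Omega_pt is positive semidefinite. Its
  determinant, multiplied by exp(2 r), is 2 cosh(2 r) - 2 cosh(2 s), and nonnegativity of r and s
  selects the branch s <= r.\<close>

lemma two_mode_squeezing_le:
  assumes "pure_state 2 S" and s: "0 \<le> s" "seralian_pt S = 2 * cosh (2 * s)" and r: "0 \<le> r"
    and bound: "\<And>x y. x \<in> carrier_vec 4 \<Longrightarrow> y \<in> carrier_vec 4 \<Longrightarrow>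
      2 * (exp (- r) * (x \<bullet> (Omega_pt *\<^sub>v y))) \<le> x \<bullet> (S *\<^sub>v x) + y \<bullet> (S *\<^sub>v y)"
  shows "s \<le> r"
proof -
  note S = pure_state_2D[OF assms(1)]
  let ?m = "exp (- r)"
  let ?J = "?m \<cdot>\<^sub>m Omega_pt"
  have J: "?J \<in> carrier_mat 4 4" by simp
  have "?J\<^sup>T = ?m \<cdot>\<^sub>m Omega_pt\<^sup>T" by (rule eq_matI) auto
  then have JT: "?J\<^sup>T = - ?J"
    unfolding Omega_pt_transpose by (intro eq_matI) auto
  have "x \<bullet> (?J *\<^sub>v y) = ?m * (x \<bullet> (Omega_pt *\<^sub>v y))" if "x \<in> carrier_vec 4" "y \<in> carrier_vec 4" for x y
    using that by (simp add: scalar_prod_mult_mat_vec[of _ 4 4] sum_distrib_left mult.assoc)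
  then have "psd 4 (cmat S + \<i> \<cdot>\<^sub>m cmat ?J)"
    unfolding psd_complex_iff[OF S(2,3) J JT] using bound by simp
  moreover have "\<i> \<cdot>\<^sub>m cmat ?J = (\<i> * of_real ?m) \<cdot>\<^sub>m cmat Omega_pt"
    by (rule eq_matI) auto
  ultimately have "psd 4 (cmat S + (\<i> * of_real ?m) \<cdot>\<^sub>m cmat Omega_pt)" by (simp only:)
  from det_psd_nonneg[OF this]
  have "0 \<le> complex_of_real 1 + (\<i> * of_real ?m)\<^sup>2 * of_real (seralian_pt S) + (\<i> * of_real ?m) ^ 4"
    unfolding det_add_Omega_pt[OF S(2,3)] S(4) .
  moreover have "complex_of_real 1 + (\<i> * of_real ?m)\<^sup>2 * of_real (seralian_pt S) + (\<i> * of_real ?m) ^ 4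
      = of_real (1 - ?m\<^sup>2 * seralian_pt S + ?m ^ 4)"
    by (simp add: power_mult_distrib)
  ultimately have "0 \<le> 1 - ?m\<^sup>2 * seralian_pt S + ?m ^ 4" by (simp only: less_eq_complex_def Re_complex_of_real zero_complex.sel)
  moreover have "exp (2 * r) * (1 - ?m\<^sup>2 * seralian_pt S + ?m ^ 4) = 2 * cosh (2 * r) - 2 * cosh (2 * s)"
  proof -
    have "exp (2 * r) * ?m\<^sup>2 = 1" "exp (2 * r) * ?m ^ 4 = exp (- (2 * r))"
      by (simp_all add: exp_of_nat_mult[symmetric] flip: exp_add)
    then have "exp (2 * r) * (1 - ?m\<^sup>2 * seralian_pt S + ?m ^ 4) = exp (2 * r) - seralian_pt S + exp (- (2 * r))"
      by (simp add: algebra_simps)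
    then show ?thesis by (simp add: s(2) cosh_def)
  qed
  ultimately have "0 \<le> 2 * cosh (2 * r) - 2 * cosh (2 * s)"
    by (metis exp_ge_zero mult_nonneg_nonneg)
  then show ?thesis using s(1) r cosh_real_nonneg_le_iff[of "2 * s" "2 * r"] by simp
qed

text \<open>Replacing the momentum variance by its lower bound from the inverse position block turns
  the product of the two bounds into an inequality for that block. Dividing its entries by d = sqrt
  D gives determinant 1, where \<open>two_mode_squeezing_bound\<close> applies. The coefficients u
  and v are those of the noiseless directions behind the beam splitter.\<close>

lemma two_mode_squeezing_ge:
  assumes "pure_state 2 S" and s: "0 \<le> s" "seralian_pt S = 2 * cosh (2 * s)"
    and r: "0 \<le> r" and \<alpha>: "\<bar>\<alpha>\<bar> \<le> exp (- r)"
  defines "u \<equiv> (1 - \<alpha>) / sqrt 2" and "v \<equiv> (1 + \<alpha>) / sqrt 2"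
  assumes bound: "vec_of_list [u, 0, - v, 0] \<bullet> (S *\<^sub>v vec_of_list [u, 0, - v, 0]) \<le> A"
    "vec_of_list [0, u, 0, v] \<bullet> (S *\<^sub>v vec_of_list [0, u, 0, v]) \<le> B"
    and AB: "A * B = (exp (- r) + \<alpha>\<^sup>2 * exp r)\<^sup>2"
  shows "r \<le> s"
proof -
  note S = pure_state_2D[OF assms(1)]
  note b = gaussian_position_block[OF S(1)]
  define G1 G2 G12 D where "G1 = S $$ (0,0)" "G2 = S $$ (2,2)" "G12 = S $$ (0,2)"
    "D = S $$ (0,0) * S $$ (2,2) - (S $$ (0,2))\<^sup>2"
  have D: "0 < D" "D = G1 * G2 - G12\<^sup>2" and G: "0 < G1" "0 < G2"
    using b(1-3) by (simp_all add: G1_G2_G12_D_def)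
  define d where "d = sqrt D"
  have d: "0 < d" "d * d = D" using D by (simp_all add: d_def)
  define q where "q = vec_of_list [0, u, 0, v] \<bullet> (S *\<^sub>v vec_of_list [0, u, 0, v])"
  define p where "p = u\<^sup>2 * G1 - 2 * (u * v) * G12 + v\<^sup>2 * G2"
  have p: "p = vec_of_list [u, 0, - v, 0] \<bullet> (S *\<^sub>v vec_of_list [u, 0, - v, 0])"
    unfolding quadratic_form_4[OF S(2)] sym4[OF S(2,3)] p_def
    by (simp add: G1_G2_G12_D_def power2_eq_square algebra_simps)
  have nonneg: "0 \<le> p" "0 \<le> q"
    unfolding p q_def by (rule gaussian_nonneg[OF S(1)], rule carrier_vecI, simp)+
  have q: "u\<^sup>2 * G2 - 2 * (u * v) * G12 + v\<^sup>2 * G1 \<le> D * q"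
    using b(6)[of u v] unfolding q_def G1_G2_G12_D_def by (simp add: algebra_simps)
  have uv: "u\<^sup>2 = (1 - \<alpha>)\<^sup>2 / 2" "v\<^sup>2 = (1 + \<alpha>)\<^sup>2 / 2" "2 * (u * v) = 1 - \<alpha>\<^sup>2"
    by (simp_all add: u_def v_def power_divide) (simp add: power2_eq_square algebra_simps)
  have "p / d * ((u\<^sup>2 * G2 - 2 * (u * v) * G12 + v\<^sup>2 * G1) / d) \<le> p / d * (D * q / d)"
    using q nonneg d by (intro mult_left_mono divide_right_mono) auto
  also have "\<dots> = p * q" using d by (simp add: field_simps flip: d(2))
  also have "\<dots> \<le> A * B"
    using bound nonneg unfolding p[symmetric] q_def[symmetric] by (intro mult_mono) auto
  finally have le: "p / d * ((u\<^sup>2 * G2 - 2 * (u * v) * G12 + v\<^sup>2 * G1) / d) \<le> (exp (- r) + \<alpha>\<^sup>2 * exp r)\<^sup>2"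
    unfolding AB .
  have "(cosh r)\<^sup>2 \<le> G1 / d * (G2 / d)"
  proof (rule two_mode_squeezing_bound[OF _ _ _ r \<alpha>, of _ _ "G12 / d"])
    have "G1 / d * (G2 / d) - (G12 / d)\<^sup>2 = (G1 * G2 - G12\<^sup>2) / (d * d)"
      by (simp add: power2_eq_square diff_divide_distrib)
    also have "\<dots> = 1" using d D by simp
    finally show "G1 / d * (G2 / d) - (G12 / d)\<^sup>2 = 1" .
    show "((1 - \<alpha>)\<^sup>2 / 2 * (G1 / d) - (1 - \<alpha>\<^sup>2) * (G12 / d) + (1 + \<alpha>)\<^sup>2 / 2 * (G2 / d)) *
        ((1 - \<alpha>)\<^sup>2 / 2 * (G2 / d) - (1 - \<alpha>\<^sup>2) * (G12 / d) + (1 + \<alpha>)\<^sup>2 / 2 * (G1 / d))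
        \<le> (exp (- r) + \<alpha>\<^sup>2 * exp r)\<^sup>2"
      using le unfolding p_def uv by (simp add: diff_divide_distrib add_divide_distrib)
  qed (use G d in auto)
  also have "\<dots> = G1 * G2 / D" using d by simp
  finally have "D * (cosh r)\<^sup>2 \<le> G1 * G2" using D(1) by (simp add: field_simps)
  moreover have "4 * (G1 * G2) \<le> D * (seralian_pt S + 2)"
    using pure_seralian_pt_ge[OF assms(1)] by (simp add: G1_G2_G12_D_def)
  ultimately have "D * (4 * (cosh r)\<^sup>2) \<le> D * (seralian_pt S + 2)" by linarith
  then have "4 * (cosh r)\<^sup>2 \<le> seralian_pt S + 2" using D by simp
  moreover have "seralian_pt S + 2 = 4 * (cosh s)\<^sup>2"
    unfolding s(2) cosh_double using hyperbolic_pythagoras[of s] by (simp add: algebra_simps)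
  ultimately have "(cosh r)\<^sup>2 \<le> (cosh s)\<^sup>2" by simp
  then have "cosh r \<le> cosh s" by (rule power2_le_imp_le) simp
  then show ?thesis using cosh_real_nonneg_le_iff[OF r s(1)] by simp
qed

section \<open>Ordinary spectrum and squeezing of a pure state\<close>

lemma eigs_up_orthogonal_diag:
  assumes U: "U \<in> carrier_mat n n" "U * U\<^sup>T = 1\<^sub>m n"
  shows "eigs_up (U * mat_diag n d * U\<^sup>T) = sort (map d [0..<n])"
    and "char_poly (U * mat_diag n d * U\<^sup>T) = (\<Prod>a\<leftarrow>map d [0..<n]. [:- a, 1:])"
proof -
  have "U\<^sup>T * U = 1\<^sub>m n" using mat_mult_left_right_inverse[OF U(1) _ U(2)] U(1) by simp
  then have "similar_mat (U * mat_diag n d * U\<^sup>T) (mat_diag n d)"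
    unfolding similar_mat_def using U
    by (intro exI[of _ U] exI[of _ "U\<^sup>T"] similar_mat_witI[of _ _ n]) auto
  then have "char_poly (U * mat_diag n d * U\<^sup>T) = char_poly (mat_diag n d)" by (rule char_poly_similar)
  also have "\<dots> = (\<Prod>a\<leftarrow>diag_mat (mat_diag n d). [:- a, 1:])"
    by (rule char_poly_upper_triangular[OF mat_diag_carrier]) (auto simp: mat_diag_def upper_triangular_def)
  also have "diag_mat (mat_diag n d) = map d [0..<n]"
    by (auto simp: diag_mat_def mat_diag_def)
  finally show *: "char_poly (U * mat_diag n d * U\<^sup>T) = (\<Prod>a\<leftarrow>map d [0..<n]. [:- a, 1:])" .
  have "proots (\<Prod>a\<leftarrow>es. [:- a, 1:]) = mset es" for es :: "real list"
  proof (induction es)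
    case (Cons a es)
    have "(\<Prod>a\<leftarrow>es. [:- a, 1:]) \<noteq> 0" by (auto simp: prod_list_zero_iff)
    then show ?case using Cons by (simp add: proots_mult del: mult_pCons_left)
  qed simp
  then show "eigs_up (U * mat_diag n d * U\<^sup>T) = sort (map d [0..<n])"
    unfolding eigs_up_def * by (metis sorted_list_of_multiset_mset)
qed

text \<open>Orthogonality of \<open>Omega_pt\<close> makes this an equality. The inequality is the
  form that survives when the matrix is padded with zeros on ancillary modes.\<close>

lemma Omega_pt_contraction:
  assumes "y \<in> carrier_vec 4"
  shows "(Omega_pt *\<^sub>v y) \<bullet> (Omega_pt *\<^sub>v y) \<le> y \<bullet> y"
proof -
  have "Omega_pt\<^sup>T * Omega_pt = 1\<^sub>m 4"
    by (rule eq_matI) (auto simp: Omega_pt_def scalar_prod_def less_Suc_eq numeral_eq_Suc)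
  then have "y = Omega_pt\<^sup>T *\<^sub>v (Omega_pt *\<^sub>v y)"
    using assms by (metis Omega_pt_carrier assoc_mult_mat_vec one_mult_mat_vec transpose_carrier_mat)
  then have "y \<bullet> y = y \<bullet> (Omega_pt\<^sup>T *\<^sub>v (Omega_pt *\<^sub>v y))" by simp
  also have "\<dots> = (Omega_pt *\<^sub>v y) \<bullet> (Omega_pt *\<^sub>v y)"
    using assms by (subst scalar_prod_transpose[of _ 4 4]) (auto intro!: mult_mat_vec_carrier)
  finally show ?thesis by simp
qed

text \<open>By definition exp(-2 sof) is the product of the two smallest eigenvalues, hence a lower
  bound for the product of any two. This is the gap hypothesis of
  \<open>orthogonal_diag_bound\<close> with \<mu> = exp(-sof).\<close>

lemma two_mode_squeezing_le_sof_pure: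
  assumes "pure_state 2 S" and s: "0 \<le> s" "seralian_pt S = 2 * cosh (2 * s)"
  shows "s \<le> sof_pure 2 S"
proof -
  note S = pure_state_2D[OF assms(1)]
  obtain U d where U: "U \<in> carrier_mat 4 4" "U\<^sup>T * U = 1\<^sub>m 4" "U * U\<^sup>T = 1\<^sub>m 4"
    and S_eq: "S = U * mat_diag 4 d * U\<^sup>T"
    using real_symmetric_diagonalization[OF S(2,3)] by blast
  define es where "es = eigs_up S"
  have es: "es = sort (map d [0..<4])"
    unfolding es_def S_eq by (rule eigs_up_orthogonal_diag(1)[OF U(1,3)])
  have len: "length es = 4" by (simp add: es)
  have d0: "0 \<le> d i" if "i < 4" for i
  proof -
    let ?e = "unit_vec 4 i :: real vec"
    have "U\<^sup>T *\<^sub>v (U *\<^sub>v ?e) = U\<^sup>T * U *\<^sub>v ?e"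
      using U(1) by (simp add: assoc_mult_mat_vec[of _ 4 4 _ 4])
    then have "U\<^sup>T *\<^sub>v (U *\<^sub>v ?e) = ?e" using U(2) by simp
    then have "(U *\<^sub>v ?e) \<bullet> (S *\<^sub>v (U *\<^sub>v ?e)) = ?e \<bullet> (mat_diag 4 d *\<^sub>v ?e)"
      unfolding S_eq using U(1) by (subst congruence_quadratic_form[of _ 4 4]) auto
    also have "\<dots> = (\<Sum>j<4. d j * (?e $ j * ?e $ j))" by (rule diag_quadratic_form) auto
    also have "\<dots> = (\<Sum>j<4. if j = i then d i else 0)" using that by (intro sum.cong) auto
    also have "\<dots> = d i" using that by simp
    finally show ?thesis
      using gaussian_nonneg[OF S(1), of "U *\<^sub>v ?e"] U(1) by simp
  qed
  have srt: "es ! i \<le> es ! j" if "i \<le> j" "j < 4" for i j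
    using that len sorted_nth_mono[of es i j] by (simp add: es)
  have "set es = d ` {..<4}" by (auto simp: es)
  then have es0: "0 \<le> es ! i" if "i < 4" for i
    using d0 len nth_mem[of i es] that by auto
  have "prod_list es = prod_mset (mset es)" by (simp add: prod_mset_prod_list)
  also have "\<dots> = prod_list (map d [0..<4])" unfolding es by (simp only: mset_sort prod_mset_prod_list)
  also have "\<dots> = det S"
    using det_eq_prod_roots[OF S(2), of "map d [0..<4]"] eigs_up_orthogonal_diag(2)[OF U(1,3), of d]
    by (simp add: S_eq)
  finally have "prod_list es = 1" using S(4) by simp
  moreover have "es = [es ! 0, es ! 1, es ! 2, es ! 3]"
    using len by (intro nth_equalityI) (auto simp: less_Suc_eq numeral_eq_Suc)
  ultimately have prod1: "es ! 0 * (es ! 1 * (es ! 2 * es ! 3)) = 1"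
    by (metis prod_list.Cons prod_list.Nil mult_1_right)
  then have "es ! 0 \<noteq> 0" "es ! 1 \<noteq> 0" by auto
  then have pos: "0 < es ! 0" "0 < es ! 1" using es0[of 0] es0[of 1] by auto
  define r where "r = sof_pure 2 S"
  have r: "r = - (1 / 2) * ln (es ! 0 * es ! 1)"
    unfolding r_def sof_pure_def es_def[symmetric] using pos by (simp add: numeral_2_eq_2 ln_mult)
  have \<mu>: "(exp (- r))\<^sup>2 = es ! 0 * es ! 1"
    using pos unfolding r by (simp flip: exp_double)
  \<comment> \<open>The product of the lower two eigenvalues is at most that of the upper two, and
    together they multiply to 1.\<close>
  have "0 \<le> r"
  proof -
    have "es ! 0 * es ! 1 \<le> es ! 2 * es ! 3"
      using es0 srt by (intro mult_mono) auto
    then have "(es ! 0 * es ! 1) * (es ! 0 * es ! 1) \<le> (es ! 0 * es ! 1) * (es ! 2 * es ! 3)"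
      using pos by (intro mult_left_mono) auto
    then have "(es ! 0 * es ! 1)\<^sup>2 \<le> 1" using prod1 by (simp add: power2_eq_square mult.assoc)
    then have "es ! 0 * es ! 1 \<le> 1" using pos by (simp add: power2_le_iff_abs_le abs_mult power_le_one_iff)
    then have "ln (es ! 0 * es ! 1) \<le> 0" using pos by (simp add: mult_pos_pos)
    then show ?thesis unfolding r by simp
  qed
  \<comment> \<open>A permutation links the unsorted weights to the sorted list, so distinct indices
    stay distinct positions even when eigenvalues coincide.\<close>
  have "mset (map d [0..<4]) = mset es" by (simp add: es)
  then obtain p where p: "p permutes {..<length es}" "permute_list p es = map d [0..<4]"
    by (rule mset_eq_permutation)
  have gap: "(exp (- r))\<^sup>2 \<le> d i * d j" if ij: "i < 4" "j < 4" "i \<noteq> j" for i j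
  proof -
    have dp: "d k = es ! p k" "p k < 4" if "k < 4" for k
      using arg_cong[OF p(2), of "\<lambda>l. l ! k"] permutes_in_image[OF p(1), of k] that len
      by (auto simp: permute_list_nth[OF p(1)])
    have ne: "p i \<noteq> p j" using ij(3) permutes_inj[OF p(1)] by (auto dest: injD)
    have *: "es ! 0 * es ! 1 \<le> es ! a * es ! b" if "a < b" "b < 4" for a b
      using that srt es0 by (intro mult_mono) auto
    from ne consider "p i < p j" | "p j < p i" by linarith
    then show ?thesis
      unfolding \<mu> using *[of "p i" "p j"] *[of "p j" "p i"] dp ij by cases (auto simp: mult.commute)
  qed
  have contr: "(Omega_pt *\<^sub>v y) \<bullet> (Omega_pt *\<^sub>v y) \<le> y \<bullet> y" if "y \<in> carrier_vec 4" for y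
    using Omega_pt_contraction that .
  show ?thesis
    unfolding r_def[symmetric]
  proof (rule two_mode_squeezing_le[OF assms \<open>0 \<le> r\<close>])
    fix x y :: "real vec" assume xy: "x \<in> carrier_vec 4" "y \<in> carrier_vec 4"
    show "2 * (exp (- r) * (x \<bullet> (Omega_pt *\<^sub>v y))) \<le> x \<bullet> (S *\<^sub>v x) + y \<bullet> (S *\<^sub>v y)"
      unfolding S_eq
      by (rule orthogonal_diag_bound[OF Omega_pt_carrier Omega_pt_transpose contr U(1,3) d0 gap xy])
  qed
qed

section \<open>Direct sums and passive transformations\<close>

lemma four_block_mat_split:
  assumes "X \<in> carrier_mat (n + m) (n + m)"
  shows "X = four_block_mat (mat n n (\<lambda>ij. X $$ ij)) (mat n m (\<lambda>(i, j). X $$ (i, n + j)))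
    (mat m n (\<lambda>(i, j). X $$ (n + i, j))) (mat m m (\<lambda>(i, j). X $$ (n + i, n + j)))"
  using assms by (intro eq_matI) auto

text \<open>Tracing out modes amounts to testing with vectors that vanish on them.\<close>

lemma quadratic_form_upper_left_block:
  fixes X :: "'a :: comm_ring_1 mat"
  assumes X: "X \<in> carrier_mat (n + m) (n + m)" and f: "f \<in> carrier_vec n"
  shows "(f @\<^sub>v 0\<^sub>v m) \<bullet> (X *\<^sub>v (f @\<^sub>v 0\<^sub>v m)) = f \<bullet> (mat n n (\<lambda>ij. X $$ ij) *\<^sub>v f)"
proof -
  let ?A = "mat n n (\<lambda>ij. X $$ ij)" and ?B = "mat n m (\<lambda>(i, j). X $$ (i, n + j))"
  let ?C = "mat m n (\<lambda>(i, j). X $$ (n + i, j))" and ?D = "mat m m (\<lambda>(i, j). X $$ (n + i, n + j))"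
  have A: "?A \<in> carrier_mat n n" "?B \<in> carrier_mat n m" "?C \<in> carrier_mat m n" "?D \<in> carrier_mat m m"
    by auto
  have Af: "?A *\<^sub>v f \<in> carrier_vec n" "?C *\<^sub>v f \<in> carrier_vec m"
    by (rule mult_mat_vec_carrier[OF A(1) f], rule mult_mat_vec_carrier[OF A(3) f])
  have z: "?B *\<^sub>v 0\<^sub>v m = 0\<^sub>v n" "?D *\<^sub>v 0\<^sub>v m = 0\<^sub>v m" by (auto intro!: eq_vecI)
  have "X *\<^sub>v (f @\<^sub>v 0\<^sub>v m) = (?A *\<^sub>v f + ?B *\<^sub>v 0\<^sub>v m) @\<^sub>v (?C *\<^sub>v f + ?D *\<^sub>v 0\<^sub>v m)"
    using four_block_mat_split[OF X] four_block_mat_mult_vec[OF A f zero_carrier_vec] by metis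
  also have "\<dots> = (?A *\<^sub>v f) @\<^sub>v (?C *\<^sub>v f)" unfolding z using Af by simp
  finally show ?thesis
    using scalar_prod_append[OF f zero_carrier_vec Af] Af(2) by simp
qed

lemma block_diag_quadratic_form:
  fixes A B :: "'a :: comm_ring_1 mat"
  assumes A: "A \<in> carrier_mat n n" and B: "B \<in> carrier_mat m m"
    and x: "x1 \<in> carrier_vec n" "x2 \<in> carrier_vec m" "y1 \<in> carrier_vec n" "y2 \<in> carrier_vec m"
  shows "(x1 @\<^sub>v x2) \<bullet> (four_block_mat A (0\<^sub>m n m) (0\<^sub>m m n) B *\<^sub>v (y1 @\<^sub>v y2)) =
    x1 \<bullet> (A *\<^sub>v y1) + x2 \<bullet> (B *\<^sub>v y2)"
proof -
  have z: "0\<^sub>m n m *\<^sub>v y2 = 0\<^sub>v n" "0\<^sub>m m n *\<^sub>v y1 = 0\<^sub>v m" using x by (auto intro!: eq_vecI)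
  have c: "A *\<^sub>v y1 \<in> carrier_vec n" "B *\<^sub>v y2 \<in> carrier_vec m" using A B x by auto
  have "four_block_mat A (0\<^sub>m n m) (0\<^sub>m m n) B *\<^sub>v (y1 @\<^sub>v y2) = (A *\<^sub>v y1) @\<^sub>v (B *\<^sub>v y2)"
    using four_block_mat_mult_vec[OF A zero_carrier_mat zero_carrier_mat B x(3,4)] c z by simp
  then show ?thesis using scalar_prod_append[OF x(1,2) c] by simp
qed

lemma Omega_isometry:
  assumes "y \<in> carrier_vec (2 * N)"
  shows "(Omega N *\<^sub>v y) \<bullet> (Omega N *\<^sub>v y) = y \<bullet> y"
proof -
  have "Omega N *\<^sub>v (Omega N *\<^sub>v y) = Omega N * Omega N *\<^sub>v y"
    using assms by (simp add: assoc_mult_mat_vec[of _ "2 * N" "2 * N" _ "2 * N"])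
  also have "\<dots> = - y"
    unfolding Omega_square using assms by (simp add: uminus_mult_mat_vec)
  finally have "y \<bullet> (Omega N *\<^sub>v (Omega N *\<^sub>v y)) = - (y \<bullet> y)" using assms by simp
  then show ?thesis
    using scalar_prod_antisym_mat[OF Omega_carrier Omega_transpose assms mult_mat_vec_carrier[OF Omega_carrier assms]]
    by simp
qed

lemma gaussian_state_one: "gaussian_state N (1\<^sub>m (2 * N))"
  unfolding gaussian_state_iff
proof (intro conjI ballI)
  fix x y :: "real vec" assume xy: "x \<in> carrier_vec (2 * N)" "y \<in> carrier_vec (2 * N)"
  have c: "Omega N *\<^sub>v y \<in> carrier_vec (2 * N)" by (rule mult_mat_vec_carrier[OF Omega_carrier xy(2)])
  \<comment> \<open>Expanding this square is the uncertainty relation of the vacuum, since Omega is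
    an isometry.\<close>
  have "0 \<le> (x - Omega N *\<^sub>v y) \<bullet> (x - Omega N *\<^sub>v y)" by (rule scalar_prod_self_nonneg)
  also have "\<dots> = x \<bullet> x - 2 * (x \<bullet> (Omega N *\<^sub>v y)) + (Omega N *\<^sub>v y) \<bullet> (Omega N *\<^sub>v y)"
    using xy c comm_scalar_prod[OF xy(1) c]
    by (simp add: minus_scalar_prod_distrib[of _ "2 * N"] scalar_prod_minus_distrib[of _ "2 * N"])
  finally show "2 * (x \<bullet> (Omega N *\<^sub>v y)) \<le> x \<bullet> (1\<^sub>m (2 * N) *\<^sub>v x) + y \<bullet> (1\<^sub>m (2 * N) *\<^sub>v y)"
    using xy Omega_isometry[OF xy(2)] by simp
qed auto

lemma vec_append_split:
  assumes "x \<in> carrier_vec (n + m)"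
  obtains x1 x2 where "x1 \<in> carrier_vec n" "x2 \<in> carrier_vec m" "x = x1 @\<^sub>v x2"
proof
  show "x = vec_first x n @\<^sub>v vec_last x m" using assms by (simp add: vec_first_last_append)
qed auto

lemma gaussian_state_block_diag:
  assumes A: "gaussian_state N A" and B: "gaussian_state M B"
  shows "gaussian_state (N + M) (four_block_mat A (0\<^sub>m (2 * N) (2 * M)) (0\<^sub>m (2 * M) (2 * N)) B)"
  unfolding gaussian_state_iff
proof (intro conjI ballI)
  have cA: "A \<in> carrier_mat (2 * N) (2 * N)" "A\<^sup>T = A" and cB: "B \<in> carrier_mat (2 * M) (2 * M)" "B\<^sup>T = B"
    using A B by (auto simp: gaussian_state_def)
  let ?X = "four_block_mat A (0\<^sub>m (2 * N) (2 * M)) (0\<^sub>m (2 * M) (2 * N)) B"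
  show "?X \<in> carrier_mat (2 * (N + M)) (2 * (N + M))" using cA cB by (simp add: distrib_left)
  show "?X\<^sup>T = ?X" using transpose_block_diag[OF cA(1) cB(1)] cA cB by simp
  fix x y :: "real vec" assume "x \<in> carrier_vec (2 * (N + M))" "y \<in> carrier_vec (2 * (N + M))"
  then have "x \<in> carrier_vec (2 * N + 2 * M)" "y \<in> carrier_vec (2 * N + 2 * M)" by (simp_all add: distrib_left)
  then obtain x1 x2 y1 y2 where x: "x1 \<in> carrier_vec (2 * N)" "x2 \<in> carrier_vec (2 * M)" "x = x1 @\<^sub>v x2"
    and y: "y1 \<in> carrier_vec (2 * N)" "y2 \<in> carrier_vec (2 * M)" "y = y1 @\<^sub>v y2"
    by (meson vec_append_split)
  have "2 * (x1 \<bullet> (Omega N *\<^sub>v y1)) \<le> x1 \<bullet> (A *\<^sub>v x1) + y1 \<bullet> (A *\<^sub>v y1)"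
    "2 * (x2 \<bullet> (Omega M *\<^sub>v y2)) \<le> x2 \<bullet> (B *\<^sub>v x2) + y2 \<bullet> (B *\<^sub>v y2)"
    using A B x y unfolding gaussian_state_iff by blast+
  then show "2 * (x \<bullet> (Omega (N + M) *\<^sub>v y)) \<le> x \<bullet> (?X *\<^sub>v x) + y \<bullet> (?X *\<^sub>v y)"
    unfolding Omega_add x(3) y(3)
    using x y cA cB by (simp add: block_diag_quadratic_form)
qed

section \<open>Passive transformations as congruences\<close>

lemma passive_transf_transpose:
  assumes "passive_transf N K"
  shows "K \<in> carrier_mat (2 * N) (2 * N)" "K * K\<^sup>T = 1\<^sub>m (2 * N)" "K\<^sup>T * K = 1\<^sub>m (2 * N)"
    "K\<^sup>T * Omega N * K = Omega N"
proof -
  let ?n = "2 * N"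
  show K: "K \<in> carrier_mat ?n ?n" and KK: "K * K\<^sup>T = 1\<^sub>m ?n"
    using assms by (auto simp: passive_transf_def)
  show KK': "K\<^sup>T * K = 1\<^sub>m ?n" using mat_mult_left_right_inverse[OF K _ KK] K by simp
  have "K\<^sup>T * (K * Omega N * K\<^sup>T) * K = (K\<^sup>T * K) * Omega N * (K\<^sup>T * K)"
    using K by (simp add: assoc_mult_mat[of _ ?n ?n _ ?n _ ?n] mult_carrier_mat[of _ ?n ?n _ ?n])
  then show "K\<^sup>T * Omega N * K = Omega N"
    using assms KK' by (simp add: passive_transf_def left_mult_one_mat[OF Omega_carrier] right_mult_one_mat[OF Omega_carrier])
qed

lemma passive_congruence:
  assumes K: "passive_transf N K"
  shows "gaussian_state N A \<Longrightarrow> gaussian_state N (K * A * K\<^sup>T)"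
    and "A \<in> carrier_mat (2 * N) (2 * N) \<Longrightarrow> A * Omega N * A = Omega N \<Longrightarrow>
      K * A * K\<^sup>T * Omega N * (K * A * K\<^sup>T) = Omega N"
    and "A \<in> carrier_mat (2 * N) (2 * N) \<Longrightarrow> det (K * A * K\<^sup>T) = det A"
proof -
  let ?n = "2 * N"
  note k = passive_transf_transpose[OF K]
  have kT: "K * Omega N * K\<^sup>T = Omega N" using K by (simp add: passive_transf_def)
  {
    assume A: "gaussian_state N A"
    then have cA: "A \<in> carrier_mat ?n ?n" "A\<^sup>T = A" by (auto simp: gaussian_state_def)
    show "gaussian_state N (K * A * K\<^sup>T)"
      unfolding gaussian_state_iff
    proof (intro conjI ballI)
      show "K * A * K\<^sup>T \<in> carrier_mat ?n ?n" using k cA by simp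
      show "(K * A * K\<^sup>T)\<^sup>T = K * A * K\<^sup>T"
        using k cA by (simp add: transpose_mult[of _ ?n ?n _ ?n] assoc_mult_mat[of _ ?n ?n _ ?n _ ?n])
      fix x y :: "real vec" assume xy: "x \<in> carrier_vec ?n" "y \<in> carrier_vec ?n"
      have c: "K\<^sup>T *\<^sub>v x \<in> carrier_vec ?n" "K\<^sup>T *\<^sub>v y \<in> carrier_vec ?n" using k xy by auto
      have "2 * ((K\<^sup>T *\<^sub>v x) \<bullet> (Omega N *\<^sub>v (K\<^sup>T *\<^sub>v y))) \<le>
          (K\<^sup>T *\<^sub>v x) \<bullet> (A *\<^sub>v (K\<^sup>T *\<^sub>v x)) + (K\<^sup>T *\<^sub>v y) \<bullet> (A *\<^sub>v (K\<^sup>T *\<^sub>v y))"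
        using A c unfolding gaussian_state_iff by blast
      then show "2 * (x \<bullet> (Omega N *\<^sub>v y)) \<le> x \<bullet> (K * A * K\<^sup>T *\<^sub>v x) + y \<bullet> (K * A * K\<^sup>T *\<^sub>v y)"
        using congruence_quadratic_form[OF k(1) Omega_carrier xy]
          congruence_quadratic_form[OF k(1) cA(1) xy(1,1)] congruence_quadratic_form[OF k(1) cA(1) xy(2,2)]
        by (simp add: kT)
    qed
  }
  {
    assume A: "A \<in> carrier_mat ?n ?n"
    {
      assume AOA: "A * Omega N * A = Omega N"
      have "K * A * K\<^sup>T * Omega N * (K * A * K\<^sup>T) = K * (A * (K\<^sup>T * Omega N * K) * A) * K\<^sup>T"
        using A k(1) by (simp add: assoc_mult_mat[of _ ?n ?n _ ?n _ ?n] mult_carrier_mat[of _ ?n ?n _ ?n])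
      then show "K * A * K\<^sup>T * Omega N * (K * A * K\<^sup>T) = Omega N"
        unfolding k(4) AOA kT .
    }
    have "det (K * A * K\<^sup>T) = det K * det A * det (K\<^sup>T)"
      using A k(1) by (simp add: det_mult[of _ ?n] mult_carrier_mat[of _ ?n ?n _ ?n])
    also have "\<dots> = det A * det (K * K\<^sup>T)"
      using k(1) by (simp add: det_mult[of _ ?n])
    finally show "det (K * A * K\<^sup>T) = det A" by (simp add: k(2))
  }
qed

lemma passive_transf_mult:
  assumes "passive_transf N K" "passive_transf N L"
  shows "passive_transf N (K * L)"
proof -
  let ?n = "2 * N"
  note k = passive_transf_transpose[OF assms(1)] and l = passive_transf_transpose[OF assms(2)]
  have T: "(K * L)\<^sup>T = L\<^sup>T * K\<^sup>T" using k(1) l(1) by (simp add: transpose_mult[of _ ?n ?n _ ?n])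
  have "K * L * (L\<^sup>T * K\<^sup>T) = K * (L * L\<^sup>T) * K\<^sup>T"
    "K * L * Omega N * (L\<^sup>T * K\<^sup>T) = K * (L * Omega N * L\<^sup>T) * K\<^sup>T"
    using k(1) l(1) by (simp_all add: assoc_mult_mat[of _ ?n ?n _ ?n _ ?n] mult_carrier_mat[of _ ?n ?n _ ?n])
  then show ?thesis
    using assms k(1) l(1) unfolding passive_transf_def T by simp
qed

lemma passive_transf_one: "passive_transf N (1\<^sub>m (2 * N))"
  by (simp add: passive_transf_def left_mult_one_mat[OF Omega_carrier] right_mult_one_mat[OF Omega_carrier])

lemma passive_transf_block_diag:
  assumes "passive_transf N K" "passive_transf M L"
  shows "passive_transf (N + M) (four_block_mat K (0\<^sub>m (2 * N) (2 * M)) (0\<^sub>m (2 * M) (2 * N)) L)"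
proof -
  note k = passive_transf_transpose[OF assms(1)] and l = passive_transf_transpose[OF assms(2)]
  have c: "K * Omega N \<in> carrier_mat (2 * N) (2 * N)" "L * Omega M \<in> carrier_mat (2 * M) (2 * M)"
    "K\<^sup>T \<in> carrier_mat (2 * N) (2 * N)" "L\<^sup>T \<in> carrier_mat (2 * M) (2 * M)"
    using k(1) l(1) by auto
  have one: "four_block_mat (1\<^sub>m (2 * N)) (0\<^sub>m (2 * N) (2 * M)) (0\<^sub>m (2 * M) (2 * N)) (1\<^sub>m (2 * M)) =
      (1\<^sub>m (2 * (N + M)) :: real mat)"
    by (rule eq_matI) auto
  show ?thesis
    using assms k(1) l(1)
    unfolding passive_transf_def Omega_add transpose_block_diag[OF k(1) l(1)]
      mult_block_diag[OF k(1) c(3) l(1) c(4)] mult_block_diag[OF k(1) Omega_carrier l(1) Omega_carrier]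
      mult_block_diag[OF c(1,3,2,4)]
    by (simp add: one distrib_left)
qed

section \<open>Conditional states of a heterodyne measurement\<close>

lemma uminus_smult_mat: "- (A :: 'a :: comm_ring_1 mat) = (- 1) \<cdot>\<^sub>m A"
  by (rule eq_matI) auto

text \<open>Since \<open>P\<close> is symplectic, its inverse is \<open>- \<Omega> P \<Omega>\<close>, which turns the determinant into
  that of the block of the inverse.\<close>

lemma det_add_one_lower_block:
  fixes A B C E :: "real mat"
  assumes A: "A \<in> carrier_mat (2 * N) (2 * N)" and B: "B \<in> carrier_mat (2 * N) (2 * M)"
    and C: "C \<in> carrier_mat (2 * M) (2 * N)" and E: "E \<in> carrier_mat (2 * M) (2 * M)"
    and P: "P = four_block_mat A B C E"
    and sP: "P * Omega (N + M) * P = Omega (N + M)" and dP: "det P = 1"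
  shows "det (four_block_mat A B C (E + 1\<^sub>m (2 * M))) = det (E + 1\<^sub>m (2 * M))"
proof -
  let ?n = "2 * N" and ?m = "2 * M"
  let ?k = "?n + ?m"
  let ?O = "Omega (N + M)"
  have cO: "?O \<in> carrier_mat ?k ?k" using Omega_carrier[of "N + M"] by (simp only: distrib_left)
  have cP: "P \<in> carrier_mat ?k ?k" unfolding P using A E by simp
  define F where "F = Omega N * B * Omega M"
  define G where "G = Omega M * E * Omega M"
  have cF: "F \<in> carrier_mat ?n ?m" unfolding F_def
    by (rule mult_carrier_mat[OF mult_carrier_mat[OF Omega_carrier B] Omega_carrier])
  have cG: "G \<in> carrier_mat ?m ?m" unfolding G_def
    by (rule mult_carrier_mat[OF mult_carrier_mat[OF Omega_carrier E] Omega_carrier])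
  define Z :: "real mat" where "Z = four_block_mat (0\<^sub>m ?n ?n) (0\<^sub>m ?n ?m) (0\<^sub>m ?m ?n) (1\<^sub>m ?m)"
  have cZ: "Z \<in> carrier_mat ?k ?k" by (simp add: Z_def)
  have OZ: "?O * Z = four_block_mat (0\<^sub>m ?n ?n) (0\<^sub>m ?n ?m) (0\<^sub>m ?m ?n) (Omega M)"
    unfolding Omega_add Z_def mult_block_diag[OF Omega_carrier zero_carrier_mat Omega_carrier one_carrier_mat]
    by (simp add: right_mult_zero_mat[OF Omega_carrier] right_mult_one_mat[OF Omega_carrier])
  have POZ: "P * (?O * Z) = four_block_mat (0\<^sub>m ?n ?n) (B * Omega M) (0\<^sub>m ?m ?n) (E * Omega M)"
    unfolding P OZ using A B C E mult_carrier_mat[OF B Omega_carrier] mult_carrier_mat[OF E Omega_carrier]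
    by (subst mult_four_block_mat[of _ ?n ?n _ ?m _ ?m _ _ ?n _ ?m]) auto
  have OPOZ: "?O * (P * (?O * Z)) = four_block_mat (0\<^sub>m ?n ?n) F (0\<^sub>m ?m ?n) G"
  proof -
    have c: "B * Omega M \<in> carrier_mat ?n ?m" "E * Omega M \<in> carrier_mat ?m ?m"
      by (rule mult_carrier_mat[OF B Omega_carrier], rule mult_carrier_mat[OF E Omega_carrier])
    have FG: "Omega N * (B * Omega M) = F" "Omega M * (E * Omega M) = G"
      unfolding F_def G_def using assoc_mult_mat[OF Omega_carrier B Omega_carrier]
        assoc_mult_mat[OF Omega_carrier E Omega_carrier] by auto
    show ?thesis
      unfolding POZ unfolding Omega_add
      by (subst mult_four_block_mat[OF Omega_carrier zero_carrier_mat zero_carrier_mat Omega_carrier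
            zero_carrier_mat c(1) zero_carrier_mat c(2)])
        (use c cF cG in \<open>simp add: FG right_mult_zero_mat[OF Omega_carrier] left_mult_zero_mat\<close>)
  qed
  \<comment> \<open>Y is the inverse of P times P + Z. Because Z lives on the ancillas, Y is block
    upper triangular and its determinant is that of the lower corner.\<close>
  define Y where "Y = four_block_mat (1\<^sub>m ?n) (- F) (0\<^sub>m ?m ?n) (1\<^sub>m ?m - G)"
  have cY: "Y \<in> carrier_mat ?k ?k"
    unfolding Y_def by (rule four_block_carrier_mat[OF one_carrier_mat minus_carrier_mat[OF cG]])
  have Y: "Y = 1\<^sub>m ?k - ?O * (P * (?O * Z))"
    unfolding OPOZ Y_def using cF cG by (intro eq_matI) auto
  have "P * Y = P * 1\<^sub>m ?k - P * (?O * (P * (?O * Z)))"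
    unfolding Y using cP cO cZ by (intro mult_minus_distrib_mat) (auto intro!: mult_carrier_mat)
  also have "P * (?O * (P * (?O * Z))) = P * ?O * P * ?O * Z"
    using cP cO cZ by (simp add: assoc_mult_mat[of _ ?k ?k _ ?k _ ?k] mult_carrier_mat[of _ ?k ?k _ ?k])
  also have "\<dots> = - Z"
    unfolding sP Omega_square using cZ by simp
  also have "P * 1\<^sub>m ?k - - Z = four_block_mat A B C (E + 1\<^sub>m ?m)"
    using cP unfolding P Z_def using A B C E by (intro eq_matI) auto
  finally have "det (four_block_mat A B C (E + 1\<^sub>m ?m)) = det P * det Y"
    using det_mult[OF cP cY] by simp
  also have "\<dots> = det (1\<^sub>m ?m - G)"
    unfolding dP Y_def
      det_four_block_mat_lower_left_zero[OF one_carrier_mat uminus_carrier_mat[OF cF] refl minus_carrier_mat[OF cG]]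
    by simp
  also have "1\<^sub>m ?m - G = - (Omega M * (E + 1\<^sub>m ?m) * Omega M)"
  proof -
    have "Omega M * (E + 1\<^sub>m ?m) * Omega M = G + Omega M * Omega M"
      using E mult_carrier_mat[OF Omega_carrier E] unfolding G_def
      by (simp add: mult_add_distrib_mat[OF Omega_carrier E one_carrier_mat]
          add_mult_distrib_mat[OF _ Omega_carrier Omega_carrier] right_mult_one_mat[OF Omega_carrier])
    then show ?thesis unfolding Omega_square using cG by (intro eq_matI) auto
  qed
  \<comment> \<open>The dimension 2 M is even, so the sign disappears.\<close>
  also have "det (- (Omega M * (E + 1\<^sub>m ?m) * Omega M)) = det (Omega M * (E + 1\<^sub>m ?m) * Omega M)"
    unfolding uminus_smult_mat by simp
  also have "\<dots> = det (E + 1\<^sub>m ?m) * (det (Omega M) * det (Omega M))"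
    using E by (simp add: det_mult[OF mult_carrier_mat[OF Omega_carrier] Omega_carrier] det_mult[OF Omega_carrier])
  also have "det (Omega M) * det (Omega M) = 1"
    unfolding det_mult[OF Omega_carrier Omega_carrier, symmetric] Omega_square uminus_smult_mat by simp
  finally show ?thesis by simp
qed

text \<open>The conditional covariance matrix is the Schur complement A - B (E + 1)^(-1) B^T: its
  form at f is the minimum over k of the P-form at (f, k) plus the squared norm of k. Dropping that
  norm gives the first estimate, and comparison with k = 0 the second. Purity of P enters as P Omega
  P = Omega, the shape that the determinant computation can use.\<close>

lemma heterodyne_conditional_state:
  assumes gP: "gaussian_state (N + M) P" and sP: "P * Omega (N + M) * P = Omega (N + M)"
    and dP: "det P = 1"
  obtains p where "pure_state N p"
    "\<And>f. f \<in> carrier_vec (2 * N) \<Longrightarrow>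
      \<exists>k \<in> carrier_vec (2 * M). (f @\<^sub>v k) \<bullet> (P *\<^sub>v (f @\<^sub>v k)) \<le> f \<bullet> (p *\<^sub>v f)"
    "\<And>f. f \<in> carrier_vec (2 * N) \<Longrightarrow>
      f \<bullet> (p *\<^sub>v f) \<le> (f @\<^sub>v 0\<^sub>v (2 * M)) \<bullet> (P *\<^sub>v (f @\<^sub>v 0\<^sub>v (2 * M)))"
proof -
  let ?n = "2 * N" and ?m = "2 * M"
  have nm: "2 * (N + M) = ?n + ?m" by simp
  have P: "P \<in> carrier_mat (?n + ?m) (?n + ?m)" "P\<^sup>T = P" using gP by (auto simp: gaussian_state_def)
  define A where "A = mat ?n ?n (\<lambda>ij. P $$ ij)"
  define B where "B = mat ?n ?m (\<lambda>(i, j). P $$ (i, ?n + j))"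
  define E where "E = mat ?m ?m (\<lambda>(i, j). P $$ (?n + i, ?n + j))"
  have cA: "A \<in> carrier_mat ?n ?n" and cB: "B \<in> carrier_mat ?n ?m" and cE: "E \<in> carrier_mat ?m ?m"
    and cBT: "B\<^sup>T \<in> carrier_mat ?m ?n"
    by (auto simp: A_def B_def E_def)
  have "mat ?m ?n (\<lambda>(i, j). P $$ (?n + i, j)) = B\<^sup>T"
    by (rule eq_matI) (auto simp: B_def sym_index[OF P])
  then have P_eq: "P = four_block_mat A B (B\<^sup>T) E"
    using four_block_mat_split[OF P(1)] by (simp add: A_def B_def E_def)
  have AT: "A\<^sup>T = A" by (rule eq_matI) (auto simp: A_def sym_index[OF P])
  have ET: "E\<^sup>T = E" by (rule eq_matI) (auto simp: E_def sym_index[OF P])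
  define R where "R = E + 1\<^sub>m ?m"
  have R: "R \<in> carrier_mat ?m ?m" using cE by (simp add: R_def)
  have RT: "R\<^sup>T = R" unfolding R_def using cE ET by (simp add: transpose_add[of _ ?m ?m])
  have E_nonneg: "0 \<le> k \<bullet> (E *\<^sub>v k)" if k: "k \<in> carrier_vec ?m" for k
  proof -
    have c: "B *\<^sub>v k \<in> carrier_vec ?n" "E *\<^sub>v k \<in> carrier_vec ?m"
      by (rule mult_mat_vec_carrier[OF cB k], rule mult_mat_vec_carrier[OF cE k])
    have z: "A *\<^sub>v 0\<^sub>v ?n = 0\<^sub>v ?n" "B\<^sup>T *\<^sub>v 0\<^sub>v ?n = 0\<^sub>v ?m" using cA cB by (auto intro!: eq_vecI)
    have "P *\<^sub>v (0\<^sub>v ?n @\<^sub>v k) = (B *\<^sub>v k) @\<^sub>v (E *\<^sub>v k)"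
      unfolding P_eq four_block_mat_mult_vec[OF cA cB cBT cE zero_carrier_vec k] z using c by simp
    then have "(0\<^sub>v ?n @\<^sub>v k) \<bullet> (P *\<^sub>v (0\<^sub>v ?n @\<^sub>v k)) = k \<bullet> (E *\<^sub>v k)"
      using scalar_prod_append[OF zero_carrier_vec k c] c by simp
    moreover have "0\<^sub>v ?n @\<^sub>v k \<in> carrier_vec (2 * (N + M))"
      unfolding nm using k by (intro append_carrier_vec) auto
    ultimately show ?thesis using gaussian_nonneg[OF gP] by metis
  qed
  have R_form: "k \<bullet> (R *\<^sub>v k) = k \<bullet> (E *\<^sub>v k) + k \<bullet> k" if k: "k \<in> carrier_vec ?m" for k
    unfolding R_def using cE k
    by (simp add: add_mult_distrib_mat_vec[of _ ?m ?m] scalar_prod_add_distrib[of _ ?m] mult_mat_vec_carrier[OF cE k])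
  have detR: "det R \<noteq> 0"
  proof
    assume "det R = 0"
    then obtain k where k: "k \<in> carrier_vec ?m" "k \<noteq> 0\<^sub>v ?m" "R *\<^sub>v k = 0\<^sub>v ?m"
      using det_0_iff_vec_prod_zero_field[OF R] by auto
    then have "k \<bullet> (E *\<^sub>v k) + k \<bullet> k = 0" using R_form[OF k(1)] by simp
    then have "k \<bullet> k \<le> 0" using E_nonneg[OF k(1)] by simp
    moreover have "0 < k \<bullet> k"
      using conjugate_square_greater_0_vec[OF k(1)] k by (simp add: conjugate_vec_def)
    ultimately show False by simp
  qed
  from det_non_zero_imp_unit[OF R detR, of "()"]
  obtain Ri where Ri: "Ri \<in> carrier_mat ?m ?m" "R * Ri = 1\<^sub>m ?m"
    by (auto simp: Units_def ring_mat_def)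
  \<comment> \<open>\<open>T *\<^sub>v f\<close> is the ancilla vector that attains the minimum for
    f.\<close>
  define T where "T = - (Ri * B\<^sup>T)"
  have cT: "T \<in> carrier_mat ?m ?n" using Ri cBT by (simp add: T_def)
  have RTB: "R * T = - B\<^sup>T"
  proof -
    have "R * (Ri * B\<^sup>T) = (R * Ri) * B\<^sup>T" using R Ri(1) cBT by (simp add: assoc_mult_mat[of _ ?m ?m _ ?m _ ?n])
    then show ?thesis unfolding T_def using R Ri cBT by simp
  qed
  define p where "p = A + B * T"
  have cp: "p \<in> carrier_mat ?n ?n" using cA cB cT by (simp add: p_def)
  have BTT: "B = - (T\<^sup>T * R)"
  proof -
    have "T\<^sup>T * R = (R * T)\<^sup>T" using R cT RT by (simp add: transpose_mult[of _ ?m ?m _ ?n])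
    also have "\<dots> = - B" unfolding RTB by (rule eq_matI) (use cB in auto)
    finally have "T\<^sup>T * R = - B" .
    then show ?thesis using cB by simp
  qed
  have "(B * T)\<^sup>T = T\<^sup>T * B\<^sup>T" using cB cT by (simp add: transpose_mult[of _ ?n ?m _ ?n])
  also have "B\<^sup>T = - (R * T)" using RTB cBT by simp
  also have "T\<^sup>T * - (R * T) = - (T\<^sup>T * R) * T"
    using R cT by (simp add: assoc_mult_mat[of _ ?n ?m _ ?m _ ?n] uminus_mult_left_mat mult_carrier_mat[of _ ?n ?m _ ?m])
  also have "\<dots> = B * T" using BTT by simp
  finally have "(B * T)\<^sup>T = B * T" .
  then have pT: "p\<^sup>T = p"
    unfolding p_def using cA cB cT AT by (simp add: transpose_add[of _ ?n ?n] mult_carrier_mat[of _ ?n ?m _ ?n])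
  define Q where "Q = four_block_mat A B (B\<^sup>T) R"
  have cQ: "Q \<in> carrier_mat (?n + ?m) (?n + ?m)" using cA R by (simp add: Q_def)
  \<comment> \<open>Block elimination with determinant 1: it exposes the Schur complement in the
    corner of Q, which is P with the vacuum added on the ancillas.\<close>
  define L where "L = four_block_mat (1\<^sub>m ?n) (0\<^sub>m ?n ?m) T (1\<^sub>m ?m)"
  have QL: "Q * L = four_block_mat p B (0\<^sub>m ?m ?n) R"
  proof -
    have "B\<^sup>T * 1\<^sub>m ?n + R * T = 0\<^sub>m ?m ?n" unfolding RTB using cB by (auto intro!: eq_matI)
    then show ?thesis
      unfolding Q_def L_def
      using cA cB cBT R cT
      by (subst mult_four_block_mat[of _ ?n ?n _ ?m _ ?m _ _ ?n _ ?m]) (auto simp: p_def)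
  qed
  have "det Q = det Q * det L"
    unfolding L_def using cT by (simp add: det_four_block_mat_upper_right_zero[of _ ?n _ ?m])
  also have "\<dots> = det (Q * L)"
    using cQ cT by (intro det_mult[symmetric]) (auto simp: L_def)
  also have "\<dots> = det p * det R"
    unfolding QL using cp cB R by (simp add: det_four_block_mat_lower_left_zero[of _ ?n _ ?m])
  finally have detQ: "det Q = det p * det R" .
  have "det Q = det R"
    using det_add_one_lower_block[OF cA cB cBT cE P_eq sP dP] by (simp add: Q_def R_def)
  then have detp: "det p = 1" using detQ detR by simp
  have form: "f \<bullet> (p *\<^sub>v f) = (f @\<^sub>v (T *\<^sub>v f)) \<bullet> (P *\<^sub>v (f @\<^sub>v (T *\<^sub>v f))) + (T *\<^sub>v f) \<bullet> (T *\<^sub>v f)"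
    "f \<bullet> (p *\<^sub>v f) = f \<bullet> (A *\<^sub>v f) - (T *\<^sub>v f) \<bullet> (R *\<^sub>v (T *\<^sub>v f))"
    if f: "f \<in> carrier_vec ?n" for f
  proof -
    define k where "k = T *\<^sub>v f"
    have k: "k \<in> carrier_vec ?m" using mult_mat_vec_carrier[OF cT f] by (simp add: k_def)
    have c: "A *\<^sub>v f \<in> carrier_vec ?n" "B *\<^sub>v k \<in> carrier_vec ?n" "B\<^sup>T *\<^sub>v f \<in> carrier_vec ?m"
      "E *\<^sub>v k \<in> carrier_vec ?m" "R *\<^sub>v k \<in> carrier_vec ?m"
      by (rule mult_mat_vec_carrier cA cB cBT cE R f k)+
    have "R *\<^sub>v k = R * T *\<^sub>v f" unfolding k_def using R cT f by simp
    then have Rk: "R *\<^sub>v k = - (B\<^sup>T *\<^sub>v f)" unfolding RTB using cBT f by (simp add: uminus_mult_mat_vec)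
    have fB: "f \<bullet> (B *\<^sub>v k) = k \<bullet> (B\<^sup>T *\<^sub>v f)"
      using scalar_prod_transpose[OF cB f k] comm_scalar_prod[OF c(3) k] by simp
    have kR: "k \<bullet> (R *\<^sub>v k) = - (k \<bullet> (B\<^sup>T *\<^sub>v f))" unfolding Rk using k c(3) cB by simp
    have "p *\<^sub>v f = A *\<^sub>v f + B *\<^sub>v k"
      unfolding p_def k_def using cA cB cT f
      by (simp add: add_mult_distrib_mat_vec[of _ ?n ?n] mult_carrier_mat[of _ ?n ?m _ ?n])
    then have pf: "f \<bullet> (p *\<^sub>v f) = f \<bullet> (A *\<^sub>v f) + f \<bullet> (B *\<^sub>v k)"
      using f c by (simp add: scalar_prod_add_distrib[of _ ?n])
    then show "f \<bullet> (p *\<^sub>v f) = f \<bullet> (A *\<^sub>v f) - (T *\<^sub>v f) \<bullet> (R *\<^sub>v (T *\<^sub>v f))"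
      unfolding k_def[symmetric] kR fB by simp
    have "(f @\<^sub>v k) \<bullet> (P *\<^sub>v (f @\<^sub>v k)) = f \<bullet> (A *\<^sub>v f + B *\<^sub>v k) + k \<bullet> (B\<^sup>T *\<^sub>v f + E *\<^sub>v k)"
      unfolding P_eq four_block_mat_mult_vec[OF cA cB cBT cE f k]
      using f k c by (intro scalar_prod_append) auto
    also have "\<dots> = f \<bullet> (A *\<^sub>v f) + f \<bullet> (B *\<^sub>v k) + (k \<bullet> (B\<^sup>T *\<^sub>v f) + k \<bullet> (E *\<^sub>v k))"
      using f k c by (simp add: scalar_prod_add_distrib[of _ ?n] scalar_prod_add_distrib[of _ ?m])
    finally show "f \<bullet> (p *\<^sub>v f) = (f @\<^sub>v (T *\<^sub>v f)) \<bullet> (P *\<^sub>v (f @\<^sub>v (T *\<^sub>v f))) + (T *\<^sub>v f) \<bullet> (T *\<^sub>v f)"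
      using R_form[OF k] kR pf unfolding k_def[symmetric] by simp
  qed
  have "gaussian_state N p"
    unfolding gaussian_state_iff
  proof (intro conjI ballI cp pT)
    fix f g :: "real vec" assume f: "f \<in> carrier_vec ?n" and g: "g \<in> carrier_vec ?n"
    define k l where "k = T *\<^sub>v f" and "l = T *\<^sub>v g"
    have kl: "k \<in> carrier_vec ?m" "l \<in> carrier_vec ?m"
      unfolding k_def l_def by (rule mult_mat_vec_carrier[OF cT f], rule mult_mat_vec_carrier[OF cT g])
    have "f @\<^sub>v k \<in> carrier_vec (2 * (N + M))" "g @\<^sub>v l \<in> carrier_vec (2 * (N + M))"
      unfolding nm using f g kl by auto
    then have "2 * ((f @\<^sub>v k) \<bullet> (Omega (N + M) *\<^sub>v (g @\<^sub>v l))) \<le>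
        (f @\<^sub>v k) \<bullet> (P *\<^sub>v (f @\<^sub>v k)) + (g @\<^sub>v l) \<bullet> (P *\<^sub>v (g @\<^sub>v l))"
      using gP unfolding gaussian_state_iff by blast
    moreover have "(f @\<^sub>v k) \<bullet> (Omega (N + M) *\<^sub>v (g @\<^sub>v l)) = f \<bullet> (Omega N *\<^sub>v g) + k \<bullet> (Omega M *\<^sub>v l)"
      unfolding Omega_add by (rule block_diag_quadratic_form[OF Omega_carrier Omega_carrier f kl(1) g kl(2)])
    \<comment> \<open>The vacuum relation is taken with k and l exchanged, so by antisymmetry it
      cancels the ancilla term of the symplectic form exactly.\<close>
    moreover have "2 * (l \<bullet> (Omega M *\<^sub>v k)) \<le> l \<bullet> l + k \<bullet> k"
      using gaussian_state_one[of M] kl unfolding gaussian_state_iff by (metis one_mult_mat_vec)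
    moreover have "k \<bullet> (Omega M *\<^sub>v l) = - (l \<bullet> (Omega M *\<^sub>v k))"
      by (rule scalar_prod_antisym_mat[OF Omega_carrier Omega_transpose kl])
    ultimately show "2 * (f \<bullet> (Omega N *\<^sub>v g)) \<le> f \<bullet> (p *\<^sub>v f) + g \<bullet> (p *\<^sub>v g)"
      unfolding form(1)[OF f] form(1)[OF g] k_def[symmetric] l_def[symmetric] by simp
  qed
  then have "pure_state N p" using detp by (simp add: pure_state_def)
  moreover have "\<exists>k \<in> carrier_vec ?m. (f @\<^sub>v k) \<bullet> (P *\<^sub>v (f @\<^sub>v k)) \<le> f \<bullet> (p *\<^sub>v f)"
    if f: "f \<in> carrier_vec ?n" for f
    using form(1)[OF f] scalar_prod_self_nonneg[of "T *\<^sub>v f"] mult_mat_vec_carrier[OF cT f]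
    by (intro bexI[of _ "T *\<^sub>v f"]) auto
  moreover have "f \<bullet> (p *\<^sub>v f) \<le> (f @\<^sub>v 0\<^sub>v ?m) \<bullet> (P *\<^sub>v (f @\<^sub>v 0\<^sub>v ?m))"
    if f: "f \<in> carrier_vec ?n" for f
  proof -
    have c: "T *\<^sub>v f \<in> carrier_vec ?m" by (rule mult_mat_vec_carrier[OF cT f])
    have "0 \<le> (T *\<^sub>v f) \<bullet> (R *\<^sub>v (T *\<^sub>v f))"
      using R_form[OF c] E_nonneg[OF c] scalar_prod_self_nonneg[of "T *\<^sub>v f"] by simp
    then show ?thesis
      using form(2)[OF f] quadratic_form_upper_left_block[OF P(1) f] by (simp add: A_def)
  qed
  ultimately show ?thesis using that by blast
qed

section \<open>The state \<open>\<sigma>_sp\<close>\<close>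

lemma pi_d_carrier [simp]: "pi_d r1 r2 \<in> carrier_mat 4 4"
  by (simp add: pi_d_def)

lemma pi_d_eq: "pi_d r1 r2 = mat 4 4 (\<lambda>(i, j).
  [[exp (-2 * r1), 0, 0, 0], [0, exp (2 * r1), 0, 0], [0, 0, exp (2 * r2), 0], [0, 0, 0, exp (-2 * r2)]] ! i ! j)"
  by (rule eq_matI) (auto simp: pi_d_def mat_diag_def less_Suc_eq numeral_eq_Suc)

lemma pi_d_quadratic_form:
  "vec_of_list [a0, a1, a2, a3] \<bullet> (pi_d r1 r2 *\<^sub>v vec_of_list [a0, a1, a2, a3]) =
    exp (-2 * r1) * a0\<^sup>2 + exp (2 * r1) * a1\<^sup>2 + exp (2 * r2) * a2\<^sup>2 + exp (-2 * r2) * a3\<^sup>2"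
  unfolding quadratic_form_4[OF pi_d_carrier] by (simp add: pi_d_eq power2_eq_square)

lemma vec_4_cases:
  assumes "x \<in> carrier_vec 4"
  obtains a0 a1 a2 a3 where "x = vec_of_list [a0, a1, a2, a3]"
proof
  show "x = vec_of_list [x $ 0, x $ 1, x $ 2, x $ 3]"
    using assms by (intro eq_vecI) (auto simp: less_Suc_eq numeral_eq_Suc)
qed

lemma pi_d_pure: "pure_state 2 (pi_d r1 r2)"
  and pi_d_symplectic: "pi_d r1 r2 * Omega 2 * pi_d r1 r2 = Omega 2"
proof -
  have e: "exp (-2 * r) * exp (2 * r) = 1" "exp (2 * r) * exp (-2 * r) = 1" for r :: real
    by (simp_all flip: exp_add)
  have "gaussian_state 2 (pi_d r1 r2)"
    unfolding gaussian_state_iff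
  proof (intro conjI ballI)
    show "(pi_d r1 r2)\<^sup>T = pi_d r1 r2"
      by (rule eq_matI) (auto simp: pi_d_def mat_diag_def)
    fix x y :: "real vec" assume "x \<in> carrier_vec (2 * 2)" "y \<in> carrier_vec (2 * 2)"
    then have "x \<in> carrier_vec 4" "y \<in> carrier_vec 4" by simp_all
    then obtain a0 a1 a2 a3 b0 b1 b2 b3
      where x: "x = vec_of_list [a0, a1, a2, a3]" and y: "y = vec_of_list [b0, b1, b2, b3]"
      by (meson vec_4_cases)
    \<comment> \<open>A rescaled arithmetic-geometric mean inequality, applied once to each of the
      four terms of the symplectic form.\<close>
    have sq: "2 * (a * b) \<le> exp (-2 * r) * a\<^sup>2 + exp (2 * r) * b\<^sup>2" for a b r :: real
    proof -
      have "0 \<le> (exp (- r) * a - exp r * b)\<^sup>2" by simp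
      also have "\<dots> = (exp (- r))\<^sup>2 * a\<^sup>2 - 2 * (exp (- r) * exp r) * (a * b) + (exp r)\<^sup>2 * b\<^sup>2"
        by (simp add: power2_eq_square algebra_simps)
      also have "\<dots> = exp (-2 * r) * a\<^sup>2 - 2 * (a * b) + exp (2 * r) * b\<^sup>2"
        by (simp add: exp_double[symmetric] flip: exp_add)
      finally show ?thesis by simp
    qed
    have "x \<bullet> (Omega 2 *\<^sub>v y) = a0 * b1 - a1 * b0 + a2 * b3 - a3 * b2"
      unfolding x y quadratic_form_4[OF Omega_2_carrier] by (simp add: Omega_2)
    then show "2 * (x \<bullet> (Omega 2 *\<^sub>v y)) \<le> x \<bullet> (pi_d r1 r2 *\<^sub>v x) + y \<bullet> (pi_d r1 r2 *\<^sub>v y)"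
      unfolding x y pi_d_quadratic_form
      using sq[of a0 b1 r1] sq[of "- b0" a1 r1] sq[of "b3" a2 r2] sq[of "- a3" b2 r2] by (simp add: algebra_simps)
  qed simp
  moreover have "det (pi_d r1 r2) = 1"
    unfolding det_4[OF pi_d_carrier] by (simp add: pi_d_eq e[simplified] mult.assoc[symmetric])
  ultimately show "pure_state 2 (pi_d r1 r2)" by (simp add: pure_state_def)
  have PO: "pi_d r1 r2 * Omega 2 = mat 4 4 (\<lambda>(i, j).
      [[0, exp (-2 * r1), 0, 0], [- exp (2 * r1), 0, 0, 0],
       [0, 0, 0, exp (2 * r2)], [0, 0, - exp (-2 * r2), 0]] ! i ! j)"
    unfolding pi_d_eq Omega_2
    by (rule eq_matI) (auto simp: scalar_prod_def less_Suc_eq numeral_eq_Suc)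
  show "pi_d r1 r2 * Omega 2 * pi_d r1 r2 = Omega 2"
    unfolding PO unfolding pi_d_eq Omega_2
    by (rule eq_matI) (auto simp: scalar_prod_def less_Suc_eq numeral_eq_Suc simp flip: exp_add)
qed

lemma K_bs_eq: "K_bs = mat 4 4 (\<lambda>(i, j).
  [[1, 0, 1, 0], [0, 1, 0, 1], [-1, 0, 1, 0], [0, -1, 0, 1]] ! i ! j / sqrt 2)"
  unfolding K_bs_def
  by (rule eq_matI) (auto simp: less_Suc_eq numeral_eq_Suc)

lemma K_bs_carrier [simp]: "K_bs \<in> carrier_mat 4 4"
  by (simp add: K_bs_eq)

lemma K_bs_passive: "passive_transf 2 K_bs"
proof -
  have KT: "K_bs\<^sup>T = mat 4 4 (\<lambda>(i, j).
      [[1, 0, -1, 0], [0, 1, 0, -1], [1, 0, 1, 0], [0, 1, 0, 1]] ! i ! j / sqrt 2)"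
    unfolding K_bs_eq by (rule eq_matI) (auto simp: less_Suc_eq numeral_eq_Suc)
  have KO: "K_bs * Omega 2 = mat 4 4 (\<lambda>(i, j).
      [[0, 1, 0, 1], [-1, 0, -1, 0], [0, -1, 0, 1], [1, 0, -1, 0]] ! i ! j / sqrt 2)"
    unfolding K_bs_eq Omega_2
    by (rule eq_matI) (auto simp: scalar_prod_def less_Suc_eq numeral_eq_Suc)
  have 1: "K_bs * K_bs\<^sup>T = 1\<^sub>m 4"
    unfolding KT unfolding K_bs_eq
    by (rule eq_matI) (auto simp: scalar_prod_def less_Suc_eq numeral_eq_Suc)
  have 2: "K_bs * Omega 2 * K_bs\<^sup>T = Omega 2"
    unfolding KO unfolding KT Omega_2
    by (rule eq_matI) (auto simp: scalar_prod_def less_Suc_eq numeral_eq_Suc)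
  show ?thesis using 1 2 by (simp add: passive_transf_def)
qed

lemma K_bs_transpose_mult_vec:
  "K_bs\<^sup>T *\<^sub>v vec_of_list [a0, a1, a2, a3] =
    vec_of_list [(a0 - a2) / sqrt 2, (a1 - a3) / sqrt 2, (a0 + a2) / sqrt 2, (a1 + a3) / sqrt 2]"
  unfolding K_bs_eq
  by (rule eq_vecI) (auto simp: scalar_prod_def less_Suc_eq numeral_eq_Suc add_divide_distrib diff_divide_distrib)

lemma outer_quadratic_form:
  assumes "v \<in> carrier_vec n" "x \<in> carrier_vec n"
  shows "x \<bullet> (outer v *\<^sub>v x) = (v \<bullet> x)\<^sup>2"
proof -
  have "outer v \<in> carrier_mat n n" using assms by (simp add: outer_def)
  then have "x \<bullet> (outer v *\<^sub>v x) = (\<Sum>i<n. \<Sum>j<n. outer v $$ (i, j) * (x $ i * x $ j))"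
    using assms by (simp add: scalar_prod_mult_mat_vec)
  also have "\<dots> = (\<Sum>i<n. \<Sum>j<n. (v $ i * x $ i) * (v $ j * x $ j))"
    using assms by (intro sum.cong) (auto simp: outer_def)
  also have "\<dots> = (v \<bullet> x)\<^sup>2"
    using assms by (simp add: scalar_prod_def atLeast0LessThan power2_eq_square sum_product)
  finally show ?thesis .
qed

lemma outer_v12_carrier:
  "v1 \<alpha> \<theta> \<in> carrier_vec 4" "v2 \<alpha> \<theta> \<in> carrier_vec 4"
  "outer (v1 \<alpha> \<theta>) \<in> carrier_mat 4 4" "outer (v2 \<alpha> \<theta>) \<in> carrier_mat 4 4"
proof -
  show v: "v1 \<alpha> \<theta> \<in> carrier_vec 4" "v2 \<alpha> \<theta> \<in> carrier_vec 4"
    unfolding v1_def v2_def by (rule carrier_vecI; simp)+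
  then show "outer (v1 \<alpha> \<theta>) \<in> carrier_mat 4 4" "outer (v2 \<alpha> \<theta>) \<in> carrier_mat 4 4"
    by (simp_all add: outer_def)
qed

lemma sigma_sp_carrier: "sigma_sp r1 r2 l1 l2 \<alpha> \<theta> \<in> carrier_mat 4 4"
  unfolding sigma_sp_def
  by (intro mult_carrier_mat[of _ 4 4] add_carrier_mat) (auto simp: outer_v12_carrier)

lemma sigma_sp_sym: "(sigma_sp r1 r2 l1 l2 \<alpha> \<theta>)\<^sup>T = sigma_sp r1 r2 l1 l2 \<alpha> \<theta>"
proof -
  let ?M = "pi_d r1 r2 + l1 \<cdot>\<^sub>m outer (v1 \<alpha> \<theta>) + l2 \<cdot>\<^sub>m outer (v2 \<alpha> \<theta>)"
  have M: "?M \<in> carrier_mat 4 4" using outer_v12_carrier by simp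
  have MT: "?M\<^sup>T = ?M"
    using outer_v12_carrier(1,2)[of \<alpha> \<theta>] by (intro eq_matI) (auto simp: outer_def pi_d_def mat_diag_def)
  show ?thesis
    unfolding sigma_sp_def using M MT K_bs_carrier
    by (simp add: transpose_mult[of _ 4 4 _ 4] assoc_mult_mat[of _ 4 4 _ 4 _ 4] del: transpose_add)
qed

lemma sigma_sp_quadratic_form:
  assumes x: "x \<in> carrier_vec 4"
  defines "y \<equiv> K_bs\<^sup>T *\<^sub>v x"
  shows "x \<bullet> (sigma_sp r1 r2 l1 l2 \<alpha> \<theta> *\<^sub>v x) =
    y \<bullet> (pi_d r1 r2 *\<^sub>v y) + l1 * (v1 \<alpha> \<theta> \<bullet> y)\<^sup>2 + l2 * (v2 \<alpha> \<theta> \<bullet> y)\<^sup>2"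
proof -
  have y: "y \<in> carrier_vec 4" unfolding y_def by (rule mult_mat_vec_carrier) (use x in auto)
  have o: "outer (v1 \<alpha> \<theta>) \<in> carrier_mat 4 4" "outer (v2 \<alpha> \<theta>) \<in> carrier_mat 4 4"
    by (rule outer_v12_carrier)+
  have "x \<bullet> (sigma_sp r1 r2 l1 l2 \<alpha> \<theta> *\<^sub>v x) =
      y \<bullet> ((pi_d r1 r2 + l1 \<cdot>\<^sub>m outer (v1 \<alpha> \<theta>) + l2 \<cdot>\<^sub>m outer (v2 \<alpha> \<theta>)) *\<^sub>v y)"
    unfolding sigma_sp_def y_def using o x by (intro congruence_quadratic_form[of _ 4 4]) auto
  also have "\<dots> = (\<Sum>i<4. \<Sum>j<4. pi_d r1 r2 $$ (i, j) * (y $ i * y $ j)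
      + l1 * (outer (v1 \<alpha> \<theta>) $$ (i, j) * (y $ i * y $ j)) + l2 * (outer (v2 \<alpha> \<theta>) $$ (i, j) * (y $ i * y $ j)))"
    using o y by (subst scalar_prod_mult_mat_vec[of _ 4 4]) (auto intro!: sum.cong simp: algebra_simps)
  also have "\<dots> = y \<bullet> (pi_d r1 r2 *\<^sub>v y) + l1 * (y \<bullet> (outer (v1 \<alpha> \<theta>) *\<^sub>v y)) + l2 * (y \<bullet> (outer (v2 \<alpha> \<theta>) *\<^sub>v y))"
    using o y by (simp add: scalar_prod_mult_mat_vec[of _ 4 4] sum.distrib flip: sum_distrib_left)
  finally show ?thesis
    unfolding outer_quadratic_form[OF outer_v12_carrier(1) y] outer_quadratic_form[OF outer_v12_carrier(2) y] .
qed

text \<open>The pure state below \<sigma>_sp at which both the squeezing and the entanglement attain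
  their minimum.\<close>

definition pi_bs :: "real \<Rightarrow> real \<Rightarrow> real mat" where
  "pi_bs r1 r2 = K_bs * pi_d r1 r2 * K_bs\<^sup>T"

lemma pi_bs_carrier [simp]: "pi_bs r1 r2 \<in> carrier_mat 4 4"
  unfolding pi_bs_def by (intro mult_carrier_mat[of _ 4 4]) auto

lemma pi_bs_pure: "pure_state 2 (pi_bs r1 r2)"
  and pi_bs_symplectic: "pi_bs r1 r2 * Omega 2 * pi_bs r1 r2 = Omega 2"
proof -
  have c: "pi_d r1 r2 \<in> carrier_mat (2 * 2) (2 * 2)" by simp
  show "pure_state 2 (pi_bs r1 r2)"
    using passive_congruence(1)[OF K_bs_passive pure_stateD(1)[OF pi_d_pure]]
      passive_congruence(3)[OF K_bs_passive c] pure_stateD(4)[OF pi_d_pure]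
    by (simp add: pure_state_def pi_bs_def)
  show "pi_bs r1 r2 * Omega 2 * pi_bs r1 r2 = Omega 2"
    unfolding pi_bs_def by (rule passive_congruence(2)[OF K_bs_passive c pi_d_symplectic])
qed

text \<open>Nonnegativity of r1 and r2 makes exp(-2 r1) and exp(-2 r2) the two smallest eigenvalues;
  their order is irrelevant for the sum of logarithms.\<close>

lemma sof_pure_pi_bs:
  assumes "0 \<le> r1" "0 \<le> r2"
  shows "sof_pure 2 (pi_bs r1 r2) = r1 + r2"
proof -
  let ?l = "[exp (-2 * r1), exp (2 * r1), exp (2 * r2), exp (-2 * r2)]"
  let ?es = "if r1 \<le> r2 then [exp (-2 * r2), exp (-2 * r1), exp (2 * r1), exp (2 * r2)]
    else [exp (-2 * r1), exp (-2 * r2), exp (2 * r2), exp (2 * r1)]"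
  have K: "K_bs \<in> carrier_mat 4 4" "K_bs * K_bs\<^sup>T = 1\<^sub>m 4"
    using passive_transf_transpose(1,2)[OF K_bs_passive] by simp_all
  have "eigs_up (pi_bs r1 r2) = sort (map (\<lambda>i. ?l ! i) [0..<4])"
    unfolding pi_bs_def pi_d_def by (rule eigs_up_orthogonal_diag(1)[OF K])
  also have "map (\<lambda>i. ?l ! i) [0..<4] = ?l"
    by (simp add: upt_conv_Cons)
  also have "sort ?l = ?es"
    using assms by (intro properties_for_sort) (auto simp: add_mset_commute)
  finally show ?thesis by (simp add: sof_pure_def numeral_2_eq_2 field_simps)
qed

lemma psd_minus_iff:
  fixes A B :: "real mat"
  assumes "A \<in> carrier_mat n n" "A\<^sup>T = A" "B \<in> carrier_mat n n" "B\<^sup>T = B"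
  shows "psd n (A - B) \<longleftrightarrow> (\<forall>x \<in> carrier_vec n. x \<bullet> (B *\<^sub>v x) \<le> x \<bullet> (A *\<^sub>v x))"
proof -
  have "(A - B)\<^sup>T = A - B"
    using assms by (auto simp: sym_index[OF assms(1,2)] sym_index[OF assms(3,4)] intro!: eq_matI)
  moreover have "x \<bullet> ((A - B) *\<^sub>v x) = x \<bullet> (A *\<^sub>v x) - x \<bullet> (B *\<^sub>v x)" if "x \<in> carrier_vec n" for x
  proof -
    have "A *\<^sub>v x \<in> carrier_vec n" "B *\<^sub>v x \<in> carrier_vec n"
      by (rule mult_mat_vec_carrier[OF assms(1) that], rule mult_mat_vec_carrier[OF assms(3) that])
    then show ?thesis
      using assms that by (simp add: minus_mult_distrib_mat_vec[of _ n n] scalar_prod_minus_distrib[of _ n])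
  qed
  ultimately show ?thesis
    using assms by (subst psd_real_iff) auto
qed

lemma diag_block_mat_pair:
  assumes "A \<in> carrier_mat n n" "B \<in> carrier_mat m m"
  shows "diag_block_mat [A, B] = four_block_mat A (0\<^sub>m n m) (0\<^sub>m m n) B"
  using assms unfolding diag_block_mat.simps(2)[of A] diag_block_mat_singleton Let_def by simp

section \<open>Entanglement after a passive transformation with vacuum ancillas\<close>

lemma eof_le_eof_pure:
  assumes "pure_state 2 p" "psd 4 (\<sigma> - p)"
  shows "eof \<sigma> \<le> eof_pure p"
  unfolding eof_def
proof (rule cInf_lower)
  show "bdd_below {eof_pure \<pi> |\<pi>. pure_state 2 \<pi> \<and> psd 4 (\<sigma> - \<pi>)}"
    by (rule bdd_belowI[of _ 0]) (auto simp: eof_pure_def)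
qed (use assms in blast)

text \<open>Stated for every \<sigma> above \<open>pi_bs\<close>. With K the identity it also
  supplies the upper bound on the entanglement of formation of \<sigma> itself.\<close>

lemma eof_passive_output_le:
  assumes r: "0 \<le> r1" "0 \<le> r2" and \<sigma>: "\<sigma> \<in> carrier_mat 4 4" "\<sigma>\<^sup>T = \<sigma>"
    and ge: "\<And>x. x \<in> carrier_vec 4 \<Longrightarrow> x \<bullet> (pi_bs r1 r2 *\<^sub>v x) \<le> x \<bullet> (\<sigma> *\<^sub>v x)"
    and K: "passive_transf 4 K"
  shows "eof (trace_out_ancillas (K * diag_block_mat [\<sigma>, 1\<^sub>m 4] * K\<^sup>T)) \<le> h0 (r1 + r2)"
proof -
  let ?z = "0\<^sub>m 4 4 :: real mat"
  define S where "S = four_block_mat \<sigma> ?z ?z (1\<^sub>m 4)"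
  have S: "S \<in> carrier_mat 8 8" "S\<^sup>T = S"
    using \<sigma> transpose_block_diag[OF \<sigma>(1) one_carrier_mat[of 4]] by (auto simp: S_def)
  have S_eq: "diag_block_mat [\<sigma>, 1\<^sub>m 4] = S"
    unfolding S_def by (rule diag_block_mat_pair[OF \<sigma>(1) one_carrier_mat])
  note k = passive_transf_transpose[OF K, simplified]
  define Q where "Q = four_block_mat (pi_bs r1 r2) ?z ?z (1\<^sub>m 4)"
  have gQ: "gaussian_state 4 Q"
    using gaussian_state_block_diag[OF pure_stateD(1)[OF pi_bs_pure] gaussian_state_one[of 2]]
    by (simp add: Q_def)
  have cQ: "Q \<in> carrier_mat 8 8" using gQ by (simp add: gaussian_state_def)
  have sQ: "Q * Omega 4 * Q = Omega 4"
  proof -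
    have c: "pi_bs r1 r2 * Omega 2 \<in> carrier_mat 4 4" by (rule mult_carrier_mat[of _ 4 4]) auto
    have "Omega 4 = four_block_mat (Omega 2) ?z ?z (Omega 2)" using Omega_add[of 2 2] by simp
    then show ?thesis
      unfolding Q_def using c
      by (simp add: mult_block_diag[of _ 4 _ _ 4] pi_bs_symplectic left_mult_one_mat[OF Omega_2_carrier]
          right_mult_one_mat[OF Omega_2_carrier])
  qed
  have dQ: "det Q = 1"
    unfolding Q_def using pure_stateD(4)[OF pi_bs_pure]
    by (simp add: det_four_block_mat_lower_left_zero[of _ 4 _ 4])
  define P where "P = K * Q * K\<^sup>T"
  have gP: "gaussian_state (2 + 2) P" and sP: "P * Omega (2 + 2) * P = Omega (2 + 2)" and dP: "det P = 1"
    unfolding P_def using passive_congruence[OF K, of Q] gQ sQ dQ cQ by simp_all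
  obtain p where p: "pure_state 2 p"
    and p_ge: "\<And>f. f \<in> carrier_vec 4 \<Longrightarrow>
      \<exists>k \<in> carrier_vec 4. (f @\<^sub>v k) \<bullet> (P *\<^sub>v (f @\<^sub>v k)) \<le> f \<bullet> (p *\<^sub>v f)"
    and p_le: "\<And>f. f \<in> carrier_vec 4 \<Longrightarrow>
      f \<bullet> (p *\<^sub>v f) \<le> (f @\<^sub>v 0\<^sub>v 4) \<bullet> (P *\<^sub>v (f @\<^sub>v 0\<^sub>v 4))"
    using heterodyne_conditional_state[OF gP sP dP] by auto
  define X where "X = K * S * K\<^sup>T"
  have X: "X \<in> carrier_mat 8 8" "X\<^sup>T = X"
    using S k(1) unfolding X_def
    by (auto simp: transpose_mult[of _ 8 8 _ 8] assoc_mult_mat[of _ 8 8 _ 8 _ 8] mult_carrier_mat[of _ 8 8 _ 8])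
  define t where "t = trace_out_ancillas X"
  have t: "t \<in> carrier_mat 4 4" "t\<^sup>T = t"
    using sym_index[OF X] by (auto simp: t_def trace_out_ancillas_def intro!: eq_matI)
  have "psd 4 (t - p)"
    unfolding psd_minus_iff[OF t pure_state_2D(2,3)[OF p]]
  proof
    fix f :: "real vec" assume f: "f \<in> carrier_vec 4"
    define y where "y = K\<^sup>T *\<^sub>v (f @\<^sub>v 0\<^sub>v 4)"
    have f0: "f @\<^sub>v 0\<^sub>v 4 \<in> carrier_vec 8" using append_carrier_vec[OF f zero_carrier_vec[of 4]] by simp
    have y: "y \<in> carrier_vec (4 + 4)" unfolding y_def by (rule mult_mat_vec_carrier) (use k(1) f0 in auto)
    then obtain y1 y2 where y12: "y1 \<in> carrier_vec 4" "y2 \<in> carrier_vec 4" "y = y1 @\<^sub>v y2"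
      by (rule vec_append_split)
    \<comment> \<open>The transpose of K carries the padded vector to y, where \<sigma> dominates
      \<open>pi_bs\<close> on the first two modes and the ancillas of Q and S agree.\<close>
    have "f \<bullet> (p *\<^sub>v f) \<le> y \<bullet> (Q *\<^sub>v y)"
      using p_le[OF f] unfolding P_def y_def congruence_quadratic_form[OF k(1) cQ f0 f0] .
    also have "\<dots> = y1 \<bullet> (pi_bs r1 r2 *\<^sub>v y1) + y2 \<bullet> (1\<^sub>m 4 *\<^sub>v y2)"
      unfolding Q_def y12(3) using y12 by (intro block_diag_quadratic_form) auto
    also have "\<dots> \<le> y1 \<bullet> (\<sigma> *\<^sub>v y1) + y2 \<bullet> (1\<^sub>m 4 *\<^sub>v y2)"
      using ge[OF y12(1)] by simp
    also have "\<dots> = y \<bullet> (S *\<^sub>v y)"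
      unfolding S_def y12(3) using y12 \<sigma> by (intro block_diag_quadratic_form[symmetric]) auto
    also have "\<dots> = (f @\<^sub>v 0\<^sub>v 4) \<bullet> (X *\<^sub>v (f @\<^sub>v 0\<^sub>v 4))"
      unfolding X_def y_def congruence_quadratic_form[OF k(1) S(1) f0 f0] ..
    also have "\<dots> = f \<bullet> (t *\<^sub>v f)"
      using quadratic_form_upper_left_block[of X 4 4 f] X f by (simp add: t_def trace_out_ancillas_def)
    finally show "f \<bullet> (p *\<^sub>v f) \<le> f \<bullet> (t *\<^sub>v f)" .
  qed
  then have "eof t \<le> eof_pure p" by (rule eof_le_eof_pure[OF p])
  also have "\<dots> \<le> h0 (r1 + r2)"
  proof -
    obtain s where s: "0 \<le> s" "seralian_pt p = 2 * cosh (2 * s)" "eof_pure p = h0 s"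
      using pure_state_two_mode_squeezing[OF p] .
    define d where "d i = (if i < 4 then [exp (-2 * r1), exp (2 * r1), exp (2 * r2), exp (-2 * r2)] ! i else 1)" for i :: nat
    define W where "W = four_block_mat K_bs ?z ?z (1\<^sub>m 4)"
    have W: "passive_transf 4 W"
      using passive_transf_block_diag[OF K_bs_passive passive_transf_one[of 2]] by (simp add: W_def)
    note w = passive_transf_transpose[OF W, simplified]
    define U where "U = K * W"
    have U: "U \<in> carrier_mat 8 8" "U * U\<^sup>T = 1\<^sub>m 8"
      using passive_transf_transpose[OF passive_transf_mult[OF K W]] by (simp_all add: U_def)
    have P_eq: "P = U * mat_diag 8 d * U\<^sup>T"
    proof -
      have diag: "mat_diag 8 d = four_block_mat (pi_d r1 r2) ?z ?z (1\<^sub>m 4)"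
        by (rule eq_matI) (auto simp: mat_diag_def pi_d_def d_def)
      have c: "K_bs * pi_d r1 r2 \<in> carrier_mat 4 4" by (rule mult_carrier_mat[of _ 4 4]) auto
      have "Q = W * mat_diag 8 d * W\<^sup>T"
        unfolding Q_def W_def diag pi_bs_def transpose_block_diag[OF K_bs_carrier one_carrier_mat]
        using c by (simp add: mult_block_diag[of _ 4 _ _ 4])
      moreover have "U\<^sup>T = W\<^sup>T * K\<^sup>T"
        unfolding U_def using k(1) w(1) by (rule transpose_mult)
      ultimately show ?thesis
        unfolding P_def U_def using k(1) w(1)
        by (simp add: assoc_mult_mat[of _ 8 8 _ 8 _ 8] mult_carrier_mat[of _ 8 8 _ 8])
    qed
    \<comment> \<open>This form ignores ancilla components, so the ancilla vectors supplied by
      \<open>p_ge\<close> can be appended without changing its value.\<close>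
    define J where "J = four_block_mat Omega_pt ?z ?z ?z"
    have J: "J \<in> carrier_mat 8 8" by (auto simp: J_def)
    have JT: "J\<^sup>T = - J"
      unfolding J_def transpose_block_diag[OF Omega_pt_carrier zero_carrier_mat] Omega_pt_transpose
      by (rule eq_matI) auto
    have J_form: "(x1 @\<^sub>v x2) \<bullet> (J *\<^sub>v (y1 @\<^sub>v y2)) = x1 \<bullet> (Omega_pt *\<^sub>v y1)"
      if "x1 \<in> carrier_vec 4" "x2 \<in> carrier_vec 4" "y1 \<in> carrier_vec 4" "y2 \<in> carrier_vec 4" for x1 x2 y1 y2
    proof -
      have "?z *\<^sub>v y2 = 0\<^sub>v 4" using that by (intro eq_vecI) auto
      then show ?thesis
        unfolding J_def using that by (simp add: block_diag_quadratic_form[of _ 4 _ 4])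
    qed
    have contr: "(J *\<^sub>v y) \<bullet> (J *\<^sub>v y) \<le> y \<bullet> y" if y: "y \<in> carrier_vec 8" for y
    proof -
      have "y \<in> carrier_vec (4 + 4)" using y by simp
      then obtain y1 y2 where y12: "y1 \<in> carrier_vec 4" "y2 \<in> carrier_vec 4" "y = y1 @\<^sub>v y2"
        by (rule vec_append_split)
      have c: "Omega_pt *\<^sub>v y1 \<in> carrier_vec 4" by (rule mult_mat_vec_carrier[OF Omega_pt_carrier y12(1)])
      have z: "?z *\<^sub>v y2 = 0\<^sub>v 4" "?z *\<^sub>v y1 = 0\<^sub>v 4" using y12 by (auto intro!: eq_vecI)
      have "J *\<^sub>v y = (Omega_pt *\<^sub>v y1) @\<^sub>v 0\<^sub>v 4"
        unfolding J_def y12(3)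
          four_block_mat_mult_vec[OF Omega_pt_carrier zero_carrier_mat zero_carrier_mat zero_carrier_mat y12(1,2)] z
        using c by simp
      then have "(J *\<^sub>v y) \<bullet> (J *\<^sub>v y) = (Omega_pt *\<^sub>v y1) \<bullet> (Omega_pt *\<^sub>v y1)"
        using scalar_prod_append[OF c zero_carrier_vec[of 4] c zero_carrier_vec[of 4]] by simp
      also have "\<dots> \<le> y1 \<bullet> y1 + y2 \<bullet> y2"
        using Omega_pt_contraction[OF y12(1)] scalar_prod_self_nonneg[of y2] by simp
      also have "\<dots> = y \<bullet> y"
        unfolding y12(3) using scalar_prod_append[OF y12(1,2) y12(1,2)] by simp
      finally show ?thesis .
    qed
    have d0: "0 \<le> d i" for i
      by (auto simp: d_def less_Suc_eq numeral_eq_Suc)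
    \<comment> \<open>The eight eigenvalues are those of the squeezed state and four ones. As r1 and
      r2 are nonnegative, the smallest product of two of them is exp(-2 r1) exp(-2 r2).\<close>
    have gap: "(exp (- (r1 + r2)))\<^sup>2 \<le> d i * d j" if "i < 8" "j < 8" "i \<noteq> j" for i j
      using that r
      by (simp add: d_def less_Suc_eq numeral_eq_Suc exp_double[symmetric] flip: exp_add)
    have "s \<le> r1 + r2"
    proof (rule two_mode_squeezing_le[OF p s(1,2)])
      show "0 \<le> r1 + r2" using r by simp
      fix f g :: "real vec" assume f: "f \<in> carrier_vec 4" and g: "g \<in> carrier_vec 4"
      obtain k where k: "k \<in> carrier_vec 4" "(f @\<^sub>v k) \<bullet> (P *\<^sub>v (f @\<^sub>v k)) \<le> f \<bullet> (p *\<^sub>v f)"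
        using p_ge[OF f] by blast
      obtain l where l: "l \<in> carrier_vec 4" "(g @\<^sub>v l) \<bullet> (P *\<^sub>v (g @\<^sub>v l)) \<le> g \<bullet> (p *\<^sub>v g)"
        using p_ge[OF g] by blast
      have c: "f @\<^sub>v k \<in> carrier_vec 8" "g @\<^sub>v l \<in> carrier_vec 8"
        using append_carrier_vec[OF f k(1)] append_carrier_vec[OF g l(1)] by simp_all
      show "2 * (exp (- (r1 + r2)) * (f \<bullet> (Omega_pt *\<^sub>v g))) \<le> f \<bullet> (p *\<^sub>v f) + g \<bullet> (p *\<^sub>v g)"
      proof -
        have "2 * (exp (- (r1 + r2)) * ((f @\<^sub>v k) \<bullet> (J *\<^sub>v (g @\<^sub>v l)))) \<le>
            (f @\<^sub>v k) \<bullet> (P *\<^sub>v (f @\<^sub>v k)) + (g @\<^sub>v l) \<bullet> (P *\<^sub>v (g @\<^sub>v l))"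
          unfolding P_eq by (rule orthogonal_diag_bound[OF J JT contr U d0 gap c])
        then show ?thesis unfolding J_form[OF f k(1) g l(1)] using k(2) l(2) by linarith
      qed
    qed
    then show ?thesis using s(1,3) h0_mono by simp
  qed
  finally show ?thesis unfolding S_eq t_def X_def .
qed

section \<open>Pure states below \<sigma>_sp\<close>

lemma sigma_sp_ge_pi_bs:
  assumes "0 \<le> l1" "0 \<le> l2" and x: "x \<in> carrier_vec 4"
  shows "x \<bullet> (pi_bs r1 r2 *\<^sub>v x) \<le> x \<bullet> (sigma_sp r1 r2 l1 l2 \<alpha> \<theta> *\<^sub>v x)"
proof -
  have "x \<bullet> (pi_bs r1 r2 *\<^sub>v x) = (K_bs\<^sup>T *\<^sub>v x) \<bullet> (pi_d r1 r2 *\<^sub>v (K_bs\<^sup>T *\<^sub>v x))"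
    unfolding pi_bs_def using x by (intro congruence_quadratic_form[of _ 4 4]) auto
  then show ?thesis
    unfolding sigma_sp_quadratic_form[OF x] using assms(1,2) by simp
qed

text \<open>Before the beam splitter the complement of the noise plane is spanned by (1, 0,
  -\<alpha>, 0) and (0, -\<alpha>, 0, 1) for every \<theta>. The vectors built from u and v are
  their images behind it, so only the squeezed state contributes to these variances.\<close>

lemma sigma_sp_noiseless_directions:
  fixes \<alpha> \<theta> :: real
  defines "u \<equiv> (1 - \<alpha>) / sqrt 2" and "v \<equiv> (1 + \<alpha>) / sqrt 2"
  shows "vec_of_list [u, 0, - v, 0] \<bullet> (sigma_sp r1 r2 l1 l2 \<alpha> \<theta> *\<^sub>v vec_of_list [u, 0, - v, 0]) =
      exp (-2 * r1) + \<alpha>\<^sup>2 * exp (2 * r2)"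
    and "vec_of_list [0, u, 0, v] \<bullet> (sigma_sp r1 r2 l1 l2 \<alpha> \<theta> *\<^sub>v vec_of_list [0, u, 0, v]) =
      \<alpha>\<^sup>2 * exp (2 * r1) + exp (-2 * r2)"
proof -
  have c: "vec_of_list [a0, a1, a2, a3] \<in> carrier_vec 4" for a0 a1 a2 a3 :: real
    by (rule carrier_vecI) simp
  have uv: "(u + v) / sqrt 2 = 1" "(u - v) / sqrt 2 = - \<alpha>" "(v + u) / sqrt 2 = 1" "(v - u) / sqrt 2 = \<alpha>"
    by (simp_all add: u_def v_def add_divide_distrib[symmetric] diff_divide_distrib[symmetric])
  have 1: "K_bs\<^sup>T *\<^sub>v vec_of_list [u, 0, - v, 0] = vec_of_list [1, 0, - \<alpha>, 0]"
    unfolding K_bs_transpose_mult_vec using uv by simp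
  have 2: "K_bs\<^sup>T *\<^sub>v vec_of_list [0, u, 0, v] = vec_of_list [0, - \<alpha>, 0, 1]"
    unfolding K_bs_transpose_mult_vec using uv by simp
  have orth: "v1 \<alpha> \<theta> \<bullet> vec_of_list [1, 0, - \<alpha>, 0] = 0" "v2 \<alpha> \<theta> \<bullet> vec_of_list [1, 0, - \<alpha>, 0] = 0"
    "v1 \<alpha> \<theta> \<bullet> vec_of_list [0, - \<alpha>, 0, 1] = 0" "v2 \<alpha> \<theta> \<bullet> vec_of_list [0, - \<alpha>, 0, 1] = 0"
    by (simp_all add: v1_def v2_def)
  show "vec_of_list [u, 0, - v, 0] \<bullet> (sigma_sp r1 r2 l1 l2 \<alpha> \<theta> *\<^sub>v vec_of_list [u, 0, - v, 0]) =
      exp (-2 * r1) + \<alpha>\<^sup>2 * exp (2 * r2)"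
    unfolding sigma_sp_quadratic_form[OF c] 1 orth pi_d_quadratic_form by simp
  show "vec_of_list [0, u, 0, v] \<bullet> (sigma_sp r1 r2 l1 l2 \<alpha> \<theta> *\<^sub>v vec_of_list [0, u, 0, v]) =
      \<alpha>\<^sup>2 * exp (2 * r1) + exp (-2 * r2)"
    unfolding sigma_sp_quadratic_form[OF c] 2 orth pi_d_quadratic_form by simp
qed

lemma squeezing_below_sigma_sp:
  assumes r: "0 \<le> r1" "0 \<le> r2" and \<alpha>: "\<bar>\<alpha>\<bar> \<le> exp (- r1 - r2)"
    and p: "pure_state 2 p" "psd 4 (sigma_sp r1 r2 l1 l2 \<alpha> \<theta> - p)"
    and s: "0 \<le> s" "seralian_pt p = 2 * cosh (2 * s)"
  shows "r1 + r2 \<le> s"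
proof (rule two_mode_squeezing_ge[OF p(1) s])
  have le: "x \<bullet> (p *\<^sub>v x) \<le> x \<bullet> (sigma_sp r1 r2 l1 l2 \<alpha> \<theta> *\<^sub>v x)" if "x \<in> carrier_vec 4" for x
    using p(2) that psd_minus_iff[OF sigma_sp_carrier sigma_sp_sym pure_state_2D(2,3)[OF p(1)]] by simp
  have c: "vec_of_list [a0, a1, a2, a3] \<in> carrier_vec 4" for a0 a1 a2 a3 :: real
    by (rule carrier_vecI) simp
  let ?u = "(1 - \<alpha>) / sqrt 2" and ?v = "(1 + \<alpha>) / sqrt 2"
  show "vec_of_list [?u, 0, - ?v, 0] \<bullet> (p *\<^sub>v vec_of_list [?u, 0, - ?v, 0]) \<le>
      exp (-2 * r1) + \<alpha>\<^sup>2 * exp (2 * r2)"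
    using le[OF c] sigma_sp_noiseless_directions(1) by metis
  show "vec_of_list [0, ?u, 0, ?v] \<bullet> (p *\<^sub>v vec_of_list [0, ?u, 0, ?v]) \<le>
      \<alpha>\<^sup>2 * exp (2 * r1) + exp (-2 * r2)"
    using le[OF c] sigma_sp_noiseless_directions(2) by metis
  \<comment> \<open>The two factors are exp(r2 - r1) and exp(r1 - r2) times exp(-r) + \<alpha>^2 exp
    r with r = r1 + r2, so the imbalance of the squeezing parameters cancels.\<close>
  show "(exp (-2 * r1) + \<alpha>\<^sup>2 * exp (2 * r2)) * (\<alpha>\<^sup>2 * exp (2 * r1) + exp (-2 * r2)) =
      (exp (- (r1 + r2)) + \<alpha>\<^sup>2 * exp (r1 + r2))\<^sup>2"
  proof -
    have e: "exp (2 * x) = exp x * exp x" "exp (-2 * x) = inverse (exp x * exp x)" for x :: real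
      by (simp_all flip: exp_add exp_minus)
    show ?thesis
      unfolding e exp_minus exp_add by (simp add: power2_eq_square field_simps)
  qed
qed (use r \<alpha> in simp_all)

theorem mainTheorem1:
  fixes r1 r2 l1 l2 \<alpha> \<theta> :: real
  assumes "0 \<le> r1" and "0 \<le> r2"
    and "0 \<le> l1" and "l1 \<le> l2"
    and "\<bar>\<alpha>\<bar> \<le> exp (- r1 - r2)"
    and "0 \<le> \<theta>" and "\<theta> < 2 * pi"
  shows "eof (sigma_sp r1 r2 l1 l2 \<alpha> \<theta>) = eof_potential (sigma_sp r1 r2 l1 l2 \<alpha> \<theta>) \<and>
    eof_potential (sigma_sp r1 r2 l1 l2 \<alpha> \<theta>) = h0 (sof 2 (sigma_sp r1 r2 l1 l2 \<alpha> \<theta>))"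
proof -
  define \<sigma> where "\<sigma> = sigma_sp r1 r2 l1 l2 \<alpha> \<theta>"
  have \<sigma>: "\<sigma> \<in> carrier_mat 4 4" "\<sigma>\<^sup>T = \<sigma>"
    unfolding \<sigma>_def by (rule sigma_sp_carrier sigma_sp_sym)+
  have ge: "x \<bullet> (pi_bs r1 r2 *\<^sub>v x) \<le> x \<bullet> (\<sigma> *\<^sub>v x)" if "x \<in> carrier_vec 4" for x
    unfolding \<sigma>_def using assms that by (intro sigma_sp_ge_pi_bs) auto
  have pi: "psd 4 (\<sigma> - pi_bs r1 r2)"
    using ge psd_minus_iff[OF \<sigma> pure_state_2D(2,3)[OF pi_bs_pure]] by simp
  \<comment> \<open>Every competitor has two-mode squeezing at least r1 + r2; this single fact gives
    the lower bounds for both minima.\<close>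
  have below: "\<exists>s. r1 + r2 \<le> s \<and> seralian_pt p = 2 * cosh (2 * s) \<and> eof_pure p = h0 s"
    if p: "pure_state 2 p" "psd 4 (\<sigma> - p)" for p
    using pure_state_two_mode_squeezing[OF p(1)]
      squeezing_below_sigma_sp[OF assms(1,2,5) p[unfolded \<sigma>_def]] by metis
  have sof: "sof 2 \<sigma> = r1 + r2"
    unfolding sof_def
  proof (rule cInf_eq_minimum)
    show "r1 + r2 \<in> {sof_pure 2 \<pi> |\<pi>. pure_state 2 \<pi> \<and> psd (2 * 2) (\<sigma> - \<pi>)}"
      using pi pi_bs_pure sof_pure_pi_bs[OF assms(1,2)] by force
    fix y assume "y \<in> {sof_pure 2 \<pi> |\<pi>. pure_state 2 \<pi> \<and> psd (2 * 2) (\<sigma> - \<pi>)}"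
    then obtain p where p: "y = sof_pure 2 p" "pure_state 2 p" "psd 4 (\<sigma> - p)" by auto
    \<comment> \<open>The total squeezing of p dominates its two-mode squeezing s, which in turn is
      at least r1 + r2.\<close>
    from below[OF p(2,3)] obtain s where s: "r1 + r2 \<le> s" "seralian_pt p = 2 * cosh (2 * s)" by blast
    then show "r1 + r2 \<le> y"
      using two_mode_squeezing_le_sof_pure[OF p(2) _ s(2)] p(1) assms(1,2) by simp
  qed
  have eof_ge: "h0 (r1 + r2) \<le> eof \<sigma>"
    unfolding eof_def
  proof (rule cInf_greatest)
    show "{eof_pure \<pi> |\<pi>. pure_state 2 \<pi> \<and> psd 4 (\<sigma> - \<pi>)} \<noteq> {}" using pi pi_bs_pure by blast
    fix y assume "y \<in> {eof_pure \<pi> |\<pi>. pure_state 2 \<pi> \<and> psd 4 (\<sigma> - \<pi>)}"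
    then show "h0 (r1 + r2) \<le> y" using below h0_mono[of "r1 + r2"] assms(1,2) by force
  qed
  note output_le = eof_passive_output_le[OF assms(1,2) \<sigma> ge]
  \<comment> \<open>The identity returns \<sigma>, which turns the bound on outputs into the upper
    bound matching \<open>eof_ge\<close>.\<close>
  have one: "trace_out_ancillas (1\<^sub>m 8 * diag_block_mat [\<sigma>, 1\<^sub>m 4] * (1\<^sub>m 8)\<^sup>T) = \<sigma>"
  proof -
    have c: "four_block_mat \<sigma> (0\<^sub>m 4 4) (0\<^sub>m 4 4) (1\<^sub>m 4) \<in> carrier_mat 8 8"
      using four_block_carrier_mat[OF \<sigma>(1) one_carrier_mat[of 4]] by simp
    have "1\<^sub>m 8 * diag_block_mat [\<sigma>, 1\<^sub>m 4] * (1\<^sub>m 8)\<^sup>T =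
        four_block_mat \<sigma> (0\<^sub>m 4 4) (0\<^sub>m 4 4) (1\<^sub>m 4)"
      unfolding diag_block_mat_pair[OF \<sigma>(1) one_carrier_mat]
      by (simp add: left_mult_one_mat[OF c] right_mult_one_mat[OF c])
    then show ?thesis
      unfolding trace_out_ancillas_def using \<sigma>(1) by (intro eq_matI) auto
  qed
  have id: "passive_transf 4 (1\<^sub>m 8)" using passive_transf_one[of 4] by simp
  have eof: "eof \<sigma> = h0 (r1 + r2)"
    using output_le[OF _ id] eof_ge unfolding one by simp
  have "eof_potential \<sigma> = h0 (r1 + r2)"
    unfolding eof_potential_def
  \<comment> \<open>The supremum is a maximum attained at the identity, so its value follows from
    membership and the uniform output bound.\<close>
  proof (rule cSup_eq_maximum)
    show "h0 (r1 + r2) \<in>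
        {eof (trace_out_ancillas (K * diag_block_mat [\<sigma>, 1\<^sub>m 4] * K\<^sup>T)) |K. passive_transf 4 K}"
      using id one eof by (intro CollectI exI[of _ "1\<^sub>m 8"]) simp
  qed (use output_le in blast)
  then show ?thesis using eof sof by (simp add: \<sigma>_def)
qed

end
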